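(* Let $\mathbb{K}$ be an algebraically closed field, let $d\le n-1$, let $L\subset\mathbb{K}^n$ be a $d$-dimensional linear subspace, and let $1\le s\le d-1$. Then the variety $\mathcal{K}_{s+1,d,n}$ is precisely the singular locus of $\mathcal{K}_{s,d,n}$. The codimension of $\mathcal{K}_{s,d,n}$ in $\mathbb{P}^{n^2-1}$ is $s(n-d)$, and the codimension of $\mathcal{K}_{s,d,n}$ in $\mathcal{K}_{s-1,d,n}$ equals $n-d$. In particular, the codimension of $\mathrm{Sing}(\mathcal{K}_{d,n})$ in $\mathcal{K}_{d,n}$ equals $n-d$, where $\mathcal{K}_{d,n}=\mathcal{K}_{1,d,n}$.
   Context: For $0\le s\le d$, $\mathcal{K}_{s,d,n}\subset\mathbb{P}^{n^2-1}=\mathbb{P}(\mathbb{K}^{n\times n})$ denotes the (reduced) closed subvariety of all $n\times n$-matrices $A$ (up to scaling) such that there is an $A$-invariant subspace of dimension $\ge s$ contained in $L$. In particular $\mathcal{K}_{0,d,n}=\mathbb{P}^{n^2-1}$, and $\mathcal{K}_{1,d,n}=\mathcal{K}_{d,n}$ is the Kalman variety of all matrices having a nonzero eigenvector in $L$. The singular locus is the set of singular points of the reduced variety. *)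

theory Defs
  imports
    "HOL-Analysis.Analysis"
    "HOL-Library.Poly_Mapping"
    "HOL-Computational_Algebra.Polynomial"
begin

section \<open>Multivariate polynomials\<close>

text \<open>
  Polynomials over \<open>'a\<close> in variables indexed by \<open>'i\<close>: finitely supported maps from exponent
  vectors to coefficients.
\<close>

type_synonym ('i, 'a) mpoly = "('i \<Rightarrow>\<^sub>0 nat) \<Rightarrow>\<^sub>0 'a"

definition mpoly_eval :: "('i::finite, 'a::comm_ring_1) mpoly \<Rightarrow> 'a ^ 'i \<Rightarrow> 'a" where
  "mpoly_eval f v =
     (\<Sum>m\<in>Poly_Mapping.keys f. Poly_Mapping.lookup f m *
        (\<Prod>i\<in>UNIV. (v $ i) ^ Poly_Mapping.lookup m i))"

text \<open>
  Formal partial derivative. The truncated subtraction of exponents is harmless: if the variable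
  does not occur in the monomial, the new coefficient is zero.
\<close>

definition mpoly_deriv :: "'i::finite \<Rightarrow> ('i, 'a::comm_ring_1) mpoly \<Rightarrow> ('i, 'a) mpoly" where
  "mpoly_deriv i f =
     (\<Sum>m\<in>Poly_Mapping.keys f.
        Poly_Mapping.single (m - Poly_Mapping.single i 1)
          (of_nat (Poly_Mapping.lookup m i) * Poly_Mapping.lookup f m))"

definition homogeneous :: "('i::finite, 'a::comm_ring_1) mpoly \<Rightarrow> bool" where
  "homogeneous f \<longleftrightarrow>
     (\<exists>k. \<forall>m\<in>Poly_Mapping.keys f. (\<Sum>i\<in>UNIV. Poly_Mapping.lookup m i) = k)"


section \<open>Projective space and its Zariski topology\<close>

text \<open>A point of the projective space of \<open>'a ^ 'i\<close> is a one-dimensional linear subspace.\<close>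

definition projective_space :: "('a::field ^ 'i::finite) set set" where
  "projective_space = {vec.span {v} | v. v \<noteq> 0}"

definition vanishes_at :: "('i::finite, 'a::field) mpoly \<Rightarrow> ('a ^ 'i) set \<Rightarrow> bool" where
  "vanishes_at f p \<longleftrightarrow> (\<forall>v\<in>p - {0}. mpoly_eval f v = 0)"

text \<open>
  The complements of hypersurfaces are a base of the Zariski topology (they are closed under finite
  intersections, by multiplying the equations), so its closed sets are exactly the common zero loci
  of sets of homogeneous polynomials.
\<close>

definition zariski :: "('a::field ^ 'i::finite) set topology" where
  "zariski = topology_generated_by
     {{p \<in> projective_space. \<not> vanishes_at f p} | f. homogeneous f}"


section \<open>Dimension and codimension\<close>

definition irreducible_closed :: "'p topology \<Rightarrow> 'p set \<Rightarrow> bool" where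
  "irreducible_closed T Z \<longleftrightarrow>
     closedin T Z \<and> Z \<noteq> {} \<and>
     (\<forall>A B. closedin T A \<and> closedin T B \<and> Z = A \<union> B \<longrightarrow> Z = A \<or> Z = B)"

text \<open>
  Krull dimension: the supremum of the lengths \<open>k\<close> of strict chains
  \<open>Z 0 \<subset> Z 1 \<subset> \<dots> \<subset> Z k\<close> of irreducible closed sets. The empty space gets
  dimension \<open>0\<close>.
\<close>

definition krull_dim :: "'p topology \<Rightarrow> enat" where
  "krull_dim T =
     Sup {enat k | k. \<exists>Z. (\<forall>j\<le>k. irreducible_closed T (Z j)) \<and> (\<forall>j<k. Z j \<subset> Z (Suc j))}"

definition zdim :: "('a::field ^ 'i::finite) set set \<Rightarrow> enat" where
  "zdim X = krull_dim (subtopology zariski X)"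

text \<open>
  Only meaningful for nonempty \<open>Y \<subseteq> X\<close>. Since \<open>\<infinity> - c = \<infinity>\<close> on \<^typ>\<open>enat\<close>, a finite value of
  the codimension entails that \<open>X\<close> has finite dimension.
\<close>

definition zcodim :: "('a::field ^ 'i::finite) set set \<Rightarrow> ('a ^ 'i) set set \<Rightarrow> enat" where
  "zcodim Y X = zdim X - zdim Y"


section \<open>Singular points\<close>

text \<open>
  The dimension of \<open>X\<close> at \<open>p\<close> is the largest dimension of an irreducible closed subset of \<open>X\<close>
  through \<open>p\<close>, equivalently of an irreducible component of \<open>X\<close> through \<open>p\<close>.
\<close>

definition local_dim :: "('a::field ^ 'i::finite) set set \<Rightarrow> ('a ^ 'i) set \<Rightarrow> enat" where
  "local_dim X p = Sup (zdim ` {Z. irreducible_closed (subtopology zariski X) Z \<and> p \<in> Z})"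

text \<open>The homogeneous elements of the radical ideal of \<open>X\<close>, i.e. of \<open>X\<close> with reduced structure.\<close>

definition vanishing_forms :: "('a::field ^ 'i::finite) set set \<Rightarrow> ('i, 'a) mpoly set" where
  "vanishing_forms X = {f. homogeneous f \<and> (\<forall>p\<in>X. vanishes_at f p)}"

text \<open>
  The linear subspace of \<open>'a ^ 'i\<close> whose projectivization is the embedded projective tangent space
  of \<open>X\<close> at \<open>p\<close>. It contains the line \<open>p\<close> itself (Euler's identity), so its dimension exceeds the
  dimension of the Zariski tangent space of \<open>X\<close> at \<open>p\<close> by one.
\<close>

definition tangent_cone_space ::
    "('a::field ^ 'i::finite) set set \<Rightarrow> ('a ^ 'i) set \<Rightarrow> ('a ^ 'i) set" where
  "tangent_cone_space X p =
     {w. \<forall>f\<in>vanishing_forms X. \<forall>v\<in>p - {0}.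
           (\<Sum>i\<in>UNIV. mpoly_eval (mpoly_deriv i f) v * w $ i) = 0}"

definition tangent_dim :: "('a::field ^ 'i::finite) set set \<Rightarrow> ('a ^ 'i) set \<Rightarrow> nat" where
  "tangent_dim X p = vec.dim (tangent_cone_space X p) - 1"

definition singular_locus :: "('a::field ^ 'i::finite) set set \<Rightarrow> ('a ^ 'i) set set" where
  "singular_locus X = {p \<in> X. local_dim X p < enat (tangent_dim X p)}"


section \<open>Kalman varieties\<close>

text \<open>
  Square matrices as coordinate vectors indexed by pairs, so that the projective space of
  \<open>n \<times> n\<close> matrices is \<^const>\<open>projective_space\<close> over \<open>'a ^ ('n \<times> 'n)\<close>.
\<close>

definition mat_coords :: "'a ^ 'n ^ 'n \<Rightarrow> 'a ^ ('n::finite \<times> 'n)" where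
  "mat_coords A = (\<chi> ij. A $ fst ij $ snd ij)"

definition kalman :: "nat \<Rightarrow> ('a::field ^ 'n::finite) set \<Rightarrow> ('a ^ ('n \<times> 'n)) set set" where
  "kalman s L =
     {vec.span {mat_coords A} | A. A \<noteq> 0 \<and>
        (\<exists>U. vec.subspace U \<and> (\<forall>u\<in>U. A *v u \<in> U) \<and> s \<le> vec.dim U \<and> U \<subseteq> L)}"

definition kalman_variety :: "('a::field ^ 'n::finite) set \<Rightarrow> ('a ^ ('n \<times> 'n)) set set" where
  "kalman_variety L =
     {vec.span {mat_coords A} | A. A \<noteq> 0 \<and> (\<exists>v\<in>L. v \<noteq> 0 \<and> (\<exists>c. A *v v = c *s v))}"

end

theory Submission
  imports Defs "HOL-Library.Function_Algebras"
begin

text \<open>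
  Let \<open>U(A)\<close> be the largest \<open>A\<close>-invariant subspace of \<open>L\<close>, that is \<open>{v. \<forall>j. A\<^sup>j v \<in> L}\<close>, so that
  \<open>K\<^sub>s\<close> is the locus \<open>dim U(A) \<ge> s\<close>.

  Dimensions. Let \<open>Z\<^sub>0 \<subset> \<dots> \<subset> Z\<^sub>m\<close> be irreducible closed sets, let the form \<open>f\<^sub>i\<close> vanish on \<open>Z\<^sub>i\<^sub>-\<^sub>1\<close>
  but not on \<open>Z\<^sub>i\<close>, and let \<open>f\<^sub>0\<close> be a coordinate that does not vanish on \<open>Z\<^sub>0\<close>. The monomials of a given
  degree in \<open>f\<^sub>0, \<dots>, f\<^sub>m\<close> are linearly independent on \<open>Z\<^sub>m\<close>, and counting them bounds \<open>m\<close> by the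
  dimension \<open>N\<close> of the ambient projective space. A single chain of length \<open>N\<close> through \<open>K\<^sub>s\<close> therefore
  determines \<open>dim K\<^sub>s\<close>. It consists of linear spaces up to \<open>{A. A L\<^sub>s \<subseteq> L\<^sub>s}\<close>, followed by the loci
  \<open>{A. dim U\<^sub>k(A) \<ge> s \<and> dim U\<^sub>k\<^sub>-\<^sub>1(A) \<ge> j}\<close> for \<open>k > s\<close> and \<open>j = s, \<dots>, 0\<close>, where \<open>L\<^sub>s \<subset> \<dots> \<subset> L\<^sub>n\<close> is
  a flag through \<open>L\<close> and \<open>U\<^sub>k\<close> refers to \<open>L\<^sub>k\<close>. Any two points of such a locus lie on a polynomial
  curve \<open>g(t) b(t) adj g(t)\<close> inside it, whence it is irreducible.

  Singularities. If \<open>A\<close> has distinct eigenvalues on an invariant subspace \<open>U \<subseteq> L\<close> of dimension \<open>s + 1\<close>,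
  then every matrix is a sum of matrices \<open>M\<close> that kill some \<open>A\<close>-invariant hyperplane of \<open>U\<close>; as \<open>A + t M\<close>
  stays in \<open>K\<^sub>s\<close>, every form vanishing on \<open>K\<^sub>s\<close> has differential zero at \<open>A\<close>, and a perturbation
  extends this to all of \<open>K\<^sub>s\<^sub>+\<^sub>1\<close>. If \<open>dim U(A) = s\<close>, the equations \<open>det (\<Sum>j. Q\<^sub>j X\<^sup>j + R) = 0\<close>, where
  \<open>Q\<^sub>j\<close> kills \<open>L\<close> and \<open>rank R < s\<close>, show that a tangent vector \<open>B\<close> at \<open>A\<close> admits some
  \<open>C : U(A) \<rightarrow> L\<close> with \<open>A C - C A - B\<close> mapping \<open>U(A)\<close> into itself; this is a space of codimension
  \<open>s (n - d)\<close>.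
\<close>

section \<open>Algebraically closed fields are infinite\<close>

text \<open>Over a finite field the product of all \<open>[:-x, 1:]\<close>, increased by 1, has
  positive degree but takes only the value 1.\<close>

lemma infinite_UNIV_alg_closed: "infinite (UNIV :: 'a::alg_closed_field set)"
proof
  assume fin: "finite (UNIV :: 'a set)"
  define p :: "'a poly" where "p = (\<Prod>x\<in>UNIV. [:-x, 1:])"
  have "degree p = card (UNIV :: 'a set)"
    unfolding p_def by (subst degree_prod_sum_eq) auto
  then have "degree p > 0"
    using fin by (simp add: card_gt_0_iff)
  then have "degree (p + 1) > 0"
    by (simp add: degree_add_eq_left)
  then obtain x where x: "poly (p + 1) x = 0"
    using alg_closed_imp_poly_has_root by blast
  have "poly p x = 0"
    unfolding p_def poly_prod using fin by (auto simp: prod_zero_iff)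
  with x show False by simp
qed

text \<open>The device behind every genericity argument below: a polynomial identity in one
  parameter may be checked away from finitely many bad values.\<close>

lemma poly_eq_0_if_cofinitely_zero:
  fixes p :: "'a::alg_closed_field poly"
  assumes "finite E" and "\<And>t. t \<notin> E \<Longrightarrow> poly p t = 0"
  shows "p = 0"
proof (rule ccontr)
  assume "p \<noteq> 0"
  then have "finite {t. poly p t = 0}" by (rule poly_roots_finite)
  moreover have "UNIV \<subseteq> E \<union> {t. poly p t = 0}" using assms(2) by auto
  ultimately show False
    using assms(1) infinite_UNIV_alg_closed[where 'a='a] by (meson finite_UnI finite_subset)
qed

lemma poly_eqI_cofinite:
  fixes p q :: "'a::alg_closed_field poly"
  assumes "finite E" and "\<And>t. t \<notin> E \<Longrightarrow> poly p t = poly q t"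
  shows "p = q"
  using poly_eq_0_if_cofinitely_zero[of E "p - q"] assms by simp

section \<open>Polynomial functions and forms\<close>

lemma mpoly_eval_superset:
  assumes "finite S" and "Poly_Mapping.keys f \<subseteq> S"
  shows "mpoly_eval f v =
    (\<Sum>m\<in>S. Poly_Mapping.lookup f m * (\<Prod>i\<in>UNIV. (v $ i) ^ Poly_Mapping.lookup m i))"
  unfolding mpoly_eval_def using assms
  by (intro sum.mono_neutral_left) (auto simp: in_keys_iff)

lemma mpoly_eval_add: "mpoly_eval (f + g) v = mpoly_eval f v + mpoly_eval g v"
proof -
  let ?S = "Poly_Mapping.keys f \<union> Poly_Mapping.keys g"
  have "Poly_Mapping.keys (f + g) \<subseteq> ?S" by (rule Poly_Mapping.keys_add)
  then show ?thesis
    by (simp add: mpoly_eval_superset[of ?S] lookup_add distrib_right sum.distrib)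
qed

lemma mpoly_eval_zero [simp]: "mpoly_eval 0 v = 0"
  by (simp add: mpoly_eval_def)

lemma mpoly_eval_sum: "mpoly_eval (sum f I) v = (\<Sum>i\<in>I. mpoly_eval (f i) v)"
  by (induction I rule: infinite_finite_induct) (auto simp: mpoly_eval_add)

lemma mpoly_eval_single:
  "mpoly_eval (Poly_Mapping.single m c) v = c * (\<Prod>i\<in>UNIV. (v $ i) ^ Poly_Mapping.lookup m i)"
  by (subst mpoly_eval_superset[of "{m}"]) auto

lemma poly_mapping_eq_sum_single:
  "f = (\<Sum>m\<in>Poly_Mapping.keys f. Poly_Mapping.single m (Poly_Mapping.lookup f m))"
  by (rule poly_mapping_eqI)
     (auto simp: lookup_sum lookup_single when_def in_keys_iff)

lemma mpoly_eval_mult: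
  fixes f g :: "('i::finite, 'a::comm_ring_1) mpoly"
  shows "mpoly_eval (f * g) v = mpoly_eval f v * mpoly_eval g v"
proof -
  have single: "mpoly_eval (Poly_Mapping.single m c * Poly_Mapping.single m' c') v =
      mpoly_eval (Poly_Mapping.single m c) v * mpoly_eval (Poly_Mapping.single m' c') v"
    for m m' :: "'i \<Rightarrow>\<^sub>0 nat" and c c' :: 'a
    by (simp add: mult_single mpoly_eval_single lookup_add power_add prod.distrib)
  have "f * g = (\<Sum>m\<in>Poly_Mapping.keys f. \<Sum>m'\<in>Poly_Mapping.keys g.
      Poly_Mapping.single m (Poly_Mapping.lookup f m) * Poly_Mapping.single m' (Poly_Mapping.lookup g m'))"
    by (subst (1) poly_mapping_eq_sum_single[of f], subst (1) poly_mapping_eq_sum_single[of g])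
       (simp only: sum_product)
  then have "mpoly_eval (f * g) v = (\<Sum>m\<in>Poly_Mapping.keys f. \<Sum>m'\<in>Poly_Mapping.keys g.
      mpoly_eval (Poly_Mapping.single m (Poly_Mapping.lookup f m)) v *
      mpoly_eval (Poly_Mapping.single m' (Poly_Mapping.lookup g m')) v)"
    by (simp only: mpoly_eval_sum single)
  also have "\<dots> = mpoly_eval f v * mpoly_eval g v"
    unfolding mpoly_eval_single unfolding mpoly_eval_def by (simp only: sum_product)
  finally show ?thesis .
qed

definition mdegree :: "('i::finite \<Rightarrow>\<^sub>0 nat) \<Rightarrow> nat" where
  "mdegree m = (\<Sum>i\<in>UNIV. Poly_Mapping.lookup m i)"

text \<open>Polynomials are handled as functions, so that closure under sums, products and
  determinants can be proved without manipulating exponent vectors.\<close>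

definition polyfun :: "('a::comm_ring_1 ^ 'i::finite \<Rightarrow> 'a) \<Rightarrow> bool" where
  "polyfun F \<longleftrightarrow> (\<exists>f. F = mpoly_eval f)"

text \<open>Unlike \<open>homogeneous\<close>, this records the degree. The zero function is a form
  of every degree, which keeps each degree closed under addition.\<close>

definition formfun :: "nat \<Rightarrow> ('a::comm_ring_1 ^ 'i::finite \<Rightarrow> 'a) \<Rightarrow> bool" where
  "formfun k F \<longleftrightarrow> (\<exists>f. (\<forall>m\<in>Poly_Mapping.keys f. mdegree m = k) \<and> F = mpoly_eval f)"

lemma homogeneous_iff: "homogeneous f \<longleftrightarrow> (\<exists>k. \<forall>m\<in>Poly_Mapping.keys f. mdegree m = k)"
  by (simp add: homogeneous_def mdegree_def)

lemma mdegree_add: "mdegree (m + m') = mdegree m + mdegree m'"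
  by (simp add: mdegree_def lookup_add sum.distrib)

lemma formfun_imp_polyfun: "formfun k F \<Longrightarrow> polyfun F"
  by (auto simp: polyfun_def formfun_def)

lemma formfun_zero: "formfun k (\<lambda>v. 0)"
  unfolding formfun_def by (rule exI[of _ 0]) auto

lemma formfun_add:
  assumes "formfun k F" "formfun k G"
  shows "formfun k (\<lambda>v. F v + G v)"
proof -
  obtain f g where "\<forall>m\<in>Poly_Mapping.keys f. mdegree m = k" "F = mpoly_eval f"
    "\<forall>m\<in>Poly_Mapping.keys g. mdegree m = k" "G = mpoly_eval g"
    using assms by (auto simp: formfun_def)
  then show ?thesis unfolding formfun_def
    using Poly_Mapping.keys_add[of f g] by (intro exI[of _ "f + g"]) (auto simp: mpoly_eval_add)
qed

lemma formfun_mult: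
  assumes "formfun k F" "formfun l G"
  shows "formfun (k + l) (\<lambda>v. F v * G v)"
proof -
  obtain f g where "\<forall>m\<in>Poly_Mapping.keys f. mdegree m = k" "F = mpoly_eval f"
    "\<forall>m\<in>Poly_Mapping.keys g. mdegree m = l" "G = mpoly_eval g"
    using assms by (auto simp: formfun_def)
  then show ?thesis unfolding formfun_def
    using Poly_Mapping.keys_mult[of f g]
    by (intro exI[of _ "f * g"]) (auto simp: mpoly_eval_mult mdegree_add)
qed

lemma formfun_const: "formfun 0 (\<lambda>v. c)"
  unfolding formfun_def
  by (rule exI[of _ "Poly_Mapping.single 0 c"])
     (auto simp: mpoly_eval_single mdegree_def fun_eq_iff)

lemma formfun_cmult: "formfun k F \<Longrightarrow> formfun k (\<lambda>v. c * F v)"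
  using formfun_mult[OF formfun_const[of c], of k F] by simp

lemma formfun_coord:
  fixes i :: "'i::finite"
  shows "formfun 1 (\<lambda>v. v $ i)"
proof -
  have "(\<Prod>j\<in>UNIV. (v $ j) ^ Poly_Mapping.lookup (Poly_Mapping.single i 1) j) =
      (\<Prod>j\<in>UNIV. if j = i then v $ i else 1)" for v :: "'a::comm_ring_1 ^ 'i"
    by (intro prod.cong) (auto simp: lookup_single when_def)
  then show ?thesis unfolding formfun_def
    by (intro exI[of _ "Poly_Mapping.single (Poly_Mapping.single i 1) 1"])
       (auto simp: mpoly_eval_single mdegree_def fun_eq_iff lookup_single when_def)
qed

lemma formfun_sum: "(\<And>i. i \<in> I \<Longrightarrow> formfun k (F i)) \<Longrightarrow> formfun k (\<lambda>v. \<Sum>i\<in>I. F i v)"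
  by (induction I rule: infinite_finite_induct) (auto simp: formfun_zero formfun_add)

lemma formfun_power: "formfun k F \<Longrightarrow> formfun (k * j) (\<lambda>v. F v ^ j)"
  by (induction j) (use formfun_const in \<open>auto simp: formfun_mult\<close>)

lemma formfun_prod:
  assumes "\<And>i. i \<in> I \<Longrightarrow> formfun (k i) (F i)"
  shows "formfun (sum k I) (\<lambda>v. \<Prod>i\<in>I. F i v)"
  using assms by (induction I rule: infinite_finite_induct) (auto simp: formfun_const formfun_mult)

lemma polyfun_const: "polyfun (\<lambda>v. c)"
  using formfun_const formfun_imp_polyfun by blast

lemma polyfun_coord: "polyfun (\<lambda>v. v $ i)"
  using formfun_coord formfun_imp_polyfun by blast

lemma polyfun_add: "polyfun F \<Longrightarrow> polyfun G \<Longrightarrow> polyfun (\<lambda>v. F v + G v)"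
  unfolding polyfun_def by (auto simp: fun_eq_iff simp flip: mpoly_eval_add)

lemma polyfun_mult: "polyfun F \<Longrightarrow> polyfun G \<Longrightarrow> polyfun (\<lambda>v. F v * G v)"
  unfolding polyfun_def by (auto simp: fun_eq_iff simp flip: mpoly_eval_mult)

lemma polyfun_sum: "(\<And>i. i \<in> I \<Longrightarrow> polyfun (F i)) \<Longrightarrow> polyfun (\<lambda>v. \<Sum>i\<in>I. F i v)"
  by (induction I rule: infinite_finite_induct) (auto simp: polyfun_const polyfun_add)

lemma polyfun_prod: "(\<And>i. i \<in> I \<Longrightarrow> polyfun (F i)) \<Longrightarrow> polyfun (\<lambda>v. \<Prod>i\<in>I. F i v)"
  by (induction I rule: infinite_finite_induct) (auto simp: polyfun_const polyfun_mult)

lemma polyfun_det: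
  fixes M :: "'a::comm_ring_1 ^ 'i::finite \<Rightarrow> 'a ^ 'n::finite ^ 'n"
  assumes "\<And>i j. polyfun (\<lambda>v. M v $ i $ j)"
  shows "polyfun (\<lambda>v. det (M v))"
  unfolding det_def by (intro polyfun_sum polyfun_mult polyfun_const polyfun_prod assms)

lemma formfun_scale:
  assumes "formfun k F"
  shows "F (c *s v) = c ^ k * F v"
proof -
  obtain f where f: "\<forall>m\<in>Poly_Mapping.keys f. mdegree m = k" "F = mpoly_eval f"
    using assms by (auto simp: formfun_def)
  have "(\<Prod>i\<in>UNIV. ((c *s v) $ i) ^ Poly_Mapping.lookup m i) =
      c ^ mdegree m * (\<Prod>i\<in>UNIV. (v $ i) ^ Poly_Mapping.lookup m i)" for m
    by (simp add: power_mult_distrib prod.distrib mdegree_def power_sum)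
  then show ?thesis using f
    unfolding f mpoly_eval_def by (auto simp: sum_distrib_left intro!: sum.cong)
qed

text \<open>Pulling back along a parametrised curve turns questions about polynomial functions into
  questions about polynomials in one variable.\<close>

lemma polyfun_on_curve:
  fixes F :: "'a::comm_ring_1 ^ 'i::finite \<Rightarrow> 'a"
  assumes "polyfun F"
  shows "\<exists>q. \<forall>t. poly q t = F (\<chi> i. poly (p i) t)"
proof -
  obtain f where f: "F = mpoly_eval f" using assms by (auto simp: polyfun_def)
  show ?thesis
    by (rule exI[of _ "\<Sum>m\<in>Poly_Mapping.keys f. smult (Poly_Mapping.lookup f m)
          (\<Prod>i\<in>UNIV. p i ^ Poly_Mapping.lookup m i)"])
       (simp add: f mpoly_eval_def poly_sum poly_prod)
qed

lemma mpoly_eval_deriv: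
  fixes f :: "('i::finite, 'a::comm_ring_1) mpoly"
  shows "mpoly_eval (mpoly_deriv i f) v = (\<Sum>m\<in>Poly_Mapping.keys f.
    Poly_Mapping.lookup f m * (of_nat (Poly_Mapping.lookup m i) *
      (v $ i ^ (Poly_Mapping.lookup m i - 1) *
       (\<Prod>j\<in>UNIV - {i}. (v $ j) ^ Poly_Mapping.lookup m j))))"
proof -
  have "(\<Prod>j\<in>UNIV. (v $ j) ^ Poly_Mapping.lookup (m - Poly_Mapping.single i 1) j) =
      v $ i ^ (Poly_Mapping.lookup m i - 1) *
       (\<Prod>j\<in>UNIV - {i}. (v $ j) ^ Poly_Mapping.lookup m j)" for m
  proof -
    have "(\<Prod>j\<in>UNIV - {i}. (v $ j) ^ Poly_Mapping.lookup (m - Poly_Mapping.single i 1) j) =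
        (\<Prod>j\<in>UNIV - {i}. (v $ j) ^ Poly_Mapping.lookup m j)"
      by (intro prod.cong) (auto simp: lookup_minus lookup_single when_def)
    then show ?thesis
      by (subst prod.remove[of _ i]) (auto simp: lookup_minus lookup_single)
  qed
  then show ?thesis
    unfolding mpoly_deriv_def by (simp add: mpoly_eval_sum mpoly_eval_single ac_simps)
qed

text \<open>Substituting \<open>[:v $ i, w $ i:]\<close> for the variables gives the restriction to
  the line \<open>v + t w\<close>; its coefficient of \<open>t\<close> is the derivative at 0,
  computed by the product rule. This works in every characteristic.\<close>

lemma directional_derivative:
  fixes f :: "('i::finite, 'a::idom) mpoly"
  shows "\<exists>q. (\<forall>t. poly q t = mpoly_eval f (v + t *s w)) \<and>
    coeff q 1 = (\<Sum>i\<in>UNIV. mpoly_eval (mpoly_deriv i f) v * w $ i)"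
proof -
  define r where "r m = (\<Prod>i\<in>UNIV. [:v $ i, w $ i:] ^ Poly_Mapping.lookup m i)" for m :: "'i \<Rightarrow>\<^sub>0 nat"
  define q where "q = (\<Sum>m\<in>Poly_Mapping.keys f. smult (Poly_Mapping.lookup f m) (r m))"
  have c1: "coeff p 1 = poly (pderiv p) 0" for p :: "'a poly"
    by (simp add: poly_0_coeff_0 coeff_pderiv)
  have "poly (pderiv (r m)) 0 = (\<Sum>i\<in>UNIV. of_nat (Poly_Mapping.lookup m i) *
      (v $ i ^ (Poly_Mapping.lookup m i - 1) *
       (\<Prod>j\<in>UNIV - {i}. (v $ j) ^ Poly_Mapping.lookup m j)) * w $ i)" for m
    unfolding r_def pderiv_prod
    by (auto simp: poly_sum poly_prod pderiv_power pderiv_pCons intro!: sum.cong)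
  then have "coeff q 1 = (\<Sum>m\<in>Poly_Mapping.keys f. Poly_Mapping.lookup f m *
      (\<Sum>i\<in>UNIV. of_nat (Poly_Mapping.lookup m i) *
      (v $ i ^ (Poly_Mapping.lookup m i - 1) *
       (\<Prod>j\<in>UNIV - {i}. (v $ j) ^ Poly_Mapping.lookup m j)) * w $ i))"
    by (simp add: q_def coeff_sum flip: c1[unfolded One_nat_def])
  also have "\<dots> = (\<Sum>i\<in>UNIV. mpoly_eval (mpoly_deriv i f) v * w $ i)"
    unfolding mpoly_eval_deriv sum_distrib_left sum_distrib_right
    by (subst sum.swap) (simp add: algebra_simps)
  finally show ?thesis
    by (intro exI[of _ q]) (auto simp: q_def r_def mpoly_eval_def poly_sum poly_prod mult.commute)
qed

lemma mpoly_homogeneous_components: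
  fixes f :: "('i::finite, 'a::comm_ring_1) mpoly"
  obtains g K where "\<And>k. homogeneous (g k)" and "\<And>k. formfun k (mpoly_eval (g k))"
    and "f = (\<Sum>k\<le>(K::nat). g k)"
proof -
  define g where "g k = (\<Sum>m\<in>{m\<in>Poly_Mapping.keys f. mdegree m = k}.
    Poly_Mapping.single m (Poly_Mapping.lookup f m))" for k
  \<comment> \<open>The inserted 0 gives the maximum a meaning for the zero polynomial.\<close>
  define K where "K = Max (insert 0 (mdegree ` Poly_Mapping.keys f))"
  have g: "\<forall>m\<in>Poly_Mapping.keys (g k). mdegree m = k" for k
  proof
    fix m assume "m \<in> Poly_Mapping.keys (g k)"
    then have "Poly_Mapping.lookup (g k) m \<noteq> 0" by (simp add: in_keys_iff)
    then obtain m' where "mdegree m' = k"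
      "Poly_Mapping.lookup (Poly_Mapping.single m' (Poly_Mapping.lookup f m')) m \<noteq> 0"
      unfolding g_def lookup_sum using sum.not_neutral_contains_not_neutral by force
    then show "mdegree m = k" by (cases "m' = m") (auto simp: lookup_single)
  qed
  have "(\<Sum>k\<le>K. g k) = (\<Sum>m\<in>Poly_Mapping.keys f. Poly_Mapping.single m (Poly_Mapping.lookup f m))"
    unfolding g_def
    by (rule sum.group) (auto simp: K_def)
  then have "f = (\<Sum>k\<le>K. g k)" using poly_mapping_eq_sum_single[of f] by simp
  moreover have "homogeneous (g k)" "formfun k (mpoly_eval (g k))" for k
    using g[of k] by (auto simp: homogeneous_iff formfun_def)
  ultimately show ?thesis using that by blast
qed

section \<open>Chains of form-irreducible sets\<close>

text \<open>The ideal of forms vanishing on the cone is prime, tested on homogeneous elements. The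
  demand for a nonzero vector excludes cones with empty projectivization.\<close>

definition form_irreducible :: "('a::comm_ring_1 ^ 'i::finite) set \<Rightarrow> bool" where
  "form_irreducible C \<longleftrightarrow> (\<exists>v\<in>C. v \<noteq> 0) \<and>
     (\<forall>k l F G. formfun k F \<longrightarrow> formfun l G \<longrightarrow> (\<forall>v\<in>C. F v * G v = 0) \<longrightarrow>
        (\<forall>v\<in>C. F v = 0) \<or> (\<forall>v\<in>C. G v = 0))"

text \<open>For closed cones this amounts to \<open>D\<close> having a nonzero vector outside
  \<open>C\<close>. It is kept as a separate notion because the chain bound works with the
  separating form itself.\<close>

definition form_separated :: "('a::comm_ring_1 ^ 'i::finite) set \<Rightarrow> ('a ^ 'i) set \<Rightarrow> bool" where
  "form_separated C D \<longleftrightarrow> (\<exists>k F. formfun k F \<and> (\<forall>v\<in>C. F v = 0) \<and> (\<exists>v\<in>D. F v \<noteq> 0))"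

text \<open>In a relation on \<open>C m\<close>, cancel the least power of the last form \<open>f (m - 1)\<close> by irreducibility and
  restrict to \<open>C (m - 1)\<close>, where only the terms with that least power survive. Here \<open>f j\<close> vanishes on
  \<open>C j\<close>, and the linear form \<open>x\<close> fills up the degree.\<close>

lemma chain_monomials_independent:
  fixes C :: "nat \<Rightarrow> ('a::field ^ 'i::finite) set"
  assumes irr: "\<And>j. j \<le> m \<Longrightarrow> form_irreducible (C j)"
    and sub: "\<And>j. j < m \<Longrightarrow> C j \<subseteq> C (Suc j)"
    and f: "\<And>j. j < m \<Longrightarrow> formfun (e j) (f j)"
    and f0: "\<And>j v. j < m \<Longrightarrow> v \<in> C j \<Longrightarrow> f j v = 0"
    and f1: "\<And>j. j < m \<Longrightarrow> \<exists>v\<in>C (Suc j). f j v \<noteq> 0"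
    and x: "formfun 1 x" "\<exists>v\<in>C 0. x v \<noteq> 0"
    and S: "finite S" "S \<subseteq> extensional {..<m}" "\<And>a. a \<in> S \<Longrightarrow> (\<Sum>j<m. e j * a j) \<le> D"
    and rel: "\<And>v. v \<in> C m \<Longrightarrow>
      (\<Sum>a\<in>S. c a * (x v ^ (D - (\<Sum>j<m. e j * a j)) * (\<Prod>j<m. f j v ^ a j))) = 0"
  shows "\<forall>a\<in>S. c a = 0"
  using assms
proof (induction m arbitrary: D S c)
  case 0
  then have S: "S \<subseteq> {\<lambda>_. undefined}" by (auto simp: extensional_def fun_eq_iff)
  obtain v where v: "v \<in> C 0" "x v \<noteq> 0" using "0.prems" by blast
  show ?case
  proof
    fix a assume "a \<in> S"
    with S have "S = {a}" by auto
    with "0.prems"(11)[OF v(1)] v(2) show "c a = 0" by simp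
  qed
next
  case (Suc m)
  show ?case
  proof (rule ccontr)
    assume "\<not> (\<forall>a\<in>S. c a = 0)"
    define T where "T = {a\<in>S. c a \<noteq> 0}"
    have T: "T \<noteq> {}" "finite T" "T \<subseteq> S"
      using \<open>\<not> (\<forall>a\<in>S. c a = 0)\<close> Suc.prems(8) by (auto simp: T_def)
    define p where "p = Min ((\<lambda>a. a m) ` T)"
    have p_le: "p \<le> a m" if "a \<in> T" for a using T that by (simp add: p_def)
    have "p \<in> (\<lambda>a. a m) ` T" unfolding p_def using T by (intro Min_in) auto
    then obtain a0 where a0: "a0 \<in> T" "a0 m = p" by auto
    define w where "w a = (\<Sum>j<m. e j * a j)" for a :: "nat \<Rightarrow> nat"
    define W where "W a v = (\<Prod>j<m. f j v ^ a j)" for a :: "nat \<Rightarrow> nat" and v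
    define H where "H v = (\<Sum>a\<in>T. c a * (x v ^ (D - e m * a m - w a) * W a v * f m v ^ (a m - p)))" for v
    have wD: "w a + e m * a m \<le> D" if "a \<in> T" for a
      using Suc.prems(10)[of a] that T(3) by (auto simp: w_def)
    have e_le: "e m * p \<le> e m * a m" if "a \<in> T" for a using p_le[OF that] by simp
    have H_form: "formfun (D - e m * p) H"
      unfolding H_def
    proof (intro formfun_sum formfun_cmult)
      fix a assume a: "a \<in> T"
      have 1: "formfun (1 * (D - e m * a m - w a)) (\<lambda>v. x v ^ (D - e m * a m - w a))"
        by (intro formfun_power Suc.prems)
      have 2: "formfun (w a) (W a)"
        unfolding w_def W_def by (intro formfun_prod formfun_power Suc.prems(3)) auto
      have 3: "formfun (e m * (a m - p)) (\<lambda>v. f m v ^ (a m - p))"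
        by (intro formfun_power Suc.prems) auto
      have "1 * (D - e m * a m - w a) + w a + e m * (a m - p) = D - e m * p"
        using wD[OF a] e_le[OF a] by (simp add: diff_mult_distrib2)
      then show "formfun (D - e m * p)
          (\<lambda>v. x v ^ (D - e m * a m - w a) * W a v * f m v ^ (a m - p))"
        using formfun_mult[OF formfun_mult[OF 1 2] 3] by simp
    qed
    have fmp_form: "formfun (e m * p) (\<lambda>v. f m v ^ p)"
      by (intro formfun_power Suc.prems) auto
    have "f m v ^ p * H v = 0" if v: "v \<in> C (Suc m)" for v
    proof -
      have "f m v ^ p * H v = (\<Sum>a\<in>T. c a * (x v ^ (D - e m * a m - w a) * W a v * f m v ^ a m))"
        unfolding H_def sum_distrib_left
      proof (intro sum.cong refl)
        fix a assume "a \<in> T"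
        then have "f m v ^ a m = f m v ^ p * f m v ^ (a m - p)"
          using p_le by (simp flip: power_add)
        then show "f m v ^ p * (c a * (x v ^ (D - e m * a m - w a) * W a v * f m v ^ (a m - p))) =
            c a * (x v ^ (D - e m * a m - w a) * W a v * f m v ^ a m)"
          by simp
      qed
      also have "\<dots> = (\<Sum>a\<in>S. c a * (x v ^ (D - e m * a m - w a) * W a v * f m v ^ a m))"
        using T(3) Suc.prems(8) by (intro sum.mono_neutral_left) (auto simp: T_def)
      also have "\<dots> = (\<Sum>a\<in>S. c a * (x v ^ (D - (\<Sum>j<Suc m. e j * a j)) * (\<Prod>j<Suc m. f j v ^ a j)))"
        by (simp add: w_def W_def mult.assoc diff_diff_add add.commute)
      also have "\<dots> = 0" by (rule Suc.prems(11)[OF v])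
      finally show ?thesis .
    qed
    then have "(\<forall>v\<in>C (Suc m). f m v ^ p = 0) \<or> (\<forall>v\<in>C (Suc m). H v = 0)"
      using Suc.prems(1)[of "Suc m"] fmp_form H_form unfolding form_irreducible_def by blast
    moreover obtain v1 where "v1 \<in> C (Suc m)" "f m v1 \<noteq> 0" using Suc.prems(5)[of m] by auto
    ultimately have H0: "H v = 0" if "v \<in> C m" for v
      using Suc.prems(2)[of m] that by (metis in_mono lessI power_not_zero)
    define T' where "T' = {a\<in>T. a m = p}"
    \<comment> \<open>Resetting the last exponent to \<open>undefined\<close> turns an index family
      for \<open>Suc m\<close> into one for \<open>m\<close>, as \<open>extensional\<close>
      requires; no information is lost on \<open>T'\<close>, where that exponent is always
      \<open>p\<close>.\<close>
    define r where "r = (\<lambda>a::nat \<Rightarrow> nat. a(m := undefined))"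
    have inj: "inj_on r T'"
      by (rule inj_on_inverseI[of _ "\<lambda>b. b(m := p)"]) (auto simp: r_def T'_def fun_eq_iff)
    have wr: "w (r a) = w a" "W (r a) v = W a v" for a v by (auto simp: w_def W_def r_def)
    have "\<forall>b\<in>r ` T'. c (b(m := p)) = 0"
    proof (rule Suc.IH[of "r ` T'" "D - e m * p"])
      show "r ` T' \<subseteq> extensional {..<m}"
        using Suc.prems(9) T(3) by (fastforce simp: r_def T'_def extensional_def)
      fix b assume "b \<in> r ` T'"
      then obtain a where a: "a \<in> T" "a m = p" "b = r a" by (auto simp: T'_def)
      show "(\<Sum>j<m. e j * b j) \<le> D - e m * p"
        using wr(1)[of a] wD[OF a(1)] a by (simp add: w_def)
    next
      fix v assume v: "v \<in> C m"
      have fv: "f m v = 0" using Suc.prems(4)[of m v] v by simp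
      have "0 = (\<Sum>a\<in>T. c a * (x v ^ (D - e m * a m - w a) * W a v * f m v ^ (a m - p)))"
        using H0[OF v] by (simp add: H_def)
      also have "\<dots> = (\<Sum>a\<in>T'. c a * (x v ^ (D - e m * a m - w a) * W a v * f m v ^ (a m - p)))"
      proof (intro sum.mono_neutral_right ballI)
        fix a assume "a \<in> T - T'"
        then have "a m - p > 0" using p_le[of a] by (auto simp: T'_def)
        then show "c a * (x v ^ (D - e m * a m - w a) * W a v * f m v ^ (a m - p)) = 0"
          by (simp add: fv)
      qed (use T in \<open>auto simp: T'_def\<close>)
      also have "\<dots> = (\<Sum>a\<in>T'. c ((r a)(m := p)) * (x v ^ (D - e m * p - w (r a)) * W (r a) v))"
        unfolding wr by (intro sum.cong) (auto simp: T'_def r_def fun_upd_idem)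
      also have "\<dots> = (\<Sum>b\<in>r ` T'. c (b(m := p)) * (x v ^ (D - e m * p - w b) * W b v))"
        by (simp add: sum.reindex[OF inj])
      finally show "(\<Sum>b\<in>r ` T'. c (b(m := p)) *
          (x v ^ (D - e m * p - (\<Sum>j<m. e j * b j)) * (\<Prod>j<m. f j v ^ b j))) = 0"
        by (simp add: w_def W_def)
    qed (use Suc.prems T in \<open>auto simp: T'_def\<close>)
    moreover have "a0 \<in> T'" using a0 by (simp add: T'_def)
    ultimately have "c ((r a0)(m := p)) = 0" by blast
    then have "c a0 = 0" using a0 by (simp add: r_def fun_upd_idem)
    then show False using a0 by (simp add: T_def)
  qed
qed

section \<open>Counting monomials and the bound on the length of chains\<close>

lemma sum_fun_apply: "(\<Sum>i\<in>I. f i) v = (\<Sum>i\<in>I. f i v)"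
  for f :: "'c \<Rightarrow> 'b \<Rightarrow> 'a::comm_monoid_add"
  by (induction I rule: infinite_finite_induct) auto

text \<open>Linear independence and spans of forms are taken in the space of all functions with
  pointwise operations.\<close>

interpretation funs: vector_space "\<lambda>(c::'a::field) (f::'b \<Rightarrow> 'a) v. c * f v"
  by unfold_locales (auto simp: fun_eq_iff algebra_simps)

definition power_monomials :: "nat \<Rightarrow> ('a::comm_ring_1 ^ 'i::finite \<Rightarrow> 'a) set" where
  "power_monomials D = (\<lambda>e v. \<Prod>i\<in>UNIV. (v $ i) ^ e i) ` {e. (\<Sum>i\<in>UNIV. e i) = D}"

text \<open>One exponent is determined by the others because the total is \<open>D\<close>. Thus the
  count grows in \<open>D\<close> with exponent only \<open>CARD('i) - 1\<close>.\<close>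

lemma power_monomials_card:
  "finite (power_monomials D :: ('a::comm_ring_1 ^ 'i::finite \<Rightarrow> 'a) set) \<and>
   card (power_monomials D :: ('a ^ 'i \<Rightarrow> 'a) set) \<le> (D + 1) ^ (CARD('i) - 1)"
proof -
  fix i0 :: 'i
  let ?E = "{e :: 'i \<Rightarrow> nat. (\<Sum>i\<in>UNIV. e i) = D}"
  let ?P = "PiE (UNIV - {i0}) (\<lambda>_. {..D})"
  have inj: "inj_on (\<lambda>e. restrict e (UNIV - {i0})) ?E"
  proof (rule inj_onI)
    fix e e' assume e: "e \<in> ?E" "e' \<in> ?E" and eq: "restrict e (UNIV - {i0}) = restrict e' (UNIV - {i0})"
    have ne: "e i = e' i" if "i \<noteq> i0" for i using fun_cong[OF eq, of i] that by simp
    have "e i0 + (\<Sum>i\<in>UNIV - {i0}. e i) = e' i0 + (\<Sum>i\<in>UNIV - {i0}. e' i)"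
      using e by (simp add: sum.remove[of UNIV i0, symmetric])
    moreover have "(\<Sum>i\<in>UNIV - {i0}. e i) = (\<Sum>i\<in>UNIV - {i0}. e' i)"
      using ne by (intro sum.cong) auto
    ultimately show "e = e'" using ne by (metis add_right_cancel ext)
  qed
  have sub: "(\<lambda>e. restrict e (UNIV - {i0})) ` ?E \<subseteq> ?P"
  proof (intro image_subsetI restrict_PiE[THEN iffD2] Pi_I)
    fix e i assume "e \<in> ?E"
    then show "e i \<in> {..D}" using member_le_sum[of i UNIV e] by auto
  qed
  have fin: "finite ?P" by (intro finite_PiE) auto
  have finE: "finite ?E" using finite_imageD[OF finite_subset[OF sub fin] inj] .
  have "card ?E = card ((\<lambda>e. restrict e (UNIV - {i0})) ` ?E)" by (simp add: card_image[OF inj])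
  also have "\<dots> \<le> card ?P" by (rule card_mono[OF fin sub])
  also have "\<dots> = (D + 1) ^ (CARD('i) - 1)" by (simp add: card_PiE card_Diff_singleton)
  finally show ?thesis
    unfolding power_monomials_def
    using finE order_trans[OF card_image_le[OF finE]] by (auto intro: finite_imageI)
qed

lemma formfun_in_span:
  fixes F :: "'a::field ^ 'i::finite \<Rightarrow> 'a"
  assumes "formfun D F"
  shows "F \<in> funs.span (power_monomials D)"
proof -
  obtain f where f: "\<forall>m\<in>Poly_Mapping.keys f. mdegree m = D" "F = mpoly_eval f"
    using assms by (auto simp: formfun_def)
  have "F = (\<Sum>m\<in>Poly_Mapping.keys f. (\<lambda>v. Poly_Mapping.lookup f m *
      (\<Prod>i\<in>UNIV. (v $ i) ^ Poly_Mapping.lookup m i)))"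
    by (rule ext) (simp add: f mpoly_eval_def sum_fun_apply)
  also have "\<dots> \<in> funs.span (power_monomials D)"
    using f(1) by (intro funs.span_sum funs.span_scale funs.span_base)
      (auto simp: power_monomials_def mdegree_def)
  finally show ?thesis .
qed

text \<open>Growth comparison: there are \<open>(k + 1) ^ m\<close> independent products of the
  separating forms with exponents at most \<open>k\<close>, all brought to degree
  \<open>k * E\<close>, and they lie in a space of dimension at most
  \<open>(k * E + 1) ^ (CARD('i) - 1)\<close>. For large \<open>k\<close> this forces
  \<open>m < CARD('i)\<close>.\<close>

theorem form_chain_bound:
  fixes C :: "nat \<Rightarrow> ('a::field ^ 'i::finite) set"
  assumes irr: "\<And>j. j \<le> m \<Longrightarrow> form_irreducible (C j)"
    and sub: "\<And>j. j < m \<Longrightarrow> C j \<subseteq> C (Suc j)"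
    and sep: "\<And>j. j < m \<Longrightarrow> form_separated (C j) (C (Suc j))"
  shows "m < CARD('i)"
proof (rule ccontr)
  assume "\<not> m < CARD('i)"
  let ?N = "CARD('i) - 1"
  have mN: "m = Suc ?N + (m - CARD('i))" using \<open>\<not> m < CARD('i)\<close> by simp
  obtain e f where f: "\<And>j. j < m \<Longrightarrow> formfun (e j) (f j)"
    "\<And>j v. j < m \<Longrightarrow> v \<in> C j \<Longrightarrow> f j v = 0" "\<And>j. j < m \<Longrightarrow> \<exists>v\<in>C (Suc j). f j v \<noteq> 0"
    using sep unfolding form_separated_def by metis
  obtain v0 where v0: "v0 \<in> C 0" "v0 \<noteq> 0" using irr[of 0] by (auto simp: form_irreducible_def)
  then obtain i0 where "v0 $ i0 \<noteq> 0" by (auto simp: vec_eq_iff)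
  define x where "x = (\<lambda>v :: 'a ^ 'i. v $ i0)"
  have x: "formfun 1 x" "\<exists>v\<in>C 0. x v \<noteq> 0"
    using v0 \<open>v0 $ i0 \<noteq> 0\<close> formfun_coord by (auto simp: x_def)
  define E where "E = (\<Sum>j<m. e j)"
  have bound: "(k + 1) ^ m \<le> (k * E + 1) ^ ?N" for k
  proof -
    define D where "D = k * E"
    define w where "w a = (\<Sum>j<m. e j * a j)" for a :: "nat \<Rightarrow> nat"
    define M where "M a = (\<lambda>v. x v ^ (D - w a) * (\<Prod>j<m. f j v ^ a j))" for a :: "nat \<Rightarrow> nat"
    define A where "A = PiE {..<m} (\<lambda>_. {..k})"
    have finA: "finite A" unfolding A_def by (intro finite_PiE) auto
    have cardA: "card A = (k + 1) ^ m" by (simp add: A_def card_PiE)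
    have wD: "w a \<le> D" if "a \<in> A" for a
    proof -
      have "w a \<le> (\<Sum>j<m. e j * k)"
        unfolding w_def using that by (intro sum_mono mult_le_mono2) (auto simp: A_def)
      then show ?thesis by (simp add: D_def E_def sum_distrib_left mult.commute)
    qed
    \<comment> \<open>Stated for arbitrary subfamilies: two-element ones, with coefficients 1 and
      -1, show that different exponents give different functions.\<close>
    have indep: "\<forall>a\<in>S. c a = 0" if S: "S \<subseteq> A" and rel: "\<And>v. (\<Sum>a\<in>S. c a * M a v) = 0" for S c
    proof (rule chain_monomials_independent[of m C e f x S D c, OF irr sub f(1) f(2) f(3) x])
      show "finite S" using finA S by (rule rev_finite_subset)
      show "S \<subseteq> extensional {..<m}" using S by (auto simp: A_def PiE_def)
      show "(\<Sum>j<m. e j * a j) \<le> D" if "a \<in> S" for a using wD[of a] S that by (auto simp: w_def)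
      show "(\<Sum>a\<in>S. c a * (x v ^ (D - (\<Sum>j<m. e j * a j)) * (\<Prod>j<m. f j v ^ a j))) = 0" for v
        using rel[of v] by (simp add: M_def w_def)
    qed
    have injM: "inj_on M A"
    proof (rule inj_onI, rule ccontr)
      fix a b assume ab: "a \<in> A" "b \<in> A" "M a = M b" "a \<noteq> b"
      have "\<forall>d\<in>{a, b}. (if d = a then 1 else -1 :: 'a) = 0"
        by (rule indep) (use ab in auto)
      then show False by auto
    qed
    have "funs.independent (M ` A)"
    proof (rule funs.independent_if_scalars_zero)
      fix u h assume u: "(\<Sum>h\<in>M ` A. (\<lambda>v. u h * h v)) = 0" and h: "h \<in> M ` A"
      have "\<forall>a\<in>A. u (M a) = 0"
      proof (rule indep)
        fix v
        show "(\<Sum>a\<in>A. u (M a) * M a v) = 0"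
          using fun_cong[OF u, of v] by (simp add: sum_fun_apply sum.reindex[OF injM])
      qed simp
      then show "u h = 0" using h by auto
    qed (use finA in simp)
    moreover have "M ` A \<subseteq> funs.span (power_monomials D)"
    proof (intro image_subsetI formfun_in_span)
      fix a assume "a \<in> A"
      have "formfun (1 * (D - w a) + w a) (M a)"
        unfolding M_def w_def by (intro formfun_mult formfun_power formfun_prod x f) auto
      then show "formfun D (M a)" using wD[OF \<open>a \<in> A\<close>] by simp
    qed
    ultimately have "card (M ` A) \<le> card (power_monomials D :: ('a ^ 'i \<Rightarrow> 'a) set)"
      using funs.independent_span_bound power_monomials_card by blast
    also have "\<dots> \<le> (D + 1) ^ ?N" using power_monomials_card by blast
    finally show ?thesis by (simp add: card_image[OF injM] cardA D_def)
  qed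
  \<comment> \<open>With this choice \<open>((k + 1) * (E + 1)) ^ ?N\<close> equals
    \<open>(k + 1) ^ ?N * k\<close>, just short of \<open>(k + 1) ^ Suc ?N\<close>.\<close>
  define k where "k = (E + 1) ^ ?N"
  have "(k + 1) ^ ?N * (k + 1) \<le> (k + 1) ^ m"
    unfolding power_Suc2[symmetric] using mN by (intro power_increasing) auto
  also have "\<dots> \<le> (k * E + 1) ^ ?N" by (rule bound)
  also have "\<dots> \<le> ((k + 1) * (E + 1)) ^ ?N" by (intro power_mono) auto
  also have "\<dots> = (k + 1) ^ ?N * k" by (subst power_mult_distrib) (simp add: k_def)
  finally show False by simp
qed

section \<open>The Zariski topology in terms of forms\<close>

definition cone_of :: "('a::field ^ 'i::finite) set set \<Rightarrow> ('a ^ 'i) set" where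
  "cone_of Z = \<Union> Z - {0}"

definition projectivization :: "('a::field ^ 'i::finite) set \<Rightarrow> ('a ^ 'i) set set" where
  "projectivization C = {vec.span {v} | v. v \<in> C \<and> v \<noteq> 0}"

text \<open>The vector 0 is exempt because it represents no point of projective space.\<close>

definition form_closed :: "('a::field ^ 'i::finite) set \<Rightarrow> bool" where
  "form_closed C \<longleftrightarrow> (\<forall>v. v \<notin> C \<longrightarrow> v \<noteq> 0 \<longrightarrow>
     (\<exists>k F. formfun k F \<and> F v \<noteq> 0 \<and> (\<forall>w\<in>C. F w = 0)))"

definition scale_closed :: "('a::field ^ 'i::finite) set \<Rightarrow> bool" where
  "scale_closed C \<longleftrightarrow> (\<forall>v\<in>C. \<forall>c. c *s v \<in> C)"

lemma form_closedD:
  "form_closed C \<Longrightarrow> v \<notin> C \<Longrightarrow> v \<noteq> 0 \<Longrightarrow> \<exists>k F. formfun k F \<and> F v \<noteq> 0 \<and> (\<forall>w\<in>C. F w = 0)"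
  by (simp add: form_closed_def)

lemma vanishes_at_span:
  fixes v :: "'a::field ^ 'i::finite"
  assumes "homogeneous f" "v \<noteq> 0"
  shows "vanishes_at f (vec.span {v}) \<longleftrightarrow> mpoly_eval f v = 0"
proof -
  obtain k where "formfun k (mpoly_eval f)"
    using assms(1) by (auto simp: homogeneous_iff formfun_def)
  then have "mpoly_eval f (c *s v) = c ^ k * mpoly_eval f v" for c
    by (rule formfun_scale)
  moreover have "v \<in> vec.span {v} - {0}" using assms(2) by (simp add: vec.span_base)
  ultimately show ?thesis
    unfolding vanishes_at_def by (auto simp: vec.span_singleton)
qed

lemma projective_spaceE:
  assumes "p \<in> projective_space"
  obtains v where "v \<noteq> 0" "p = vec.span {v}"
  using assms by (auto simp: projective_space_def)

lemma formfunE: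
  assumes "formfun k F"
  obtains f where "homogeneous f" "F = mpoly_eval f"
  using assms unfolding formfun_def homogeneous_iff by blast

lemma homogeneousE:
  assumes "homogeneous f"
  obtains k where "formfun k (mpoly_eval f)"
  using assms unfolding formfun_def homogeneous_iff by blast

lemma homogeneous_mult:
  assumes "homogeneous f" "homogeneous g"
  shows "homogeneous (f * g)"
proof -
  obtain k l where "\<forall>m\<in>Poly_Mapping.keys f. mdegree m = k" "\<forall>m\<in>Poly_Mapping.keys g. mdegree m = l"
    using assms by (auto simp: homogeneous_iff)
  then show ?thesis unfolding homogeneous_iff
    using Poly_Mapping.keys_mult[of f g] by (intro exI[of _ "k + l"]) (auto simp: mdegree_add)
qed

lemma vanishes_at_mult:
  assumes "homogeneous f" "homogeneous g" "p \<in> projective_space"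
  shows "vanishes_at (f * g) p \<longleftrightarrow> vanishes_at f p \<or> vanishes_at g p"
  using assms(3) by (elim projective_spaceE)
    (simp add: vanishes_at_span homogeneous_mult assms mpoly_eval_mult)

lemma homogeneous_one: "homogeneous 1"
  by (auto simp: homogeneous_iff mdegree_def)

lemma not_vanishes_at_one:
  fixes p :: "('a::field ^ 'i::finite) set"
  assumes "p \<in> projective_space"
  shows "\<not> vanishes_at 1 p"
proof -
  have "mpoly_eval 1 v = 1" for v :: "'a ^ 'i"
    unfolding single_one[symmetric] mpoly_eval_single by simp
  then show ?thesis using assms by (elim projective_spaceE) (simp add: vanishes_at_span homogeneous_one)
qed

text \<open>Induction over the generated topology. Finite intersections are served by products of
  forms, unions by a form belonging to one member; conversely the forms in question exhibit
  \<open>U\<close> as a union of basic open sets.\<close>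

lemma openin_zariski_iff:
  fixes U :: "('a::field ^ 'i::finite) set set"
  shows "openin zariski U \<longleftrightarrow> U \<subseteq> projective_space \<and>
    (\<forall>p\<in>U. \<exists>f. homogeneous f \<and> \<not> vanishes_at f p \<and> (\<forall>q\<in>projective_space - U. vanishes_at f q))"
    (is "?L \<longleftrightarrow> ?R")
proof
  let ?B = "{{p \<in> projective_space. \<not> vanishes_at f p} | f :: ('i, 'a) mpoly. homogeneous f}"
  assume ?L
  then have "generate_topology_on ?B U" unfolding zariski_def openin_topology_generated_by_iff .
  then show ?R
  proof induction
    case (Int U V)
    show ?case
    proof safe
      fix p assume p: "p \<in> U" "p \<in> V"
      obtain f g where f: "homogeneous f" "\<not> vanishes_at f p" "\<forall>q\<in>projective_space - U. vanishes_at f q"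
        and g: "homogeneous g" "\<not> vanishes_at g p" "\<forall>q\<in>projective_space - V. vanishes_at g q"
        using Int.IH p by meson
      show "\<exists>f. homogeneous f \<and> \<not> vanishes_at f p \<and> (\<forall>q\<in>projective_space - U \<inter> V. vanishes_at f q)"
        using f g p Int.IH by (intro exI[of _ "f * g"]) (auto simp: homogeneous_mult vanishes_at_mult)
    qed (use Int.IH in auto)
  next
    case (UN K)
    show ?case
    proof safe
      fix p V assume "p \<in> V" "V \<in> K"
      then obtain f where "homogeneous f" "\<not> vanishes_at f p" "\<forall>q\<in>projective_space - V. vanishes_at f q"
        using UN.IH by meson
      then show "\<exists>f. homogeneous f \<and> \<not> vanishes_at f p \<and> (\<forall>q\<in>projective_space - \<Union> K. vanishes_at f q)"
        using \<open>V \<in> K\<close> by (intro exI[of _ f]) auto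
    qed (use UN.IH in blast)
  qed auto
next
  assume R: ?R
  define F where "F = {f. homogeneous f \<and> (\<forall>q\<in>projective_space - U. vanishes_at f q)}"
  have "U = (\<Union>f\<in>F. {p \<in> projective_space. \<not> vanishes_at f p})"
  proof (intro equalityI subsetI)
    fix p assume "p \<in> U"
    with R show "p \<in> (\<Union>f\<in>F. {p \<in> projective_space. \<not> vanishes_at f p})"
      unfolding F_def by blast
  qed (auto simp: F_def)
  moreover have "openin zariski {p \<in> projective_space. \<not> vanishes_at f p}" if "f \<in> F" for f
    unfolding zariski_def using that by (intro topology_generated_by_Basis) (auto simp: F_def)
  ultimately show ?L by auto
qed

lemma topspace_zariski: "topspace zariski = projective_space"
proof
  have "openin zariski (projective_space :: ('a::field ^ 'i::finite) set set)"
    unfolding openin_zariski_iff using homogeneous_one not_vanishes_at_one by blast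
  then show "(projective_space :: ('a ^ 'i) set set) \<subseteq> topspace zariski" by (rule openin_subset)
  show "topspace zariski \<subseteq> (projective_space :: ('a ^ 'i) set set)"
    using openin_topspace openin_zariski_iff by blast
qed

lemma closedin_zariski_iff:
  "closedin zariski Z \<longleftrightarrow> Z \<subseteq> projective_space \<and>
    (\<forall>p\<in>projective_space - Z. \<exists>f. homogeneous f \<and> \<not> vanishes_at f p \<and> (\<forall>q\<in>Z. vanishes_at f q))"
  unfolding closedin_def openin_zariski_iff topspace_zariski
  by (auto simp: Diff_Diff_Int Int_absorb1 double_diff)

lemma closedin_vanishing:
  assumes "homogeneous f"
  shows "closedin zariski {p \<in> projective_space. vanishes_at f p}"
  unfolding closedin_zariski_iff using assms by blast

lemma vanishes_on_cone:
  assumes "homogeneous f" "Z \<subseteq> projective_space"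
  shows "(\<forall>v\<in>cone_of Z. mpoly_eval f v = 0) \<longleftrightarrow> (\<forall>p\<in>Z. vanishes_at f p)"
  by (auto simp: cone_of_def vanishes_at_def)

lemma cone_projectivization:
  assumes "scale_closed C"
  shows "cone_of (projectivization C) = C - {0}"
proof (intro equalityI subsetI)
  fix v assume "v \<in> cone_of (projectivization C)"
  then obtain w where w: "w \<in> C" "v \<in> vec.span {w}" "v \<noteq> 0"
    by (auto simp: cone_of_def projectivization_def)
  with assms show "v \<in> C - {0}" by (auto simp: vec.span_singleton scale_closed_def)
next
  fix v assume "v \<in> C - {0}"
  then show "v \<in> cone_of (projectivization C)"
    by (auto simp: cone_of_def projectivization_def intro: vec.span_base)
qed

lemma projectivization_subset: "projectivization C \<subseteq> projective_space"
  by (auto simp: projectivization_def projective_space_def)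

lemma irreducible_closed_subset:
  "irreducible_closed (subtopology zariski X) Z \<Longrightarrow> Z \<subseteq> X \<and> Z \<subseteq> projective_space"
  unfolding irreducible_closed_def closedin_subtopology
  using closedin_subset[of zariski] topspace_zariski by blast

text \<open>If a product of forms vanishes on \<open>Z\<close>, the zero loci of the factors cut
  \<open>Z\<close> into two relatively closed pieces that cover it, so one piece is
  everything.\<close>

lemma form_irreducible_cone:
  assumes "irreducible_closed (subtopology zariski X) Z"
  shows "form_irreducible (cone_of Z)"
  unfolding form_irreducible_def
proof (intro conjI allI impI)
  have Z: "Z \<subseteq> X" "Z \<subseteq> projective_space" using irreducible_closed_subset[OF assms] by auto
  obtain p where "p \<in> Z" using assms by (auto simp: irreducible_closed_def)
  then have "p \<in> projective_space" using Z by auto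
  then obtain v where "v \<noteq> 0" "p = vec.span {v}" by (rule projective_spaceE)
  then show "\<exists>v\<in>cone_of Z. v \<noteq> 0"
    using \<open>p \<in> Z\<close> by (intro bexI[of _ v]) (auto simp: cone_of_def vec.span_base)
  fix k l F G assume "formfun k F" "formfun l G" and zero: "\<forall>v\<in>cone_of Z. F v * G v = 0"
  then obtain f g where f: "homogeneous f" "F = mpoly_eval f" and g: "homogeneous g" "G = mpoly_eval g"
    by (auto elim!: formfunE)
  obtain T where T: "closedin zariski T" "Z = T \<inter> X"
    using assms by (auto simp: irreducible_closed_def closedin_subtopology)
  define A where "A = Z \<inter> {p \<in> projective_space. vanishes_at f p}"
  define B where "B = Z \<inter> {p \<in> projective_space. vanishes_at g p}"
  have "closedin (subtopology zariski X) A" "closedin (subtopology zariski X) B"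
    unfolding A_def B_def T(2) closedin_subtopology
    using closedin_Int[OF T(1) closedin_vanishing] f(1) g(1) by blast+
  moreover have "p \<in> Z \<Longrightarrow> p \<in> projective_space" for p using Z by auto
  then have "Z = A \<union> B"
    using zero vanishes_on_cone[of "f * g" Z] vanishes_at_mult[of f g] homogeneous_mult[of f g] f g Z
    by (auto simp: A_def B_def mpoly_eval_mult)
  ultimately have "Z = A \<or> Z = B" using assms by (auto simp: irreducible_closed_def)
  then show "(\<forall>v\<in>cone_of Z. F v = 0) \<or> (\<forall>v\<in>cone_of Z. G v = 0)"
    using vanishes_on_cone[of f Z] vanishes_on_cone[of g Z] f g Z by (auto simp: A_def B_def)
qed

lemma form_separated_cone:
  assumes "irreducible_closed (subtopology zariski X) Z" "irreducible_closed (subtopology zariski X) Z'"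
    and "Z \<subset> Z'"
  shows "form_separated (cone_of Z) (cone_of Z')"
proof -
  have Z: "Z \<subseteq> projective_space" "Z' \<subseteq> X" "Z' \<subseteq> projective_space"
    using irreducible_closed_subset assms(1,2) by blast+
  obtain p where p: "p \<in> Z'" "p \<notin> Z" using assms(3) by auto
  obtain T where T: "closedin zariski T" "Z = T \<inter> X"
    using assms by (auto simp: irreducible_closed_def closedin_subtopology)
  then obtain f where f: "homogeneous f" "\<not> vanishes_at f p" "\<forall>q\<in>T. vanishes_at f q"
    using p Z unfolding closedin_zariski_iff by blast
  obtain k where "formfun k (mpoly_eval f)" using f(1) by (rule homogeneousE)
  then show ?thesis unfolding form_separated_def
    using vanishes_on_cone[OF f(1) Z(1)] vanishes_on_cone[OF f(1) Z(3)] f T p by blast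
qed

lemma closedin_projectivization:
  assumes "form_closed C" "scale_closed C"
  shows "closedin zariski (projectivization C)"
  unfolding closedin_zariski_iff
proof (intro conjI ballI projectivization_subset)
  fix p assume p: "p \<in> projective_space - projectivization C"
  then obtain v where v: "v \<noteq> 0" "p = vec.span {v}" by (auto elim: projective_spaceE)
  with p have "v \<notin> C" by (auto simp: projectivization_def)
  then obtain k F where F: "formfun k F" "F v \<noteq> 0" "\<forall>w\<in>C. F w = 0"
    using form_closedD[OF assms(1) _ v(1)] by auto
  then obtain f where f: "homogeneous f" "F = mpoly_eval f" by (elim formfunE)
  have "\<forall>q\<in>projectivization C. vanishes_at f q"
    using F f by (auto simp: projectivization_def vanishes_at_span)
  then show "\<exists>f. homogeneous f \<and> \<not> vanishes_at f p \<and> (\<forall>q\<in>projectivization C. vanishes_at f q)"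
    using f F v by (auto simp: vanishes_at_span)
qed

text \<open>Were the set covered by two proper closed subsets, points missed by each would give two
  forms, neither vanishing on the cone, whose product does.\<close>

lemma irreducible_closed_projectivization:
  assumes "form_irreducible (C - {0})" "form_closed C" "scale_closed C" "projectivization C \<subseteq> X"
  shows "irreducible_closed (subtopology zariski X) (projectivization C)"
proof -
  let ?Z = "projectivization C"
  have cl: "closedin zariski ?Z" using assms by (simp add: closedin_projectivization)
  have "?Z = A \<or> ?Z = B"
    if AB: "closedin (subtopology zariski X) A" "closedin (subtopology zariski X) B" "?Z = A \<union> B" for A B
  proof (rule ccontr)
    assume "\<not> (?Z = A \<or> ?Z = B)"
    then obtain p q where pq: "p \<in> ?Z" "p \<notin> A" "q \<in> ?Z" "q \<notin> B" using AB(3) by blast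
    obtain T T' where T: "closedin zariski T" "A = T \<inter> X" "closedin zariski T'" "B = T' \<inter> X"
      using AB by (auto simp: closedin_subtopology)
    have "p \<in> projective_space - T" "q \<in> projective_space - T'"
      using T pq assms(4) projectivization_subset[of C] by blast+
    then obtain f g where f: "homogeneous f" "\<not> vanishes_at f p" "\<forall>q\<in>T. vanishes_at f q"
      and g: "homogeneous g" "\<not> vanishes_at g q" "\<forall>q\<in>T'. vanishes_at g q"
      using T(1,3) unfolding closedin_zariski_iff by meson
    obtain k l where kl: "formfun k (mpoly_eval f)" "formfun l (mpoly_eval g)"
      using f(1) g(1) by (meson homogeneousE)
    have "\<forall>p\<in>?Z. vanishes_at (f * g) p"
    proof
      fix r assume r: "r \<in> ?Z"
      then have "r \<in> projective_space" using projectivization_subset by blast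
      moreover have "r \<in> T \<or> r \<in> T'" using r AB(3) T(2,4) by auto
      ultimately show "vanishes_at (f * g) r"
        using f(3) g(3) vanishes_at_mult[OF f(1) g(1)] by auto
    qed
    then have "\<forall>v\<in>C - {0}. mpoly_eval f v * mpoly_eval g v = 0"
      using vanishes_on_cone[OF homogeneous_mult[OF f(1) g(1)] projectivization_subset[of C]]
      unfolding cone_projectivization[OF assms(3)] mpoly_eval_mult by simp
    then have "(\<forall>v\<in>C - {0}. mpoly_eval f v = 0) \<or> (\<forall>v\<in>C - {0}. mpoly_eval g v = 0)"
      using assms(1) kl unfolding form_irreducible_def by blast
    then have "(\<forall>p\<in>?Z. vanishes_at f p) \<or> (\<forall>p\<in>?Z. vanishes_at g p)"
      using vanishes_on_cone[OF f(1) projectivization_subset[of C]]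
        vanishes_on_cone[OF g(1) projectivization_subset[of C]]
      unfolding cone_projectivization[OF assms(3)] by simp
    then show False using pq(1,3) f(2) g(2) by auto
  qed
  moreover have "closedin (subtopology zariski X) ?Z"
    using cl assms(4) unfolding closedin_subtopology by blast
  moreover have "?Z \<noteq> {}"
    using assms(1) by (auto simp: form_irreducible_def projectivization_def)
  ultimately show ?thesis by (auto simp: irreducible_closed_def)
qed

lemma form_separatedI:
  assumes "form_closed C" "\<not> D \<subseteq> C" "0 \<notin> D"
  shows "form_separated C D"
proof -
  obtain v where v: "v \<in> D" "v \<notin> C" "v \<noteq> 0" using assms by auto
  then obtain k F where "formfun k F" "F v \<noteq> 0" "\<forall>w\<in>C. F w = 0"
    using form_closedD[OF assms(1) v(2,3)] by auto
  then show ?thesis using v(1) unfolding form_separated_def by auto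
qed

lemma form_separated_mono: "form_separated C D \<Longrightarrow> C' \<subseteq> C \<Longrightarrow> D \<subseteq> D' \<Longrightarrow> form_separated C' D'"
  unfolding form_separated_def by blast

section \<open>Dimensions of the members of a complete flag of cones\<close>

text \<open>One closed irreducible cone for each projective dimension from 0 to \<open>N\<close>.
  Such a flag fixes the dimension of each of its members: the part below bounds it from below, the
  part above, by the chain bound, from above.\<close>

locale cone_flag =
  fixes D :: "nat \<Rightarrow> ('a::field ^ 'i::finite) set" and N :: nat
  assumes card_eq: "CARD('i) = Suc N"
    and irreducible: "j \<le> N \<Longrightarrow> form_irreducible (D j - {0})"
    and closed: "j \<le> N \<Longrightarrow> form_closed (D j)"
    and scale: "j \<le> N \<Longrightarrow> scale_closed (D j)"
    and strict: "j < N \<Longrightarrow> D j \<subset> D (Suc j)"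
begin

lemma zero_mem: "j \<le> N \<Longrightarrow> 0 \<in> D j"
proof -
  assume j: "j \<le> N"
  then obtain v where "v \<in> D j" using irreducible[OF j] by (auto simp: form_irreducible_def)
  then have "0 *s v \<in> D j" using scale[OF j] unfolding scale_closed_def by blast
  then show ?thesis by simp
qed

lemma separated: "j < N \<Longrightarrow> form_separated (D j - {0}) (D (Suc j) - {0})"
  by (rule form_separated_mono[OF form_separatedI[of "D j" "D (Suc j) - {0}"]])
     (use closed[of j] strict[of j] zero_mem[of j] in auto)

lemma mono: "i \<le> j \<Longrightarrow> j \<le> N \<Longrightarrow> D i \<subseteq> D j"
proof (induction j rule: dec_induct)
  case (step n)
  then show ?case using strict[of n] by auto
qed simp

text \<open>A chain in \<open>D j\<close> is prolonged by the members of the flag above \<open>D j\<close>.\<close>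

lemma zdim_le:
  assumes j: "j \<le> N" and X: "X \<subseteq> projectivization (D j)"
  shows "zdim X \<le> enat j"
  unfolding zdim_def krull_dim_def
proof (rule Sup_least, clarify)
  fix k Z assume Z: "\<forall>i\<le>k. irreducible_closed (subtopology zariski X) (Z i)" "\<forall>i<k. Z i \<subset> Z (Suc i)"
  \<comment> \<open>Position \<open>k + r\<close> with \<open>r > 0\<close> carries
    \<open>D (j + r)\<close>. The member \<open>D j\<close> is left out since \<open>Z k\<close> may
    already fill it, so the combined chain has length \<open>k + (N - j)\<close>.\<close>
  define C where "C i = (if i \<le> k then cone_of (Z i) else D (j + (i - k)) - {0})" for i
  have sub0: "cone_of (Z i) \<subseteq> D j - {0}" if "i \<le> k" for i
  proof -
    have "Z i \<subseteq> projectivization (D j)" using irreducible_closed_subset[of X "Z i"] Z(1) X that by auto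
    then have "cone_of (Z i) \<subseteq> cone_of (projectivization (D j))" by (auto simp: cone_of_def)
    then show ?thesis by (simp add: cone_projectivization scale j)
  qed
  have "k + (N - j) < CARD('i)"
  proof (rule form_chain_bound[of _ C])
    fix i assume "i \<le> k + (N - j)"
    then show "form_irreducible (C i)"
      using Z(1) by (auto simp: C_def intro!: form_irreducible_cone irreducible)
  next
    fix i assume i: "i < k + (N - j)"
    then consider "i < k" | "i = k" "j < N" | "i > k" by linarith
    note cases = this
    from cases show "C i \<subseteq> C (Suc i)"
    proof cases
      case 1
      then have "Z i \<subseteq> Z (Suc i)" using Z(2) by auto
      then have "cone_of (Z i) \<subseteq> cone_of (Z (Suc i))" by (auto simp: cone_of_def)
      then show ?thesis using 1 by (simp add: C_def)
    next
      case 2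
      then show ?thesis using sub0[of k] strict[of j] by (auto simp: C_def)
    next
      case 3
      then have "j + (i - k) < N" using i by linarith
      from strict[OF this] 3 show ?thesis by (auto simp: C_def Suc_diff_le)
    qed
    from cases show "form_separated (C i) (C (Suc i))"
    proof cases
      case 1
      then show ?thesis using Z form_separated_cone[of X "Z i" "Z (Suc i)"] by (auto simp: C_def)
    next
      case 2
      then show ?thesis
        using form_separated_mono[OF separated[of j] sub0[of k] subset_refl] by (auto simp: C_def)
    next
      case 3
      then have "j + (i - k) < N" using i by linarith
      from separated[OF this] 3 show ?thesis by (auto simp: C_def Suc_diff_le)
    qed
  qed
  then show "enat k \<le> enat j" using card_eq j by simp
qed

lemma zdim_eq:
  assumes j: "j \<le> N"
  shows "zdim (projectivization (D j)) = enat j"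
proof (rule antisym)
  show "zdim (projectivization (D j)) \<le> enat j" using zdim_le[OF j] by simp
  have sub: "projectivization (D i) \<subseteq> projectivization (D i')" if "i \<le> i'" "i' \<le> N" for i i'
    using mono[OF that] by (auto simp: projectivization_def)
  have "projectivization (D i) \<subset> projectivization (D (Suc i))" if i: "i < N" for i
  proof -
    have "cone_of (projectivization (D i)) \<noteq> cone_of (projectivization (D (Suc i)))"
      using strict[OF i] zero_mem[of i] i
      unfolding cone_projectivization[OF scale[OF less_imp_le[OF i]]] cone_projectivization[OF scale[OF Suc_leI[OF i]]]
      by auto
    then show ?thesis using sub[of i "Suc i"] i by auto
  qed
  moreover have "irreducible_closed (subtopology zariski (projectivization (D j))) (projectivization (D i))"
    if "i \<le> j" for i
    using that j by (intro irreducible_closed_projectivization irreducible closed scale sub) auto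
  ultimately show "enat j \<le> zdim (projectivization (D j))"
    unfolding zdim_def krull_dim_def using j
    by (intro Sup_upper CollectI exI[of _ j] conjI exI[of _ "\<lambda>i. projectivization (D i)"]) auto
qed

text \<open>The members are irreducible, so the whole of \<open>D j\<close> is an irreducible closed
  set through each of its points and the local dimension is constant.\<close>

lemma local_dim_eq:
  assumes j: "j \<le> N" and p: "p \<in> projectivization (D j)"
  shows "local_dim (projectivization (D j)) p = enat j"
proof (rule antisym)
  show "local_dim (projectivization (D j)) p \<le> enat j"
    unfolding local_dim_def
    by (rule Sup_least) (use irreducible_closed_subset zdim_le[OF j] in blast)
  have "irreducible_closed (subtopology zariski (projectivization (D j))) (projectivization (D j))"
    using j by (intro irreducible_closed_projectivization irreducible closed scale) auto
  then show "enat j \<le> local_dim (projectivization (D j)) p"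
    unfolding local_dim_def zdim_eq[OF j, symmetric] using p by (intro Sup_upper) auto
qed

end

section \<open>Irreducibility from joining curves\<close>

text \<open>If \<open>F\<close> does not vanish at \<open>x\<close> nor \<open>G\<close> at
  \<open>y\<close>, both pull back to nonzero polynomials on the curve joining \<open>x\<close> to
  \<open>y\<close>, and so does their product. The end points are prescribed only up to nonzero
  factors, which forms do not notice.\<close>

lemma form_irreducible_by_curves:
  fixes C :: "('a::alg_closed_field ^ 'i::finite) set"
  assumes ne: "\<exists>v\<in>C. v \<noteq> 0"
    and curve: "\<And>x y. x \<in> C \<Longrightarrow> y \<in> C \<Longrightarrow> \<exists>p E a b. finite E \<and> a \<noteq> 0 \<and> b \<noteq> 0 \<and>
      (\<forall>t. t \<notin> E \<longrightarrow> (\<chi> i. poly (p i) t) \<in> C) \<and>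
      (\<chi> i. poly (p i) 0) = a *s x \<and> (\<chi> i. poly (p i) 1) = b *s y"
  shows "form_irreducible (C - {0})"
  unfolding form_irreducible_def
proof (intro conjI allI impI)
  show "\<exists>v\<in>C - {0}. v \<noteq> 0" using ne by auto
  fix k l F G assume F: "formfun k F" and G: "formfun l G" and FG: "\<forall>v\<in>C - {0}. F v * G v = 0"
  show "(\<forall>v\<in>C - {0}. F v = 0) \<or> (\<forall>v\<in>C - {0}. G v = 0)"
  proof (rule ccontr)
    assume "\<not> ?thesis"
    then obtain x y where x: "x \<in> C" "x \<noteq> 0" "F x \<noteq> 0" and y: "y \<in> C" "G y \<noteq> 0" by auto
    obtain p E a b where p: "finite E" "a \<noteq> 0" "b \<noteq> 0" "\<And>t. t \<notin> E \<Longrightarrow> (\<chi> i. poly (p i) t) \<in> C"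
      "(\<chi> i. poly (p i) 0) = a *s x" "(\<chi> i. poly (p i) 1) = b *s y"
      using curve[OF x(1) y(1)] by blast
    obtain qF qG where q: "\<And>t. poly qF t = F (\<chi> i. poly (p i) t)" "\<And>t. poly qG t = G (\<chi> i. poly (p i) t)"
      using polyfun_on_curve[OF formfun_imp_polyfun[OF F], of p]
        polyfun_on_curve[OF formfun_imp_polyfun[OF G], of p] by auto
    obtain i where i: "x $ i \<noteq> 0" using x(2) by (auto simp: vec_eq_iff)
    \<comment> \<open>The factor \<open>p i\<close> takes care of the parameters at which the curve
      passes through 0, where nothing is known about \<open>F\<close> and \<open>G\<close>.\<close>
    have "qF * qG * p i = 0"
    proof (rule poly_eq_0_if_cofinitely_zero[OF p(1)])
      fix t assume t: "t \<notin> E"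
      show "poly (qF * qG * p i) t = 0"
      proof (cases "(\<chi> i. poly (p i) t) = 0")
        case True
        then have "poly (p i) t = 0" by (simp add: vec_eq_iff)
        then show ?thesis by simp
      next
        case False
        then show ?thesis using FG p(4)[OF t] by (simp add: q)
      qed
    qed
    moreover have "poly qF 0 \<noteq> 0" using x(3) p(2) by (simp add: q p(5) formfun_scale[OF F])
    moreover have "poly qG 1 \<noteq> 0" using y(2) p(3) by (simp add: q p(6) formfun_scale[OF G])
    moreover have "poly (p i) 0 \<noteq> 0"
    proof -
      have "poly (p i) 0 = (\<chi> i. poly (p i) 0) $ i" by simp
      also have "\<dots> = a * x $ i" unfolding p(5) by simp
      finally show ?thesis using i p(2) by simp
    qed
    ultimately show False by auto
  qed
qed

section \<open>Coordinate subspaces and adapted bases\<close>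

definition coord_subspace :: "'i set \<Rightarrow> ('a::field ^ 'i::finite) set" where
  "coord_subspace S = {x. \<forall>i. i \<notin> S \<longrightarrow> x $ i = 0}"

lemma subspace_coord_subspace: "vec.subspace (coord_subspace S)"
  by (rule vec.subspaceI) (auto simp: coord_subspace_def)

lemma dim_coord_subspace: "vec.dim (coord_subspace S) = card S"
  unfolding coord_subspace_def by (rule dim_substandard_cart)

lemma axis_mem_coord_subspace: "axis i (1::'a::field) \<in> coord_subspace S \<longleftrightarrow> i \<in> S"
  by (auto simp: coord_subspace_def axis_def)

lemma coord_subspace_eq_span: "coord_subspace S = vec.span ((\<lambda>i. axis i (1::'a::field)) ` S)"
proof
  show "coord_subspace S \<subseteq> vec.span ((\<lambda>i. axis i (1::'a)) ` S)"
  proof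
    fix x :: "'a ^ 'b" assume x: "x \<in> coord_subspace S"
    have "x = (\<Sum>i\<in>UNIV. x $ i *s axis i 1)" by (simp add: basis_expansion)
    also have "\<dots> = (\<Sum>i\<in>S. x $ i *s axis i 1)"
      using x by (intro sum.mono_neutral_right) (auto simp: coord_subspace_def)
    also have "\<dots> \<in> vec.span ((\<lambda>i. axis i 1) ` S)"
      by (intro vec.span_sum vec.span_scale vec.span_base) auto
    finally show "x \<in> vec.span ((\<lambda>i. axis i 1) ` S)" .
  qed
  show "vec.span ((\<lambda>i. axis i (1::'a)) ` S) \<subseteq> coord_subspace S"
    by (intro vec.span_minimal subspace_coord_subspace) (auto simp: axis_mem_coord_subspace)
qed

lemma exists_bij_flag:
  fixes S' S :: "'i::finite set"
  assumes "S' \<subseteq> S" "B' \<subseteq> B" "B \<subseteq> C" "finite C"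
    and "card S' = card B'" "card S = card B" "CARD('i) = card C"
  obtains b where "bij_betw b UNIV C" "b ` S' = B'" "b ` S = B"
proof -
  have fin: "finite B" "finite B'" using assms finite_subset by metis+
  obtain b1 where b1: "bij_betw b1 S' B'"
    using assms fin finite_same_card_bij[of S' B'] by auto
  have "card (S - S') = card (B - B')" "card (UNIV - S) = card (C - B)"
    using assms fin by (simp_all add: card_Diff_subset)
  then obtain b2 b3 where b2: "bij_betw b2 (S - S') (B - B')" and b3: "bij_betw b3 (UNIV - S) (C - B)"
    using assms(4) fin finite_same_card_bij[of "S - S'" "B - B'"] finite_same_card_bij[of "UNIV - S" "C - B"]
    by (meson finite finite_Diff)
  define b where "b i = (if i \<in> S' then b1 i else if i \<in> S then b2 i else b3 i)" for i
  have 1: "bij_betw b S' B'" using b1 by (simp add: b_def cong: bij_betw_cong)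
  have 2: "bij_betw b (S - S') (B - B')"
    using b2 by (subst bij_betw_cong[where g = b2]) (auto simp: b_def)
  have 3: "bij_betw b (UNIV - S) (C - B)"
    using b3 assms(1) by (subst bij_betw_cong[where g = b3]) (auto simp: b_def)
  have 12: "bij_betw b S B"
    using bij_betw_combine[OF 1 2] assms(1,2) by (simp add: Un_absorb1)
  have "bij_betw b UNIV C"
    using bij_betw_combine[OF 12 3] assms(3) by (simp add: Un_absorb1)
  then show ?thesis using that 1 12 by (simp add: bij_betw_def)
qed

text \<open>The columns of \<open>G\<close> form a basis that extends one of \<open>U'\<close> first
  to \<open>U\<close> and then to the whole space; multiplication by the inverse \<open>H\<close>
  reads off coordinates in it.\<close>

lemma adapted_basis:
  fixes U' U :: "('a::field ^ 'i::finite) set"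
  assumes "vec.subspace U'" "vec.subspace U" "U' \<subseteq> U" "S' \<subseteq> S"
    and "card S' = vec.dim U'" "card S = vec.dim U"
  obtains G H :: "'a ^ 'i ^ 'i" where "G ** H = mat 1" "H ** G = mat 1"
    "(*v) G ` coord_subspace S' = U'" "(*v) G ` coord_subspace S = U"
proof -
  obtain B' where B': "B' \<subseteq> U'" "vec.independent B'" "U' \<subseteq> vec.span B'" "card B' = vec.dim U'"
    using vec.basis_exists[of U'] by metis
  have "B' \<subseteq> U" using B'(1) assms(3) by simp
  then obtain B where B: "B' \<subseteq> B" "B \<subseteq> U" "vec.independent B" "U \<subseteq> vec.span B"
    using vec.maximal_independent_subset_extend[OF _ B'(2), of U] by blast
  obtain C where C: "B \<subseteq> C" "vec.independent C" "UNIV \<subseteq> vec.span C"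
    by (rule vec.maximal_independent_subset_extend[OF subset_UNIV B(3)])
  have finC: "finite C" using C(2) by (rule vec.finiteI_independent)
  have cardB: "card B = vec.dim U" using B vec.basis_card_eq_dim by blast
  have cardC: "card C = CARD('i)" using C vec.basis_card_eq_dim[of C UNIV] vec_dim_card by auto
  obtain b where b: "bij_betw b UNIV C" "b ` S' = B'" "b ` S = B"
    using exists_bij_flag[OF assms(4) B(1) C(1) finC] assms(5,6) B'(4) cardB cardC by metis
  define G where "G = (\<chi> i j. b j $ i)"
  have Gaxis: "G *v axis j 1 = b j" for j
    by (simp add: matrix_vector_mult_def axis_def G_def vec_eq_iff if_distrib cong: if_cong)
  have Gimage: "(*v) G ` coord_subspace T = vec.span (b ` T)" for T
    unfolding coord_subspace_eq_span vec.span_image[symmetric] by (simp add: image_image Gaxis)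
  have "(*v) G ` UNIV = UNIV"
  proof -
    have "coord_subspace UNIV = (UNIV :: ('a ^ 'i) set)" by (auto simp: coord_subspace_def)
    then show ?thesis using Gimage[of UNIV] b(1) C(3) by (auto simp: bij_betw_def)
  qed
  then obtain H where H: "G ** H = mat 1" using matrix_right_invertible_surjective[of G] by auto
  then have "H ** G = mat 1" by (simp add: matrix_left_right_inverse)
  moreover have "vec.span B' = U'" "vec.span B = U"
    using B B' assms(1,2) vec.span_subspace by blast+
  ultimately show ?thesis using that[of G H] H b(2,3) Gimage by simp
qed

lemma adapted_basis1:
  fixes U :: "('a::field ^ 'i::finite) set"
  assumes "vec.subspace U" "card S = vec.dim U"
  obtains G H :: "'a ^ 'i ^ 'i" where "G ** H = mat 1" "H ** G = mat 1"
    "(*v) G ` coord_subspace S = U"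
  using adapted_basis[OF assms(1) assms(1) subset_refl subset_refl assms(2) assms(2)] by metis

lemma mem_image_coord_subspace:
  fixes G H :: "'a::field ^ 'i::finite ^ 'i"
  assumes "G ** H = mat 1" "H ** G = mat 1"
  shows "x \<in> (*v) G ` coord_subspace S \<longleftrightarrow> (\<forall>i. i \<notin> S \<longrightarrow> (H *v x) $ i = 0)"
proof
  assume "x \<in> (*v) G ` coord_subspace S"
  then show "\<forall>i. i \<notin> S \<longrightarrow> (H *v x) $ i = 0"
    by (auto simp: matrix_vector_mul_assoc assms coord_subspace_def)
next
  assume "\<forall>i. i \<notin> S \<longrightarrow> (H *v x) $ i = 0"
  then have "H *v x \<in> coord_subspace S" by (simp add: coord_subspace_def)
  moreover have "x = G *v (H *v x)" by (simp add: matrix_vector_mul_assoc assms)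
  ultimately show "x \<in> (*v) G ` coord_subspace S" by blast
qed

text \<open>The rows of \<open>H\<close> with index outside \<open>S\<close> are equations for
  \<open>R\<close>, and one of them fails at \<open>w\<close>.\<close>

lemma exists_functional:
  fixes R :: "('a::field ^ 'i::finite) set"
  assumes "vec.subspace R" "w \<notin> R"
  obtains c :: "'a ^ 'i" where "\<And>v. v \<in> R \<Longrightarrow> (\<Sum>i\<in>UNIV. c $ i * v $ i) = 0"
    "(\<Sum>i\<in>UNIV. c $ i * w $ i) \<noteq> 0"
proof -
  have "vec.dim R \<le> CARD('i)" by (rule dim_subset_UNIV_cart_gen)
  then obtain S :: "'i set" where S: "card S = vec.dim R"
    using obtain_subset_with_card_n[of "vec.dim R" "UNIV :: 'i set"] by metis
  obtain G H :: "'a ^ 'i ^ 'i" where G: "G ** H = mat 1" "H ** G = mat 1" "(*v) G ` coord_subspace S = R"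
    using adapted_basis1[OF assms(1) S] by metis
  have R: "v \<in> R \<longleftrightarrow> (\<forall>i. i \<notin> S \<longrightarrow> (H *v v) $ i = 0)" for v
    using mem_image_coord_subspace[OF G(1,2)] G(3) by auto
  obtain i where i: "i \<notin> S" "(H *v w) $ i \<noteq> 0" using assms(2) R by blast
  show ?thesis
  proof (rule that[of "H $ i"])
    fix v assume "v \<in> R"
    then show "(\<Sum>k\<in>UNIV. H $ i $ k * v $ k) = 0" using R i(1) by (simp add: matrix_vector_mult_def)
  qed (use i(2) in \<open>simp add: matrix_vector_mult_def\<close>)
qed

lemma subspace_form_cone:
  fixes W :: "('a::alg_closed_field ^ 'i::finite) set"
  assumes "vec.subspace W"
  shows "form_closed W" "scale_closed W" "\<exists>v\<in>W. v \<noteq> 0 \<Longrightarrow> form_irreducible (W - {0})"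
proof -
  show "form_closed W"
    unfolding form_closed_def
  proof (intro allI impI)
    fix v assume "v \<notin> W"
    then obtain c where c: "\<And>w. w \<in> W \<Longrightarrow> (\<Sum>i\<in>UNIV. c $ i * w $ i) = 0" "(\<Sum>i\<in>UNIV. c $ i * v $ i) \<noteq> 0"
      using exists_functional[OF assms] by metis
    have "formfun 1 (\<lambda>w. \<Sum>i\<in>UNIV. c $ i * w $ i)"
      by (intro formfun_sum formfun_cmult formfun_coord)
    then show "\<exists>k F. formfun k F \<and> F v \<noteq> 0 \<and> (\<forall>w\<in>W. F w = 0)" using c by blast
  qed
  show "scale_closed W" using assms by (simp add: scale_closed_def vec.subspace_scale)
  assume ne: "\<exists>v\<in>W. v \<noteq> 0"
  show "form_irreducible (W - {0})"
  proof (rule form_irreducible_by_curves[OF ne])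
    fix x y assume xy: "x \<in> W" "y \<in> W"
    have "(\<chi> i. poly [:x $ i, y $ i - x $ i:] t) = x + t *s (y - x)" for t
      by (simp add: vec_eq_iff right_diff_distrib)
    moreover have "x + t *s (y - x) \<in> W" for t
      using xy assms by (intro vec.subspace_add vec.subspace_scale vec.subspace_diff)
    ultimately show "\<exists>p E a b. finite E \<and> a \<noteq> 0 \<and> b \<noteq> 0 \<and> (\<forall>t. t \<notin> E \<longrightarrow> (\<chi> i. poly (p i) t) \<in> W) \<and>
        (\<chi> i. poly (p i) 0) = a *s x \<and> (\<chi> i. poly (p i) 1) = b *s y"
      by (intro exI[of _ "\<lambda>i. [:x $ i, y $ i - x $ i:]"] exI[of _ "{}"] exI[of _ 1]) simp
  qed
qed

section \<open>Invariant subspaces\<close>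

definition invariant :: "'a::field ^ 'n::finite ^ 'n \<Rightarrow> ('a ^ 'n) set \<Rightarrow> bool" where
  "invariant A U \<longleftrightarrow> vec.subspace U \<and> (\<forall>u\<in>U. A *v u \<in> U)"

text \<open>This is \<open>p(A) v\<close>, computed by Horner's scheme.\<close>

definition poly_act :: "'a::field ^ 'n::finite ^ 'n \<Rightarrow> 'a poly \<Rightarrow> 'a ^ 'n \<Rightarrow> 'a ^ 'n" where
  "poly_act A p v = fold_coeffs (\<lambda>a w. a *s v + A *v w) p 0"

lemma poly_act_0 [simp]: "poly_act A 0 v = 0"
  by (simp add: poly_act_def)

lemma poly_act_pCons: "poly_act A (pCons a p) v = a *s v + A *v poly_act A p v"
  by (cases "p = 0 \<and> a = 0") (auto simp: poly_act_def)

lemma poly_act_add: "poly_act A (p + q) v = poly_act A p v + poly_act A q v"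
proof (induction p arbitrary: q)
  case (pCons a p)
  then show ?case
    by (cases q) (simp add: poly_act_pCons vec.scale_left_distrib vec.add algebra_simps)
qed simp

lemma poly_act_smult: "poly_act A (smult c p) v = c *s poly_act A p v"
  by (induction p) (auto simp: poly_act_pCons vec.scale_right_distrib vec.scale)

lemma poly_act_sum: "poly_act A (sum p I) v = (\<Sum>i\<in>I. poly_act A (p i) v)"
  by (induction I rule: infinite_finite_induct) (auto simp: poly_act_add)

lemma invariant_poly_act:
  assumes "invariant A U" "v \<in> U"
  shows "poly_act A p v \<in> U"
  using assms by (induction p)
    (auto simp: poly_act_pCons invariant_def vec.subspace_0 vec.subspace_add vec.subspace_scale)

text \<open>The first \<open>CARD('n) + 1\<close> vectors among \<open>v\<close>,
  \<open>A v\<close>, \<open>A (A v)\<close> and so on cannot be independent.\<close>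

lemma exists_annihilating_poly:
  fixes A :: "'a::field ^ 'n::finite ^ 'n"
  obtains p where "p \<noteq> 0" "poly_act A p v = 0"
proof -
  have "\<exists>p. p \<noteq> 0 \<and> poly_act A p v = 0"
  proof (rule ccontr)
    assume neg: "\<not> ?thesis"
    define m where "m i = poly_act A (monom 1 i) v" for i
    have ind: "\<forall>i\<in>I. u i = 0" if fin: "finite I" and 0: "(\<Sum>i\<in>I. u i *s m i) = 0" for u :: "nat \<Rightarrow> 'a" and I
    proof -
      have "poly_act A (\<Sum>i\<in>I. smult (u i) (monom 1 i)) v = 0"
        using 0 by (simp only: poly_act_sum poly_act_smult m_def)
      then have p0: "(\<Sum>i\<in>I. smult (u i) (monom 1 i)) = 0" using neg by blast
      have "coeff (\<Sum>i\<in>I. smult (u i) (monom 1 i)) j = (\<Sum>i\<in>I. if i = j then u i else 0)" for j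
        by (auto simp: coeff_sum intro: sum.cong)
      then have "(if j \<in> I then u j else 0) = 0" for j using p0 fin by simp
      then show ?thesis by meson
    qed
    let ?I = "{..CARD('n)}"
    have inj: "inj_on m ?I"
    proof (rule inj_onI, rule ccontr)
      fix i j assume "m i = m j" "i \<noteq> j"
      then show False using ind[of "{i, j}" "\<lambda>k. if k = i then 1 else -1"] by simp
    qed
    have "vec.independent (m ` ?I)"
    proof (rule vec.independent_if_scalars_zero)
      fix f x assume f: "(\<Sum>x\<in>m ` ?I. f x *s x) = 0" and x: "x \<in> m ` ?I"
      have "\<forall>i\<in>?I. f (m i) = 0" by (rule ind) (use f in \<open>simp_all add: sum.reindex[OF inj]\<close>)
      then show "f x = 0" using x by auto
    qed simp
    then have "card (m ` ?I) \<le> vec.dim (UNIV :: ('a ^ 'n) set)"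
      by (intro vec.independent_card_le_dim) auto
    then show False by (simp add: card_image[OF inj] card_cart_basis)
  qed
  then show ?thesis using that by blast
qed

text \<open>Take a polynomial \<open>p\<close> of least degree with \<open>p(A) v0\<close> in
  \<open>U\<close> and split off a linear factor \<open>X - l\<close>. By minimality the cofactor
  sends \<open>v0\<close> outside \<open>U\<close>, to an eigenvector modulo \<open>U\<close> for
  \<open>l\<close>.\<close>

lemma exists_eigenvector_modulo:
  fixes A :: "'a::alg_closed_field ^ 'n::finite ^ 'n"
  assumes "invariant A U" "invariant A W" "U \<subset> W"
  obtains v c where "v \<in> W" "v \<notin> U" "A *v v - c *s v \<in> U"
proof -
  obtain v0 where v0: "v0 \<in> W" "v0 \<notin> U" using assms(3) by auto
  have U: "vec.subspace U" using assms(1) by (simp add: invariant_def)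
  define P where "P p \<longleftrightarrow> p \<noteq> 0 \<and> poly_act A p v0 \<in> U" for p
  obtain p0 where "P p0"
    using exists_annihilating_poly[of A v0] vec.subspace_0[OF U] unfolding P_def by metis
  define p where "p = arg_min degree P"
  have p: "P p" unfolding p_def using \<open>P p0\<close> by (rule arg_min_natI)
  have min: "degree p \<le> degree q" if "P q" for q unfolding p_def using that by (rule arg_min_nat_le)
  have "degree p > 0"
  proof (rule ccontr)
    assume "\<not> degree p > 0"
    then obtain c where c: "p = [:c:]" using degree_eq_zeroE by blast
    with p have "c \<noteq> 0" "c *s v0 \<in> U" by (auto simp: P_def poly_act_pCons)
    then have "inverse c *s (c *s v0) \<in> U" using U vec.subspace_scale by blast
    then show False using v0(2) \<open>c \<noteq> 0\<close> by simp
  qed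
  then obtain l where "poly p l = 0" using alg_closed_imp_poly_has_root by blast
  then obtain q where q: "p = [:-l, 1:] * q" by (metis poly_eq_0_iff_dvd dvdE)
  then have q0: "q \<noteq> 0" using p by (auto simp: P_def)
  then have "degree p = Suc (degree q)" unfolding q by (subst degree_mult_eq) auto
  then have "\<not> P q" using min[of q] by auto
  then have "poly_act A q v0 \<notin> U" using q0 by (simp add: P_def)
  moreover have "poly_act A p v0 = A *v poly_act A q v0 - l *s poly_act A q v0"
  proof -
    have "p = smult (- l) q + pCons 0 q" unfolding q by (simp add: mult_pCons_left)
    then show ?thesis by (simp only: poly_act_add poly_act_smult poly_act_pCons) simp
  qed
  moreover have "poly_act A q v0 \<in> W" using invariant_poly_act[OF assms(2) v0(1)] .
  ultimately show ?thesis using that p by (metis P_def)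
qed

lemma invariant_span_insert:
  fixes A :: "'a::field ^ 'n::finite ^ 'n"
  assumes "invariant A U" "A *v v - c *s v \<in> U"
  shows "invariant A (vec.span (insert v U))"
  unfolding invariant_def
proof (intro conjI ballI vec.subspace_span)
  have spanU: "vec.span U = U" using assms(1) by (simp add: invariant_def)
  fix x assume "x \<in> vec.span (insert v U)"
  then obtain k where k: "x - k *s v \<in> U" using spanU by (auto simp: vec.span_breakdown_eq)
  have "A *v (x - k *s v) + k *s (A *v v - c *s v) \<in> U"
    using assms k unfolding invariant_def by (blast intro: vec.subspace_add vec.subspace_scale)
  then have "A *v x - (k * c) *s v \<in> U"
    by (simp add: vec.diff vec.scale vec.scale_right_diff_distrib)
  then show "A *v x \<in> vec.span (insert v U)" unfolding vec.span_breakdown_eq spanU by blast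
qed

text \<open>An eigenvector modulo \<open>V\<close> enlarges an invariant space by exactly one
  dimension, so every intermediate dimension occurs.\<close>

lemma exists_invariant_between:
  fixes A :: "'a::alg_closed_field ^ 'n::finite ^ 'n"
  assumes "invariant A U" "invariant A W" "U \<subseteq> W" "vec.dim U \<le> k" "k \<le> vec.dim W"
  obtains V where "invariant A V" "U \<subseteq> V" "V \<subseteq> W" "vec.dim V = k"
proof -
  have "\<exists>V. invariant A V \<and> U \<subseteq> V \<and> V \<subseteq> W \<and> vec.dim V = k"
    using assms(4,5)
  proof (induction k rule: dec_induct)
    case base
    then show ?case using assms by blast
  next
    case (step k)
    then obtain V where V: "invariant A V" "U \<subseteq> V" "V \<subseteq> W" "vec.dim V = k" by auto
    then have "V \<subset> W" using step by auto
    then obtain v c where v: "v \<in> W" "v \<notin> V" "A *v v - c *s v \<in> V"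
      using exists_eigenvector_modulo[OF V(1) assms(2)] by metis
    have sub: "vec.subspace V" "vec.subspace W" using V(1) assms(2) by (auto simp: invariant_def)
    have "vec.span (insert v V) \<subseteq> W" using V(3) v(1) sub by (intro vec.span_minimal) auto
    moreover have "vec.dim (vec.span (insert v V)) = Suc k"
      using v(2) sub V(4) by (simp add: vec.dim_insert vec.span_eq_iff[THEN iffD2])
    moreover have "V \<subseteq> vec.span (insert v V)" by (auto intro: vec.span_base)
    ultimately show ?case using invariant_span_insert[OF V(1) v(3)] V(2) by blast
  qed
  then show ?thesis using that by blast
qed

text \<open>Induction on the dimension through an invariant hyperplane of \<open>U\<close> and an
  eigenvector modulo it. The diagonal entries \<open>a\<close> are what is later perturbed.\<close>

lemma exists_triangular_basis:
  fixes A :: "'a::alg_closed_field ^ 'n::finite ^ 'n"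
  assumes "invariant A U" "vec.dim U = k"
  shows "\<exists>v a. U = vec.span (v ` {..<k}) \<and>
    (\<forall>i<k. v i \<notin> vec.span (v ` {..<i}) \<and> A *v v i - a i *s v i \<in> vec.span (v ` {..<i}))"
  using assms
proof (induction k arbitrary: U)
  case 0
  then have "U = {0}" by (auto simp: invariant_def dest: vec.subspace_0)
  then show ?case by simp
next
  case (Suc k)
  have "invariant A {0}" by (simp add: invariant_def)
  moreover have "{0} \<subseteq> U" using Suc.prems(1) by (auto simp: invariant_def dest: vec.subspace_0)
  ultimately obtain V where V: "invariant A V" "V \<subseteq> U" "vec.dim V = k"
    using exists_invariant_between[of A "{0}" U k] Suc.prems by auto
  then have "V \<subset> U" using Suc.prems(2) by auto
  then obtain w c where w: "w \<in> U" "w \<notin> V" "A *v w - c *s w \<in> V"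
    using exists_eigenvector_modulo[OF V(1) Suc.prems(1)] by metis
  obtain v a where v: "V = vec.span (v ` {..<k})"
    "\<And>i. i < k \<Longrightarrow> v i \<notin> vec.span (v ` {..<i}) \<and> A *v v i - a i *s v i \<in> vec.span (v ` {..<i})"
    using Suc.IH[OF V(1,3)] by auto
  have im: "v(k := w) ` {..<i} = v ` {..<i}" if "i \<le> k" for i using that by (auto simp: image_iff)
  have imS: "v(k := w) ` {..<Suc k} = insert w (v ` {..<k})"
    unfolding lessThan_Suc image_insert im[OF order_refl] by simp
  have subU: "vec.subspace U" "vec.subspace V" using Suc.prems V by (auto simp: invariant_def)
  have "vec.span (insert w (v ` {..<k})) = vec.span (insert w V)"
    unfolding vec.span_insert v(1) by (simp add: vec.span_span)
  also have "\<dots> = U"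
  proof (rule vec.subspace_dim_equal)
    show "vec.span (insert w V) \<subseteq> U" using V(2) w(1) subU by (intro vec.span_minimal) auto
    show "vec.dim U \<le> vec.dim (vec.span (insert w V))"
      using w(2) subU V(3) Suc.prems(2) by (simp add: vec.dim_insert vec.span_eq_iff[THEN iffD2])
  qed (use subU in auto)
  finally have span: "U = vec.span (v(k := w) ` {..<Suc k})" by (simp only: imS)
  show ?case
  proof (intro exI[of _ "v(k := w)"] exI[of _ "a(k := c)"] conjI span allI impI)
    fix i assume "i < Suc k"
    then consider "i < k" | "i = k" by linarith
    then show "(v(k := w)) i \<notin> vec.span (v(k := w) ` {..<i})"
      "A *v (v(k := w)) i - (a(k := c)) i *s (v(k := w)) i \<in> vec.span (v(k := w) ` {..<i})"
      using v w by (cases; simp add: im)+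
  qed
qed

lemma span_image_lessThan:
  fixes u :: "nat \<Rightarrow> 'a::field ^ 'n::finite"
  assumes "x \<in> vec.span (u ` {..<k})"
  shows "\<exists>c. x = (\<Sum>i<k. c i *s u i)"
  using assms
proof (induction k arbitrary: x)
  case (Suc k)
  then obtain t where "x - t *s u k \<in> vec.span (u ` {..<k})"
    by (auto simp: lessThan_Suc vec.span_breakdown_eq)
  then obtain c where "x - t *s u k = (\<Sum>i<k. c i *s u i)" using Suc.IH by blast
  then have "x = (\<Sum>i<Suc k. (c(k := t)) i *s u i)" by (simp add: algebra_simps)
  then show ?case by blast
qed simp

lemma triangular_distinct_eigenbasis:
  fixes X :: "'a::field ^ 'n::finite ^ 'n" and k :: nat
  assumes "\<forall>i<k. X *v v i - l i *s v i \<in> vec.span (v ` {..<i})"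
    and "inj_on l {..<k}"
  shows "\<exists>u. vec.span (u ` {..<k}) = vec.span (v ` {..<k}) \<and> (\<forall>i<k. X *v u i = l i *s u i)"
  using assms
proof (induction k)
  case (Suc k)
  obtain u where u: "vec.span (u ` {..<k}) = vec.span (v ` {..<k})" "\<And>i. i < k \<Longrightarrow> X *v u i = l i *s u i"
    using Suc.IH Suc.prems by (force simp: inj_on_def)
  define h where "h = X *v v k - l k *s v k"
  have "h \<in> vec.span (u ` {..<k})" using Suc.prems(1) by (simp add: u h_def)
  then obtain c where c: "h = (\<Sum>i<k. c i *s u i)" using span_image_lessThan by blast
  \<comment> \<open>This solves \<open>(X - l k) g = h\<close> in the eigenvectors already found;
    subtracting it from \<open>v k\<close> leaves an exact eigenvector.\<close>
  define g where "g = (\<Sum>i<k. (c i / (l i - l k)) *s u i)"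
  have ne: "l i \<noteq> l k" if "i < k" for i using Suc.prems(2) that by (auto simp: inj_on_def)
  have "X *v g = (\<Sum>i<k. (c i / (l i - l k) * l i) *s u i)"
    unfolding g_def vec.sum by (intro sum.cong) (auto simp: vec.scale u(2))
  then have "X *v g - l k *s g = (\<Sum>i<k. (c i / (l i - l k) * l i - l k * (c i / (l i - l k))) *s u i)"
    by (simp add: g_def vec.scale_sum_right vec.scale_left_diff_distrib sum_subtractf)
  also have "\<dots> = h"
    unfolding c
  proof (intro sum.cong refl)
    fix i assume "i \<in> {..<k}"
    then have "c i / (l i - l k) * (l i - l k) = c i" using ne by simp
    then have "c i / (l i - l k) * l i - l k * (c i / (l i - l k)) = c i"
      by (simp only: right_diff_distrib[of "c i / (l i - l k)"] mult.commute[of "l k"])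
    then show "(c i / (l i - l k) * l i - l k * (c i / (l i - l k))) *s u i = c i *s u i" by simp
  qed
  finally have g: "X *v g - l k *s g = h" .
  have gspan: "g \<in> vec.span (v ` {..<k})"
    unfolding u(1)[symmetric] g_def by (intro vec.span_sum vec.span_scale vec.span_base) auto
  define w where "w = v k - g"
  have Xw: "X *v w = l k *s w"
    using g by (simp add: w_def h_def vec.diff vec.scale_right_diff_distrib algebra_simps)
  have im: "u(k := w) ` {..<Suc k} = insert w (u ` {..<k})"
    unfolding lessThan_Suc image_insert by (auto simp: image_iff)
  have im': "v ` {..<Suc k} = insert (v k) (v ` {..<k})" by (simp add: lessThan_Suc)
  have "vec.span (insert w (u ` {..<k})) = vec.span (insert w (v ` {..<k}))"
    unfolding vec.span_insert u(1) by simp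
  also have "\<dots> = vec.span (insert (v k) (v ` {..<k}))"
    by (rule vec.eq_span_insert_eq) (use gspan in \<open>simp add: w_def vec.span_neg\<close>)
  finally have span: "vec.span (u(k := w) ` {..<Suc k}) = vec.span (v ` {..<Suc k})"
    by (simp only: im im')
  show ?case
  proof (intro exI[of _ "u(k := w)"] conjI span allI impI)
    fix i assume "i < Suc k"
    then consider "i < k" | "i = k" by linarith
    then show "X *v (u(k := w)) i = l i *s (u(k := w)) i"
      using Xw u(2) by cases simp_all
  qed
qed simp

section \<open>The largest invariant subspace contained in a given subspace\<close>

text \<open>The entries range over a semiring because powers of matrices of polynomials are needed
  as well.\<close>

primrec mpow :: "'a::semiring_1 ^ 'n::finite ^ 'n \<Rightarrow> nat \<Rightarrow> 'a ^ 'n ^ 'n" where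
  "mpow A 0 = mat 1"
| "mpow A (Suc j) = mpow A j ** A"

definition maxinv :: "('a::field ^ 'n::finite) set \<Rightarrow> 'a ^ 'n ^ 'n \<Rightarrow> ('a ^ 'n) set" where
  "maxinv L A = {v. \<forall>j. mpow A j *v v \<in> L}"

lemma mpow_Suc_vec: "mpow A (Suc j) *v v = mpow A j *v (A *v v)"
  by (simp add: matrix_vector_mul_assoc)

lemma mpow_mem_invariant:
  assumes "invariant A U" "u \<in> U"
  shows "mpow A j *v u \<in> U"
  using assms(2)
proof (induction j arbitrary: u)
  case (Suc j)
  then show ?case using assms(1) by (auto simp: mpow_Suc_vec invariant_def simp del: mpow.simps)
qed simp

lemma maxinv_subset: "maxinv L A \<subseteq> L"
proof
  fix v assume "v \<in> maxinv L A"
  then have "mpow A 0 *v v \<in> L" unfolding maxinv_def by blast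
  then show "v \<in> L" by simp
qed

lemma invariant_maxinv:
  assumes "vec.subspace L"
  shows "invariant A (maxinv L A)"
  unfolding invariant_def
proof
  show "vec.subspace (maxinv L A)"
    by (rule vec.subspaceI)
       (use assms in \<open>auto simp: maxinv_def vec.add vec.scale vec.subspace_0 vec.subspace_add vec.subspace_scale\<close>)
  show "\<forall>u\<in>maxinv L A. A *v u \<in> maxinv L A"
  proof
    fix u assume "u \<in> maxinv L A"
    then have "mpow A (Suc j) *v u \<in> L" for j unfolding maxinv_def by blast
    then show "A *v u \<in> maxinv L A" by (simp only: maxinv_def mpow_Suc_vec mem_Collect_eq) simp
  qed
qed

lemma invariant_subset_maxinv: "invariant A U \<Longrightarrow> U \<subseteq> L \<Longrightarrow> U \<subseteq> maxinv L A"
  unfolding maxinv_def using mpow_mem_invariant by blast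

lemma maxinv_mono: "L' \<subseteq> L \<Longrightarrow> maxinv L' A \<subseteq> maxinv L A"
  by (auto simp: maxinv_def)

lemma exists_invariant_iff_maxinv:
  assumes "vec.subspace L"
  shows "(\<exists>U. vec.subspace U \<and> (\<forall>u\<in>U. A *v u \<in> U) \<and> s \<le> vec.dim U \<and> U \<subseteq> L) \<longleftrightarrow>
    s \<le> vec.dim (maxinv L A)"
proof
  assume "\<exists>U. vec.subspace U \<and> (\<forall>u\<in>U. A *v u \<in> U) \<and> s \<le> vec.dim U \<and> U \<subseteq> L"
  then obtain U where U: "invariant A U" "s \<le> vec.dim U" "U \<subseteq> L" by (auto simp: invariant_def)
  then have "U \<subseteq> maxinv L A" by (simp add: invariant_subset_maxinv)
  then show "s \<le> vec.dim (maxinv L A)" using U(2) vec.dim_subset by (meson le_trans)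
next
  assume "s \<le> vec.dim (maxinv L A)"
  then show "\<exists>U. vec.subspace U \<and> (\<forall>u\<in>U. A *v u \<in> U) \<and> s \<le> vec.dim U \<and> U \<subseteq> L"
    using invariant_maxinv[OF assms, of A] maxinv_subset[of L A] by (auto simp: invariant_def)
qed

section \<open>Matrices as vectors\<close>

definition coords_mat :: "'a ^ ('n::finite \<times> 'n) \<Rightarrow> 'a ^ 'n ^ 'n" where
  "coords_mat v = (\<chi> i j. v $ (i, j))"

lemma coords_mat_nth [simp]: "coords_mat v $ i $ j = v $ (i, j)"
  by (simp add: coords_mat_def)

lemma mat_coords_nth [simp]: "mat_coords A $ (i, j) = A $ i $ j"
  by (simp add: mat_coords_def)

lemma coords_mat_inverse [simp]: "coords_mat (mat_coords A) = A"
  by (simp add: vec_eq_iff)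

lemma mat_coords_inverse [simp]: "mat_coords (coords_mat v) = v"
  by (simp add: vec_eq_iff)

lemma mat_coords_add: "mat_coords (A + B) = mat_coords A + mat_coords B"
  by (simp add: vec_eq_iff)

lemma mat_coords_zero [simp]: "mat_coords 0 = 0"
  by (simp add: vec_eq_iff)

lemma mat_coords_eq_0_iff [simp]: "mat_coords A = 0 \<longleftrightarrow> A = 0"
  by (metis coords_mat_inverse mat_coords_zero)

text \<open>Scalar multiples of matrices are written as products with \<open>mat c\<close>
  throughout.\<close>

lemma mat_scale_nth: "(mat c ** A) $ i $ j = c * A $ i $ j" for A :: "'a::comm_ring_1 ^ 'n::finite ^ 'n"
  by (simp add: matrix_matrix_mult_def mat_def if_distrib[of "\<lambda>x. x * _"] cong: if_cong)

lemma mat_scale_nth': "(A ** mat c) $ i $ j = c * A $ i $ j" for A :: "'a::comm_ring_1 ^ 'n::finite ^ 'n"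
  by (simp add: matrix_matrix_mult_def mat_def if_distrib[of "\<lambda>x. _ * x"] mult.commute cong: if_cong)

lemma mat_commute: "mat c ** A = A ** mat c" for A :: "'a::comm_ring_1 ^ 'n::finite ^ 'n"
  by (simp add: vec_eq_iff mat_scale_nth mat_scale_nth')

lemma mat_scale_vec: "(mat c ** A) *v x = c *s (A *v x)" for A :: "'a::comm_ring_1 ^ 'n::finite ^ 'n"
  by (simp add: vec_eq_iff matrix_vector_mult_def mat_scale_nth sum_distrib_left mult.assoc)

lemma mat_coords_scale: "mat_coords (mat c ** A) = c *s mat_coords A" for A :: "'a::comm_ring_1 ^ 'n::finite ^ 'n"
  by (simp add: vec_eq_iff mat_scale_nth)

lemma matrix_add_rdistrib: "(A + B) ** C = A ** C + B ** C"
  for C :: "'a::comm_ring_1 ^ 'n::finite ^ 'n"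
  by (simp add: matrix_matrix_mult_def vec_eq_iff distrib_right sum.distrib)

lemma matrix_mul_sum_right: "B ** (\<Sum>i\<in>I. f i) = (\<Sum>i\<in>I. B ** f i)"
  for B :: "'a::comm_ring_1 ^ 'n::finite ^ 'n"
  by (induction I rule: infinite_finite_induct) (auto simp: matrix_add_ldistrib)

lemma sum_matrix_vec: "(\<Sum>i\<in>I. f i) *v x = (\<Sum>i\<in>I. f i *v x)"
  for x :: "'a::comm_ring_1 ^ 'n::finite" and f :: "'c \<Rightarrow> 'a ^ 'n ^ 'n"
  by (induction I rule: infinite_finite_induct) (auto simp: matrix_vector_mult_add_rdistrib)

section \<open>Matrices annihilating the largest invariant subspace\<close>

definition kills :: "'a::field ^ 'n::finite ^ 'n \<Rightarrow> ('a ^ 'n) set \<Rightarrow> bool" where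
  "kills Q L \<longleftrightarrow> (\<forall>v\<in>L. Q *v v = 0)"

text \<open>The rows of \<open>obs J Q X\<close> are linear combinations of rows of the observability matrix of \<open>X\<close>,
  which consists of the rows \<open>q ** mpow X j\<close> with \<open>q\<close> vanishing on \<open>L\<close>.\<close>

definition obs :: "nat \<Rightarrow> (nat \<Rightarrow> 'a::semiring_1 ^ 'n::finite ^ 'n) \<Rightarrow> 'a ^ 'n ^ 'n \<Rightarrow> 'a ^ 'n ^ 'n" where
  "obs J Q X = (\<Sum>j<J. Q j ** mpow X j)"

lemma obs_maxinv:
  assumes "\<And>j. kills (Q j) L" "u \<in> maxinv L X"
  shows "obs J Q X *v u = 0"
  using assms by (simp add: obs_def sum_matrix_vec kills_def maxinv_def flip: matrix_vector_mul_assoc)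

lemma subspace_obs:
  fixes X :: "'a::field ^ 'n::finite ^ 'n"
  shows "vec.subspace {mat_coords (obs J Q X) | J Q. \<forall>j. kills (Q j) L}"
    (is "vec.subspace ?S")
proof (rule vec.subspaceI)
  have "0 = mat_coords (obs 0 (\<lambda>_. 0) X)" by (simp add: obs_def)
  moreover have "kills 0 L" by (simp add: kills_def)
  ultimately show "0 \<in> ?S" by blast
  fix x y assume "x \<in> ?S" "y \<in> ?S"
  then obtain J Q J' Q' where xy: "x = mat_coords (obs J Q X)" "y = mat_coords (obs J' Q' X)"
    and k: "\<forall>j. kills (Q j) L" "\<forall>j. kills (Q' j) L" by auto
  define P where "P j = (if j < J then Q j else 0) + (if j < J' then Q' j else 0)" for j
  have pad: "obs K R X = obs (max J J') (\<lambda>j. if j < K then R j else 0) X"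
    if "K \<le> max J J'" for K and R :: "nat \<Rightarrow> 'a ^ 'n ^ 'n"
    unfolding obs_def using that by (intro sum.mono_neutral_cong_left) auto
  have "obs J Q X + obs J' Q' X = obs (max J J') P X"
    unfolding pad[of J Q, OF max.cobounded1] pad[of J' Q', OF max.cobounded2]
    by (simp add: obs_def P_def matrix_add_rdistrib sum.distrib)
  moreover have "\<forall>j. kills (P j) L"
    using k by (auto simp: kills_def P_def matrix_vector_mult_add_rdistrib)
  ultimately show "x + y \<in> ?S" unfolding xy mat_coords_add[symmetric] by auto
next
  fix x c assume "x \<in> ?S"
  then obtain J Q where x: "x = mat_coords (obs J Q X)" and k: "\<forall>j. kills (Q j) L" by auto
  have "mat c ** obs J Q X = obs J (\<lambda>j. mat c ** Q j) X"
    by (simp add: obs_def matrix_mul_sum_right matrix_mul_assoc)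
  moreover have "\<forall>j. kills (mat c ** Q j) L" using k by (simp add: kills_def mat_scale_vec)
  ultimately show "c *s x \<in> ?S" unfolding x mat_coords_scale[symmetric] by auto
qed

text \<open>A linear form on matrices that vanishes on all \<open>obs J Q X\<close> has its rows in the largest invariant
  subspace, hence it vanishes on \<open>T\<close>.\<close>

lemma exists_obs_eq:
  fixes X T :: "'a::field ^ 'n::finite ^ 'n"
  assumes L: "vec.subspace L" and T: "kills T (maxinv L X)"
  obtains J Q where "\<And>j. kills (Q j) L" "obs J Q X = T"
proof -
  define S where "S = {mat_coords (obs J Q X) | J Q. \<forall>j. kills (Q j) L}"
  have subS: "vec.subspace S" unfolding S_def by (rule subspace_obs)
  have "mat_coords T \<in> S"
  proof (rule ccontr)
    assume "mat_coords T \<notin> S"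
    then obtain c where c: "\<And>v. v \<in> S \<Longrightarrow> (\<Sum>i\<in>UNIV. c $ i * v $ i) = 0"
      "(\<Sum>i\<in>UNIV. c $ i * mat_coords T $ i) \<noteq> 0"
      using exists_functional[OF subS] by metis
    define r where "r a = (\<chi> b. c $ (a, b))" for a
    have pair: "(\<Sum>i\<in>UNIV. c $ i * mat_coords M $ i) = (\<Sum>a\<in>UNIV. \<Sum>b\<in>UNIV. M $ a $ b * r a $ b)" for M :: "'a ^ 'n ^ 'n"
      unfolding UNIV_Times_UNIV[symmetric] sum.cartesian_product
      by (intro sum.cong) (auto simp: r_def mult.commute)
    have "r a \<in> maxinv L X" for a
    proof -
      have "mpow X j *v r a \<in> L" for j
      proof (rule ccontr)
        assume "mpow X j *v r a \<notin> L"
        then obtain q where q: "\<And>v. v \<in> L \<Longrightarrow> (\<Sum>i\<in>UNIV. q $ i * v $ i) = 0"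
          "(\<Sum>i\<in>UNIV. q $ i * (mpow X j *v r a) $ i) \<noteq> 0"
          using exists_functional[OF L] by metis
        \<comment> \<open>Only row \<open>a\<close> of this matrix is nonzero, so pairing
          \<open>c\<close> with \<open>Q ** mpow X j\<close> gives the value of \<open>q\<close> at
          \<open>mpow X j *v r a\<close>.\<close>
        define Q where "Q = (\<chi> a' b. if a' = a then q $ b else 0)"
        have Qv: "(Q *v v) $ a' = (if a' = a then \<Sum>i\<in>UNIV. q $ i * v $ i else 0)" for v a'
          by (simp add: Q_def matrix_vector_mult_def)
        have killsQ: "kills Q L" using q(1) by (simp add: kills_def vec_eq_iff Qv)
        have "obs (Suc j) (\<lambda>i. if i = j then Q else 0) X = Q ** mpow X j" by (simp add: obs_def)
        moreover have "\<forall>i. kills (if i = j then Q else 0) L" using killsQ by (simp add: kills_def)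
        ultimately have "mat_coords (Q ** mpow X j) \<in> S"
          unfolding S_def by (intro CollectI exI[of _ "Suc j"] exI[of _ "\<lambda>i. if i = j then Q else 0"]) simp
        then have "(\<Sum>a'\<in>UNIV. \<Sum>b\<in>UNIV. (Q ** mpow X j) $ a' $ b * r a' $ b) = 0"
          using c(1) pair by metis
        then have "(\<Sum>a'\<in>UNIV. (Q *v (mpow X j *v r a')) $ a') = 0"
          unfolding matrix_vector_mul_assoc by (simp add: matrix_vector_mult_def)
        then show False using q(2) by (simp add: Qv)
      qed
      then show ?thesis by (simp add: maxinv_def)
    qed
    then have "(T *v r a) $ a = 0" for a using T by (simp add: kills_def)
    then have "(\<Sum>b\<in>UNIV. T $ a $ b * r a $ b) = 0" for a by (simp add: matrix_vector_mult_def)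
    then show False using c(2) pair by simp
  qed
  then obtain J Q where "\<forall>j. kills (Q j) L" "mat_coords T = mat_coords (obs J Q X)" by (auto simp: S_def)
  moreover from this have "obs J Q X = T" by (metis coords_mat_inverse)
  ultimately show ?thesis using that by blast
qed

section \<open>Equations of Kalman cones\<close>

definition diag_on :: "'n set \<Rightarrow> 'a::zero_neq_one ^ 'n::finite ^ 'n" where
  "diag_on S = (\<chi> i j. if i = j \<and> i \<in> S then 1 else 0)"

lemma diag_on_vec: "(diag_on S *v x) $ i = (if i \<in> S then x $ i else 0)" for x :: "'a::comm_ring_1 ^ 'n::finite"
  by (simp add: diag_on_def matrix_vector_mult_def if_distrib[of "\<lambda>x. x * _"] cong: if_cong)

text \<open>The second summand factors through a space of dimension \<open>card S\<close>, hence
  annihilates a nonzero vector of \<open>maxinv L X\<close>; the first summand annihilates all of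
  that space.\<close>

lemma det_obs_eq_0:
  fixes G H X :: "'a::field ^ 'n::finite ^ 'n"
  assumes L: "vec.subspace L" and kills: "\<And>j. kills (Q j) L"
    and S: "card S < vec.dim (maxinv L X)"
  shows "det (obs J Q X + G ** diag_on S ** H) = 0"
proof -
  let ?U = "maxinv L X" and ?f = "\<lambda>v. (diag_on S ** H) *v v"
  have sub: "vec.subspace ?U" using invariant_maxinv[OF L] by (simp add: invariant_def)
  have "\<not> inj_on ?f ?U"
  proof
    assume "inj_on ?f ?U"
    then have "vec.dim (?f ` ?U) = vec.dim ?U"
      using sub by (intro vec.dim_image_eq) (auto simp: vec.span_eq_iff[THEN iffD2])
    moreover have "?f ` ?U \<subseteq> coord_subspace S"
      by (auto simp: coord_subspace_def diag_on_vec simp flip: matrix_vector_mul_assoc)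
    then have "vec.dim (?f ` ?U) \<le> card S" using vec.dim_subset dim_coord_subspace by metis
    ultimately show False using S by simp
  qed
  then obtain x y where xy: "x \<in> ?U" "y \<in> ?U" "x \<noteq> y" "?f x = ?f y" by (auto simp: inj_on_def)
  define u where "u = x - y"
  have u: "u \<in> ?U" "u \<noteq> 0" "?f u = 0"
    using xy sub by (auto simp: u_def vec.subspace_diff vec.diff)
  have "(obs J Q X + G ** diag_on S ** H) *v u = obs J Q X *v u + G *v ?f u"
    by (simp add: matrix_vector_mult_add_rdistrib matrix_vector_mul_assoc matrix_mul_assoc)
  also have "\<dots> = 0" using u obs_maxinv[OF kills u(1)] by simp
  finally have "(obs J Q X + G ** diag_on S ** H) *v u = 0" .
  then have "\<not> inj ((*v) (obs J Q X + G ** diag_on S ** H))"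
    using u(2) by (auto simp: vec.inj_iff_eq_0)
  then show ?thesis using det_nz_iff_inj_gen[of "(*v) (obs J Q X + G ** diag_on S ** H)"]
    by (simp add: matrix_vector_mul_linear_gen)
qed

lemma polyfun_mpow: "polyfun (\<lambda>v. mpow (coords_mat v) j $ a $ b)"
proof (induction j arbitrary: a b)
  case 0
  then show ?case by (simp add: polyfun_const)
next
  case (Suc j)
  show ?case
    unfolding mpow.simps matrix_matrix_mult_def
    by (simp, intro polyfun_sum polyfun_mult Suc polyfun_coord)
qed

lemma polyfun_det_obs: "polyfun (\<lambda>v. det (obs J Q (coords_mat v) + R))"
proof (rule polyfun_det)
  fix a b
  show "polyfun (\<lambda>v. (obs J Q (coords_mat v) + R) $ a $ b)"
    by (simp add: obs_def matrix_matrix_mult_def)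
       (intro polyfun_add polyfun_sum polyfun_mult polyfun_const polyfun_mpow)
qed

definition kalman_cone :: "nat \<Rightarrow> ('a::field ^ 'n::finite) set \<Rightarrow> ('a ^ ('n \<times> 'n)) set" where
  "kalman_cone s L = {v. s \<le> vec.dim (maxinv L (coords_mat v))}"

lemma kalman_eq_projectivization:
  assumes "vec.subspace L"
  shows "kalman s L = projectivization (kalman_cone s L)"
proof -
  have "kalman s L = {vec.span {mat_coords A} | A. A \<noteq> 0 \<and> s \<le> vec.dim (maxinv L A)}"
    unfolding kalman_def exists_invariant_iff_maxinv[OF assms] ..
  also have "\<dots> = projectivization (kalman_cone s L)"
    unfolding projectivization_def
  proof (intro Collect_cong iffI)
    fix p assume "\<exists>A. p = vec.span {mat_coords A} \<and> A \<noteq> 0 \<and> s \<le> vec.dim (maxinv L A)"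
    then obtain A where "p = vec.span {mat_coords A}" "A \<noteq> 0" "s \<le> vec.dim (maxinv L A)" by blast
    then show "\<exists>v. p = vec.span {v} \<and> v \<in> kalman_cone s L \<and> v \<noteq> 0"
      by (intro exI[of _ "mat_coords A"]) (simp add: kalman_cone_def)
  next
    fix p assume "\<exists>v. p = vec.span {v} \<and> v \<in> kalman_cone s L \<and> v \<noteq> 0"
    then obtain v where "p = vec.span {v}" "v \<in> kalman_cone s L" "v \<noteq> 0" by blast
    then show "\<exists>A. p = vec.span {mat_coords A} \<and> A \<noteq> 0 \<and> s \<le> vec.dim (maxinv L A)"
      by (intro exI[of _ "coords_mat v"]) (simp add: kalman_cone_def flip: mat_coords_eq_0_iff)
  qed
  finally show ?thesis .
qed

lemma coords_mat_scale: "coords_mat (c *s v) = mat c ** coords_mat v" for v :: "'a::comm_ring_1 ^ ('n::finite \<times> 'n)"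
  by (simp add: vec_eq_iff mat_scale_nth)

lemma invariant_scale: "invariant A U \<Longrightarrow> invariant (mat c ** A) U"
  by (simp add: invariant_def mat_scale_vec vec.subspace_scale)

lemma scale_closed_kalman_cone:
  fixes L :: "('a::field ^ 'n::finite) set"
  assumes "vec.subspace L"
  shows "scale_closed (kalman_cone s L)"
  unfolding scale_closed_def
proof safe
  fix v :: "'a ^ ('n \<times> 'n)" and c assume "v \<in> kalman_cone s L"
  moreover have "maxinv L (coords_mat v) \<subseteq> maxinv L (coords_mat (c *s v))"
    unfolding coords_mat_scale
    by (intro invariant_subset_maxinv invariant_scale invariant_maxinv assms maxinv_subset)
  ultimately show "c *s v \<in> kalman_cone s L"
    unfolding kalman_cone_def using vec.dim_subset le_trans by blast
qed

text \<open>Along the ray through \<open>w\<close> the function becomes a polynomial in the scalar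
  whose coefficients are the values of the homogeneous components. It vanishes identically, so each
  coefficient does.\<close>

lemma polyfun_vanishing_on_cone:
  fixes C :: "('a::alg_closed_field ^ 'i::finite) set"
  assumes "scale_closed C" "\<And>w. w \<in> C \<Longrightarrow> mpoly_eval f w = 0"
  obtains g K where "f = (\<Sum>k\<le>(K::nat). g k)" "\<And>k. homogeneous (g k)" "\<And>k. formfun k (mpoly_eval (g k))"
    "\<And>k w. k \<le> K \<Longrightarrow> w \<in> C \<Longrightarrow> mpoly_eval (g k) w = 0"
proof -
  obtain g K where g: "\<And>k. homogeneous (g k)" "\<And>k. formfun k (mpoly_eval (g k))" "f = (\<Sum>k\<le>(K::nat). g k)"
    using mpoly_homogeneous_components[of f] by metis
  have "mpoly_eval (g k) w = 0" if k: "k \<le> K" and w: "w \<in> C" for k w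
  proof -
    define p where "p = (\<Sum>k\<le>K. monom (mpoly_eval (g k) w) k)"
    have "poly p c = 0" for c
    proof -
      have "poly p c = (\<Sum>k\<le>K. mpoly_eval (g k) (c *s w))"
        by (simp add: p_def poly_sum poly_monom formfun_scale[OF g(2)] mult.commute)
      also have "\<dots> = mpoly_eval f (c *s w)" by (simp add: g(3) mpoly_eval_sum)
      also have "\<dots> = 0" using assms w by (simp add: scale_closed_def)
      finally show ?thesis .
    qed
    then have "p = 0" using poly_eq_0_if_cofinitely_zero[of "{}" p] by simp
    moreover have "coeff p k = mpoly_eval (g k) w"
      using k by (simp add: p_def coeff_sum)
    ultimately show ?thesis by simp
  qed
  then show ?thesis using that g by blast
qed

text \<open>The determinantal equations of Kalman cones mix degrees; passing to a homogeneous
  component that is nonzero at \<open>v\<close> makes them usable.\<close>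

lemma form_closed_by_polyfuns:
  fixes C :: "('a::alg_closed_field ^ 'i::finite) set"
  assumes "scale_closed C" and "\<And>v. v \<notin> C \<Longrightarrow> \<exists>F. polyfun F \<and> F v \<noteq> 0 \<and> (\<forall>w\<in>C. F w = 0)"
  shows "form_closed C"
  unfolding form_closed_def
proof (intro allI impI)
  fix v assume "v \<notin> C"
  then obtain f where f: "mpoly_eval f v \<noteq> 0" "\<forall>w\<in>C. mpoly_eval f w = 0"
    using assms(2) by (auto simp: polyfun_def)
  obtain g K where g: "f = (\<Sum>k\<le>(K::nat). g k)" "\<And>k. formfun k (mpoly_eval (g k))"
    "\<And>k w. k \<le> K \<Longrightarrow> w \<in> C \<Longrightarrow> mpoly_eval (g k) w = 0"
    using polyfun_vanishing_on_cone[OF assms(1), of f] f(2) by metis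
  have "(\<Sum>k\<le>K. mpoly_eval (g k) v) \<noteq> 0" using f(1) by (simp add: g(1) mpoly_eval_sum)
  then obtain k where "k \<le> K" "mpoly_eval (g k) v \<noteq> 0" by (meson atMost_iff sum.neutral)
  then show "\<exists>k F. formfun k F \<and> F v \<noteq> 0 \<and> (\<forall>w\<in>C. F w = 0)" using g by blast
qed

lemma diag_on_complement: "diag_on (- S) + diag_on S = (mat 1 :: 'a::comm_ring_1 ^ 'n::finite ^ 'n)"
  by (auto simp: vec_eq_iff diag_on_def mat_def)

text \<open>The right-hand matrix is a projection with kernel \<open>maxinv L X\<close>, so it is
  among the matrices produced by \<open>exists_obs_eq\<close>.\<close>

lemma exists_obs_projection:
  fixes X G H :: "'a::field ^ 'n::finite ^ 'n"
  assumes "vec.subspace L" "G ** H = mat 1" "H ** G = mat 1" "(*v) G ` coord_subspace S = maxinv L X"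
  obtains J Q where "\<And>j. kills (Q j) L" "obs J Q X = G ** diag_on (- S) ** H"
proof -
  have "kills (G ** diag_on (- S) ** H) (maxinv L X)"
    unfolding kills_def
  proof
    fix v assume "v \<in> maxinv L X"
    then have "\<forall>i. i \<notin> S \<longrightarrow> (H *v v) $ i = 0"
      using mem_image_coord_subspace[OF assms(2,3)] unfolding assms(4)[symmetric] by blast
    then have "diag_on (- S) *v (H *v v) = 0" by (simp add: vec_eq_iff diag_on_vec)
    then show "(G ** diag_on (- S) ** H) *v v = 0" by (simp flip: matrix_vector_mul_assoc)
  qed
  then show ?thesis using exists_obs_eq[OF assms(1)] that by metis
qed

lemma adapted_basis_maxinv:
  fixes L :: "('a::field ^ 'n::finite) set"
  assumes "vec.subspace L"
  obtains S' S and G H :: "'a ^ 'n ^ 'n" where "S' \<subseteq> S" "card S' = vec.dim (maxinv L A)" "card S = vec.dim L"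
    "G ** H = mat 1" "H ** G = mat 1" "(*v) G ` coord_subspace S' = maxinv L A" "(*v) G ` coord_subspace S = L"
proof -
  have U: "vec.subspace (maxinv L A)" using invariant_maxinv[OF assms] by (simp add: invariant_def)
  obtain S :: "'n set" where S: "card S = vec.dim L"
    using obtain_subset_with_card_n[of "vec.dim L" "UNIV :: 'n set"] dim_subset_UNIV_cart_gen[of L] by metis
  have "vec.dim (maxinv L A) \<le> card S" unfolding S using maxinv_subset by (rule vec.dim_subset)
  then obtain S' where S': "S' \<subseteq> S" "card S' = vec.dim (maxinv L A)" by (rule obtain_subset_with_card_n)
  show ?thesis using adapted_basis[OF U assms maxinv_subset S'(1) S'(2) S] that S S' by metis
qed

text \<open>At a matrix outside the cone, a suitable \<open>obs\<close> is the projection along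
  \<open>maxinv L X\<close>. The complementary projection has rank below \<open>s\<close> and
  completes it to the identity, of determinant 1, whereas on the cone the same determinant is
  0.\<close>

lemma form_closed_kalman_cone:
  fixes L :: "('a::alg_closed_field ^ 'n::finite) set"
  assumes L: "vec.subspace L"
  shows "form_closed (kalman_cone s L)"
proof (rule form_closed_by_polyfuns[OF scale_closed_kalman_cone[OF L]])
  fix v :: "'a ^ ('n \<times> 'n)" assume v: "v \<notin> kalman_cone s L"
  define X where "X = coords_mat v"
  obtain S' S and G H :: "'a ^ 'n ^ 'n" where G: "card S' = vec.dim (maxinv L X)"
    "G ** H = mat 1" "H ** G = mat 1" "(*v) G ` coord_subspace S' = maxinv L X"
    using adapted_basis_maxinv[OF L, of X] by metis
  obtain J Q where Q: "\<And>j. kills (Q j) L" "obs J Q X = G ** diag_on (- S') ** H"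
    using exists_obs_projection[OF L G(2-4)] by metis
  have "obs J Q X + G ** diag_on S' ** H = G ** (diag_on (- S') + diag_on S') ** H"
    by (simp add: Q(2) matrix_add_ldistrib matrix_add_rdistrib)
  then have "det (obs J Q X + G ** diag_on S' ** H) = 1"
    by (simp add: diag_on_complement G)
  moreover have "det (obs J Q (coords_mat w) + G ** diag_on S' ** H) = 0" if "w \<in> kalman_cone s L" for w
    using that v G(1) by (intro det_obs_eq_0[OF L Q(1)]) (auto simp: kalman_cone_def X_def)
  ultimately show "\<exists>F. polyfun F \<and> F v \<noteq> 0 \<and> (\<forall>w\<in>kalman_cone s L. F w = 0)"
    by (intro exI[of _ "\<lambda>v. det (obs J Q (coords_mat v) + G ** diag_on S' ** H)"])
       (auto simp: polyfun_det_obs X_def)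
qed

section \<open>Matrices of polynomials\<close>

definition eval_matrix :: "'a::comm_ring_1 \<Rightarrow> 'a poly ^ 'n::finite ^ 'n \<Rightarrow> 'a ^ 'n ^ 'n" where
  "eval_matrix t M = (\<chi> i j. poly (M $ i $ j) t)"

definition pencil :: "'a::comm_ring_1 ^ 'n::finite ^ 'n \<Rightarrow> 'a ^ 'n ^ 'n \<Rightarrow> 'a poly ^ 'n ^ 'n" where
  "pencil A B = (\<chi> i j. [:A $ i $ j, B $ i $ j:])"

text \<open>Defined by the determinants of Cramer's rule, hence polynomial in the entries; it stands
  in for the inverse along a polynomial curve.\<close>

definition adjugate :: "'a::comm_ring_1 ^ 'n::finite ^ 'n \<Rightarrow> 'a ^ 'n ^ 'n" where
  "adjugate M = (\<chi> k i. det (\<chi> a b. if b = k then (if a = i then 1 else 0) else M $ a $ b))"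

lemma eval_matrix_add: "eval_matrix t (M + N) = eval_matrix t M + eval_matrix t N"
  by (simp add: eval_matrix_def vec_eq_iff)

lemma eval_matrix_mult: "eval_matrix t (M ** N) = eval_matrix t M ** eval_matrix t N"
  by (simp add: eval_matrix_def vec_eq_iff matrix_matrix_mult_def poly_sum)

lemma poly_det: "poly (det M) t = det (eval_matrix t M)"
  by (simp add: det_def eval_matrix_def poly_sum poly_prod)

lemma eval_matrix_pencil: "eval_matrix t (pencil A B) = A + mat t ** B"
  by (simp add: eval_matrix_def pencil_def vec_eq_iff mat_scale_nth)

lemma eval_matrix_adjugate: "eval_matrix t (adjugate M) = adjugate (eval_matrix t M)"
proof -
  have "poly (det (\<chi> a b. if b = k then (if a = i then 1 else 0) else M $ a $ b)) t =
      det (\<chi> a b. if b = k then (if a = i then 1 else 0) else eval_matrix t M $ a $ b)" for k i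
    unfolding poly_det by (rule arg_cong[where f = det]) (auto simp: eval_matrix_def vec_eq_iff)
  then show ?thesis by (simp add: adjugate_def) (simp add: eval_matrix_def)
qed

lemma mult_adjugate:
  fixes M :: "'a::field ^ 'n::finite ^ 'n"
  assumes "det M \<noteq> 0"
  shows "M ** adjugate M = mat (det M)"
proof -
  have "(M ** adjugate M) $ a $ i = mat (det M) $ a $ i" for a i
  proof -
    define x where "x = (\<chi> k. det (\<chi> a b. if b = k then (axis i 1 :: 'a ^ 'n) $ a else M $ a $ b) / det M)"
    have "M *v x = axis i 1" using cramer[OF assms, of x "axis i 1"] by (simp add: x_def)
    then have "(M *v x) $ a = (if a = i then 1 else 0)" by (simp add: axis_def)
    then have "det M * (M *v x) $ a = mat (det M) $ a $ i" by (simp add: mat_def)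
    moreover have "adjugate M $ k $ i = det M * x $ k" for k
      using assms by (auto simp: adjugate_def x_def axis_def vec_eq_iff intro!: arg_cong[where f = det])
    then have "(M ** adjugate M) $ a $ i = det M * (M *v x) $ a"
      by (simp add: matrix_matrix_mult_def matrix_vector_mult_def sum_distrib_left mult.left_commute)
    ultimately show ?thesis by simp
  qed
  then show ?thesis by (simp add: vec_eq_iff)
qed

lemma det_nonzero_of_inverse:
  fixes G H :: "'a::field ^ 'n::finite ^ 'n"
  assumes "G ** H = mat 1"
  shows "det G \<noteq> 0"
proof
  assume "det G = 0"
  then have "det (G ** H) = 0" by (simp add: det_mul)
  then show False using assms by simp
qed

lemma mat_mult_mat: "mat a ** mat b = (mat (a * b) :: 'a::comm_ring_1 ^ 'n::finite ^ 'n)"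
  by (simp add: vec_eq_iff mat_scale_nth) (simp add: mat_def)

lemma inverse_adjugate:
  fixes G :: "'a::field ^ 'n::finite ^ 'n"
  assumes "det G \<noteq> 0"
  defines "H \<equiv> mat (1 / det G) ** adjugate G"
  shows "G ** H = mat 1" "H ** G = mat 1" "adjugate G = mat (det G) ** H"
proof -
  have "G ** H = (G ** mat (1 / det G)) ** adjugate G" by (simp add: H_def matrix_mul_assoc)
  also have "\<dots> = mat (1 / det G) ** (G ** adjugate G)"
    by (simp add: matrix_mul_assoc flip: mat_commute)
  also have "\<dots> = mat 1" using assms(1) by (simp add: mult_adjugate mat_mult_mat)
  finally show GH: "G ** H = mat 1" .
  then show "H ** G = mat 1" by (simp add: matrix_left_right_inverse)
  have "mat (det G) ** H = (mat (det G) ** mat (1 / det G)) ** adjugate G"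
    by (simp add: H_def matrix_mul_assoc)
  then show "adjugate G = mat (det G) ** H" using assms(1) by (simp add: mat_mult_mat)
qed

section \<open>Irreducibility\<close>

definition preserves :: "'n set \<Rightarrow> 'a::zero ^ 'n::finite ^ 'n \<Rightarrow> bool" where
  "preserves S B \<longleftrightarrow> (\<forall>i k. i \<notin> S \<longrightarrow> k \<in> S \<longrightarrow> B $ i $ k = 0)"

lemma preserves_iff: "preserves S B \<longleftrightarrow> (\<forall>x\<in>coord_subspace S. B *v x \<in> coord_subspace S)"
  for B :: "'a::field ^ 'n::finite ^ 'n"
proof
  assume B: "preserves S B"
  show "\<forall>x\<in>coord_subspace S. B *v x \<in> coord_subspace S"
  proof
    fix x :: "'a ^ 'n" assume x: "x \<in> coord_subspace S"
    have "B $ i $ k * x $ k = 0" if "i \<notin> S" for i k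
      using B x that by (cases "k \<in> S") (auto simp: preserves_def coord_subspace_def)
    then show "B *v x \<in> coord_subspace S"
      by (auto simp: coord_subspace_def matrix_vector_mult_def intro!: sum.neutral)
  qed
next
  assume B: "\<forall>x\<in>coord_subspace S. B *v x \<in> coord_subspace S"
  have "B $ i $ k = 0" if "i \<notin> S" "k \<in> S" for i k
  proof -
    have "B *v axis k 1 \<in> coord_subspace S" using B that by (simp add: axis_mem_coord_subspace)
    then have "(B *v axis k 1) $ i = 0" using that by (simp add: coord_subspace_def)
    then show ?thesis by (simp add: matrix_vector_mult_def axis_def if_distrib cong: if_cong)
  qed
  then show "preserves S B" by (simp add: preserves_def)
qed

lemma invariant_conj:
  fixes G H :: "'a::field ^ 'n::finite ^ 'n"
  assumes "G ** H = mat 1" "H ** G = mat 1"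
  shows "invariant A ((*v) G ` coord_subspace S) \<longleftrightarrow> preserves S (H ** A ** G)"
proof -
  have sub: "vec.subspace ((*v) G ` coord_subspace S)"
    by (intro vec.subspace_image subspace_coord_subspace)
  have "A *v (G *v x) \<in> (*v) G ` coord_subspace S \<longleftrightarrow> (H ** A ** G) *v x \<in> coord_subspace S" for x
    unfolding mem_image_coord_subspace[OF assms]
    by (simp add: coord_subspace_def matrix_vector_mul_assoc matrix_mul_assoc)
  then show ?thesis using sub by (simp add: invariant_def preserves_iff)
qed

lemma dim_image_invertible:
  fixes G H :: "'a::field ^ 'n::finite ^ 'n"
  assumes "H ** G = mat 1"
  shows "vec.dim ((*v) G ` coord_subspace S) = card S"
proof -
  have "inj ((*v) G)"
    using assms by (intro inj_on_inverseI[of _ "(*v) H"]) (simp add: matrix_vector_mul_assoc)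
  then have "vec.dim ((*v) G ` coord_subspace S) = vec.dim (coord_subspace S :: ('a ^ 'n) set)"
    by (intro vec.dim_image_eq) (auto intro: inj_on_subset)
  then show ?thesis by (simp add: dim_coord_subspace)
qed

lemma conj_inverse:
  fixes G H :: "'a::comm_ring_1 ^ 'n::finite ^ 'n"
  assumes "G ** H = mat 1"
  shows "G ** (H ** A ** G) ** H = A"
proof -
  have "G ** (H ** A ** G) ** H = (G ** H) ** A ** (G ** H)" by (simp only: matrix_mul_assoc)
  then show ?thesis by (simp add: assms)
qed

text \<open>Conjugating a pair of standard coordinate subspaces onto a given pair of invariant subspaces
  turns the cone into the image of a linear space of pairs \<open>(G, B)\<close> under \<open>G ** B ** adjugate G\<close>.\<close>

lemma mem_kalman_cone_flag_iff:
  fixes L L' :: "('a::alg_closed_field ^ 'n::finite) set" and S S' :: "'n set"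
  assumes L: "vec.subspace L" "vec.subspace L'" "L' \<subseteq> L" and S: "S' \<subseteq> S" "card S' = j" "card S = s"
  shows "v \<in> kalman_cone s L \<inter> kalman_cone j L' \<longleftrightarrow>
    (\<exists>G H B. G ** H = mat 1 \<and> H ** G = mat 1 \<and> preserves S B \<and> preserves S' B \<and>
      (*v) G ` coord_subspace S \<subseteq> L \<and> (*v) G ` coord_subspace S' \<subseteq> L' \<and>
      coords_mat v = G ** B ** H)" (is "?l \<longleftrightarrow> ?r")
proof
  let ?A = "coords_mat v"
  assume ?l
  then have dims: "s \<le> vec.dim (maxinv L ?A)" "j \<le> vec.dim (maxinv L' ?A)"
    by (auto simp: kalman_cone_def)
  have js: "j \<le> s" using S by (metis card_mono finite)
  have inv: "invariant ?A (maxinv L ?A)" "invariant ?A (maxinv L' ?A)" "invariant ?A {0}"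
    using invariant_maxinv L by (auto simp: invariant_def)
  have "{0} \<subseteq> maxinv L' ?A" using inv(2) by (auto simp: invariant_def dest: vec.subspace_0)
  then obtain U' where U': "invariant ?A U'" "U' \<subseteq> maxinv L' ?A" "vec.dim U' = j"
    using exists_invariant_between[OF inv(3,2), of j] dims by auto
  have "U' \<subseteq> maxinv L ?A" using U'(2) maxinv_mono[OF L(3)] by blast
  then obtain U where U: "invariant ?A U" "U' \<subseteq> U" "U \<subseteq> maxinv L ?A" "vec.dim U = s"
    using exists_invariant_between[OF U'(1) inv(1), of s] dims js U'(3) by auto
  obtain G H :: "'a ^ 'n ^ 'n" where G: "G ** H = mat 1" "H ** G = mat 1"
    "(*v) G ` coord_subspace S' = U'" "(*v) G ` coord_subspace S = U"
    using adapted_basis[of U' U S' S] U' U S by (auto simp: invariant_def)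
  have "preserves S (H ** ?A ** G)" "preserves S' (H ** ?A ** G)"
    using invariant_conj[OF G(1,2), of ?A] G(3,4) U(1) U'(1) by auto
  moreover have "U \<subseteq> L" "U' \<subseteq> L'" using U U' maxinv_subset by blast+
  ultimately show ?r using G conj_inverse[OF G(1), of ?A] by metis
next
  assume ?r
  then obtain G H B where G: "G ** H = mat 1" "H ** G = mat 1" and B: "preserves S B" "preserves S' B"
    and sub: "(*v) G ` coord_subspace S \<subseteq> L" "(*v) G ` coord_subspace S' \<subseteq> L'"
    and v: "coords_mat v = G ** B ** H" by blast
  have "H ** coords_mat v ** G = B" unfolding v by (rule conj_inverse[OF G(2)])
  then have "invariant (coords_mat v) ((*v) G ` coord_subspace S)"
    "invariant (coords_mat v) ((*v) G ` coord_subspace S')"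
    using invariant_conj[OF G, of "coords_mat v"] B by auto
  then have "(*v) G ` coord_subspace S \<subseteq> maxinv L (coords_mat v)"
    "(*v) G ` coord_subspace S' \<subseteq> maxinv L' (coords_mat v)"
    using sub invariant_subset_maxinv by blast+
  then have "card S \<le> vec.dim (maxinv L (coords_mat v))" "card S' \<le> vec.dim (maxinv L' (coords_mat v))"
    unfolding dim_image_invertible[OF G(2), symmetric] by (auto intro: vec.dim_subset)
  then show ?l using S by (simp add: kalman_cone_def)
qed

text \<open>For fixed \<open>S\<close> and \<open>S'\<close> the conditions on the base change and
  on the conjugated matrix are linear, so both can be interpolated linearly between two points of
  the cone. Using \<open>adjugate\<close> in place of the inverse makes the resulting curve
  polynomial; it stays in the cone wherever the base change is invertible.\<close>

lemma form_irreducible_kalman_cone_flag: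
  fixes L L' :: "('a::alg_closed_field ^ 'n::finite) set"
  assumes L: "vec.subspace L" "vec.subspace L'" "L' \<subseteq> L"
    and j: "j \<le> s" "j \<le> vec.dim L'" "s \<le> vec.dim L"
  shows "form_irreducible (kalman_cone s L \<inter> kalman_cone j L' - {0})"
proof (rule form_irreducible_by_curves)
  let ?C = "kalman_cone s L \<inter> kalman_cone j L'"
  have scale: "scale_closed ?C"
    using scale_closed_kalman_cone[OF L(1)] scale_closed_kalman_cone[OF L(2)]
    unfolding scale_closed_def by blast
  \<comment> \<open>Every subspace is invariant under the identity, which therefore serves as a
    nonzero member of the cone.\<close>
  have "maxinv K (mat 1) = K" for K :: "('a ^ 'n) set"
  proof -
    have "mpow (mat 1) j = (mat 1 :: 'a ^ 'n ^ 'n)" for j by (induction j) auto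
    then show ?thesis by (simp add: maxinv_def)
  qed
  then have "mat_coords (mat 1) \<in> ?C" using j by (simp add: kalman_cone_def)
  moreover have "mat 1 \<noteq> (0 :: 'a ^ 'n ^ 'n)" by (simp add: vec_eq_iff mat_def)
  ultimately show "\<exists>v\<in>?C. v \<noteq> 0" by (intro bexI[of _ "mat_coords (mat 1)"]) auto
  have "s \<le> CARD('n)" using j(3) dim_subset_UNIV_cart_gen[of L] by linarith
  then obtain S :: "'n set" where S: "card S = s"
    using obtain_subset_with_card_n[of s "UNIV :: 'n set"] by metis
  obtain S' where S': "S' \<subseteq> S" "card S' = j" using obtain_subset_with_card_n[of j S] j(1) S by metis
  note mem_iff = mem_kalman_cone_flag_iff[OF L S' S]
  fix x y assume "x \<in> ?C" "y \<in> ?C"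
  then obtain G0 H0 B0 G1 H1 B1 where
    0: "G0 ** H0 = mat 1" "H0 ** G0 = mat 1" "preserves S B0" "preserves S' B0"
      "(*v) G0 ` coord_subspace S \<subseteq> L" "(*v) G0 ` coord_subspace S' \<subseteq> L'" "coords_mat x = G0 ** B0 ** H0" and
    1: "G1 ** H1 = mat 1" "H1 ** G1 = mat 1" "preserves S B1" "preserves S' B1"
      "(*v) G1 ` coord_subspace S \<subseteq> L" "(*v) G1 ` coord_subspace S' \<subseteq> L'" "coords_mat y = G1 ** B1 ** H1"
    unfolding mem_iff by metis
  define g where "g = pencil G0 (G1 - G0)"
  define b where "b = pencil B0 (B1 - B0)"
  define p where "p i = (g ** b ** adjugate g) $ fst i $ snd i" for i
  define E where "E = {t. poly (det g) t = 0}"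
  have p_at: "(\<chi> i. poly (p i) t) = mat_coords (eval_matrix t g ** eval_matrix t b ** adjugate (eval_matrix t g))" for t
    unfolding eval_matrix_adjugate[symmetric] eval_matrix_mult[symmetric]
    by (simp add: vec_eq_iff mat_coords_def p_def eval_matrix_def)
  \<comment> \<open>The adjugate is \<open>det G\<close> times the inverse, so the curve meets its
    end points only up to these determinants.\<close>
  have p_scaled: "mat_coords (G ** B ** adjugate G) = det G *s mat_coords (G ** B ** H)"
    if GH: "G ** H = mat 1" "H ** G = mat 1" for G H B :: "'a ^ 'n ^ 'n"
  proof -
    have d: "det G \<noteq> 0" using det_nonzero_of_inverse[OF GH(1)] .
    have "H = H ** (G ** (mat (1 / det G) ** adjugate G))" by (simp add: inverse_adjugate(1)[OF d])
    also have "\<dots> = mat (1 / det G) ** adjugate G" by (simp add: matrix_mul_assoc GH(2))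
    finally have "adjugate G = mat (det G) ** H" using inverse_adjugate(3)[OF d] by simp
    then have "G ** B ** adjugate G = mat (det G) ** (G ** B ** H)"
      by (simp add: matrix_mul_assoc mat_commute[of "det G"])
         (simp add: mat_commute[of "det G"] flip: matrix_mul_assoc)
    then show ?thesis by (simp add: mat_coords_scale)
  qed
  have g0: "eval_matrix 0 g = G0" "eval_matrix 0 b = B0" "eval_matrix 1 g = G1" "eval_matrix 1 b = B1"
    by (simp_all add: g_def b_def eval_matrix_pencil vec_eq_iff mat_scale_nth)
  have det0: "det G0 \<noteq> 0" "det G1 \<noteq> 0" using det_nonzero_of_inverse 0(1) 1(1) by blast+
  then have "poly (det g) 0 \<noteq> 0" by (simp add: poly_det g0)
  then have "det g \<noteq> 0" by auto
  then have "finite E" unfolding E_def by (rule poly_roots_finite)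
  moreover have "(\<chi> i. poly (p i) t) \<in> ?C" if "t \<notin> E" for t
  proof -
    let ?G = "eval_matrix t g" and ?B = "eval_matrix t b"
    have d: "det ?G \<noteq> 0" using that by (simp add: E_def poly_det)
    obtain H where H: "?G ** H = mat 1" "H ** ?G = mat 1" using inverse_adjugate(1,2)[OF d] by blast
    have Gx: "?G *v x = G0 *v x + t *s (G1 *v x - G0 *v x)" for x
      by (simp add: g_def eval_matrix_pencil matrix_vector_mult_add_rdistrib mat_scale_vec matrix_vector_mult_diff_rdistrib)
    have "preserves S ?B" "preserves S' ?B"
      using 0(3,4) 1(3,4) by (auto simp: preserves_def b_def eval_matrix_pencil mat_scale_nth)
    moreover have "(*v) ?G ` coord_subspace S \<subseteq> L" "(*v) ?G ` coord_subspace S' \<subseteq> L'"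
      using 0(5,6) 1(5,6) L unfolding Gx image_subset_iff
      by (auto intro!: vec.subspace_add vec.subspace_scale vec.subspace_diff)
    ultimately have "mat_coords (?G ** ?B ** H) \<in> ?C"
      unfolding mem_iff using H by (intro exI[of _ ?G] exI[of _ H] exI[of _ ?B]) simp
    then show ?thesis unfolding p_at p_scaled[OF H] using scale by (simp add: scale_closed_def)
  qed
  moreover have "(\<chi> i. poly (p i) 0) = det G0 *s x"
    unfolding p_at g0 p_scaled[OF 0(1,2)] 0(7)[symmetric] by simp
  moreover have "(\<chi> i. poly (p i) 1) = det G1 *s y"
    unfolding p_at g0 p_scaled[OF 1(1,2)] 1(7)[symmetric] by simp
  ultimately show "\<exists>p E a b. finite E \<and> a \<noteq> 0 \<and> b \<noteq> 0 \<and>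
      (\<forall>t. t \<notin> E \<longrightarrow> (\<chi> i. poly (p i) t) \<in> ?C) \<and>
      (\<chi> i. poly (p i) 0) = a *s x \<and> (\<chi> i. poly (p i) 1) = b *s y"
    using det0 by blast
qed

section \<open>Forms vanishing on a Kalman cone are singular along the next one\<close>

definition dirderiv :: "('i::finite, 'a::comm_ring_1) mpoly \<Rightarrow> 'a ^ 'i \<Rightarrow> 'a ^ 'i \<Rightarrow> 'a" where
  "dirderiv f v w = (\<Sum>i\<in>UNIV. mpoly_eval (mpoly_deriv i f) v * w $ i)"

lemma dirderiv_eq_coeff:
  fixes f :: "('i::finite, 'a::alg_closed_field) mpoly"
  assumes "\<And>t. poly q t = mpoly_eval f (v + t *s w)"
  shows "dirderiv f v w = coeff q 1"
proof -
  obtain q' where q': "\<And>t. poly q' t = mpoly_eval f (v + t *s w)" "coeff q' 1 = dirderiv f v w"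
    using directional_derivative[of f v w] by (auto simp: dirderiv_def)
  have "q' = q" by (rule poly_eqI_cofinite[of "{}"]) (simp_all add: assms q'(1))
  then show ?thesis using q'(2) by simp
qed

lemma dirderiv_eq_0:
  fixes f :: "('i::finite, 'a::alg_closed_field) mpoly"
  assumes "\<And>t. mpoly_eval f (v + t *s w) = 0"
  shows "dirderiv f v w = 0"
  using dirderiv_eq_coeff[of 0 f v w] assms by simp

lemma dirderiv_add: "dirderiv f v (w + w') = dirderiv f v w + dirderiv f v w'"
  by (simp add: dirderiv_def distrib_left sum.distrib)

lemma dirderiv_zero: "dirderiv f v 0 = 0"
  by (simp add: dirderiv_def)

lemma dirderiv_sum: "dirderiv f v (\<Sum>i\<in>I. w i) = (\<Sum>i\<in>I. dirderiv f v (w i))"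
  by (induction I rule: infinite_finite_induct) (auto simp: dirderiv_add dirderiv_zero)

text \<open>The matrix \<open>X + t M\<close> agrees with \<open>X\<close> on \<open>U\<close>,
  which stays invariant; so the whole line lies in the cone and \<open>f\<close> vanishes along
  it.\<close>

lemma dirderiv_kills_invariant:
  fixes f :: "('n::finite \<times> 'n, 'a::alg_closed_field) mpoly"
  assumes f: "\<And>v. v \<in> kalman_cone s L \<Longrightarrow> mpoly_eval f v = 0"
    and U: "invariant X U" "U \<subseteq> L" "s \<le> vec.dim U" and M: "kills M U"
  shows "dirderiv f (mat_coords X) (mat_coords M) = 0"
proof (rule dirderiv_eq_0, rule f)
  fix t
  have X': "coords_mat (mat_coords X + t *s mat_coords M) = X + mat t ** M"
    by (simp add: vec_eq_iff mat_scale_nth)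
  have "(X + mat t ** M) *v u = X *v u" if "u \<in> U" for u
    using M that by (simp add: kills_def matrix_vector_mult_add_rdistrib mat_scale_vec)
  then have "invariant (X + mat t ** M) U" using U(1) by (simp add: invariant_def)
  then have "U \<subseteq> maxinv L (X + mat t ** M)" using U(2) by (rule invariant_subset_maxinv)
  then show "mat_coords X + t *s mat_coords M \<in> kalman_cone s L"
    using U(3) vec.dim_subset unfolding kalman_cone_def mem_Collect_eq X' by (meson le_trans)
qed

lemma exists_matrix_on_independent:
  fixes u :: "nat \<Rightarrow> 'a::field ^ 'n::finite"
  assumes "vec.independent (u ` I)" "inj_on u I"
  obtains M :: "'a ^ 'n ^ 'n" where "\<And>i. i \<in> I \<Longrightarrow> M *v u i = g i"
proof -
  obtain h where h: "Vector_Spaces.linear (*s) (*s) h" "\<And>x. x \<in> u ` I \<Longrightarrow> h x = g (the_inv_into I u x)"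
    using vec.linear_independent_extend[OF assms(1), of "\<lambda>x. g (the_inv_into I u x)"] by blast
  have "matrix h *v u i = g i" if "i \<in> I" for i
    using h that assms(2) by (simp add: matrix_works the_inv_into_f_f)
  then show ?thesis using that by blast
qed

text \<open>If \<open>P i\<close> is the projection to the line of \<open>u i\<close>, then \<open>B ** P i\<close> kills the invariant hyperplane
  spanned by the other eigenvectors.\<close>

lemma dirderiv_eigenbasis:
  fixes f :: "('n::finite \<times> 'n, 'a::alg_closed_field) mpoly" and u :: "nat \<Rightarrow> 'a ^ 'n"
  assumes f: "\<And>v. v \<in> kalman_cone s L \<Longrightarrow> mpoly_eval f v = 0"
    and u: "\<And>i. i < Suc s \<Longrightarrow> X *v u i = l i *s u i"
    and U: "vec.span (u ` {..<Suc s}) \<subseteq> L" "vec.dim (vec.span (u ` {..<Suc s})) = Suc s"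
  shows "dirderiv f (mat_coords X) w = 0"
proof -
  let ?I = "{..<Suc s}"
  have "card (u ` ?I) \<ge> Suc s" using vec.dim_le_card[of "u ` ?I" "u ` ?I"] U(2) by (simp add: vec.span_superset)
  then have card: "card (u ` ?I) = Suc s" using card_image_le[of ?I u] by simp
  then have inj: "inj_on u ?I" by (intro eq_card_imp_inj_on) auto
  have ind: "vec.independent (u ` ?I)"
    by (rule vec.card_le_dim_spanning[of _ "vec.span (u ` ?I)"]) (use card U(2) in \<open>auto simp: vec.span_superset\<close>)
  have inv: "invariant X (vec.span (u ` J))" if "J \<subseteq> ?I" for J
    unfolding invariant_def
  proof (intro conjI ballI vec.subspace_span)
    fix x assume "x \<in> vec.span (u ` J)"
    then have "X *v x \<in> vec.span ((*v) X ` u ` J)" unfolding vec.span_image by blast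
    also have "\<dots> \<subseteq> vec.span (u ` J)"
    proof (intro vec.span_minimal vec.subspace_span image_subsetI, elim imageE, clarify)
      fix j assume "j \<in> J"
      then have "X *v u j = l j *s u j" using u that by auto
      then show "X *v u j \<in> vec.span (u ` J)" using \<open>j \<in> J\<close> by (simp add: vec.span_scale vec.span_base)
    qed
    finally show "X *v x \<in> vec.span (u ` J)" .
  qed
  have dimJ: "vec.dim (vec.span (u ` J)) = card J" if "J \<subseteq> ?I" for J
    using vec.dim_span_eq_card_independent[OF vec.independent_mono[OF ind image_mono[OF that]]]
      card_image[OF inj_on_subset[OF inj that]] by simp
  have kills_span: "kills M (vec.span (u ` J))" if "\<And>i. i \<in> J \<Longrightarrow> M *v u i = 0" for M and J
  proof -
    have "vec.span (u ` J) \<subseteq> {x. M *v x = 0}"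
      using that by (intro vec.span_minimal vec.subspace_kernel) auto
    then show ?thesis by (auto simp: kills_def)
  qed
  have key: "dirderiv f (mat_coords X) (mat_coords M) = 0"
    if "i < Suc s" "\<And>j. j < Suc s \<Longrightarrow> j \<noteq> i \<Longrightarrow> M *v u j = 0" for M i
  proof (rule dirderiv_kills_invariant[OF f])
    let ?J = "?I - {i}"
    show "invariant X (vec.span (u ` ?J))" by (rule inv) auto
    show "vec.span (u ` ?J) \<subseteq> L" using U(1) vec.span_mono[of "u ` ?J" "u ` ?I"] by blast
    show "s \<le> vec.dim (vec.span (u ` ?J))" using that(1) by (subst dimJ) auto
    show "kills M (vec.span (u ` ?J))" using that(2) by (intro kills_span) auto
  qed
  have "\<exists>P :: 'a ^ 'n ^ 'n. \<forall>j\<in>?I. P *v u j = (if i = j then u j else 0)" for i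
    using exists_matrix_on_independent[OF ind inj, of "\<lambda>j. if i = j then u j else 0"] by metis
  then obtain P :: "nat \<Rightarrow> 'a ^ 'n ^ 'n" where P: "\<And>i j. j \<in> ?I \<Longrightarrow> P i *v u j = (if i = j then u j else 0)"
    by metis
  define B where "B = coords_mat w"
  \<comment> \<open>What is left of \<open>B\<close> after removing its part along each eigenline
    kills all eigenvectors, so it too is covered by \<open>key\<close>.\<close>
  define R where "R = B - (\<Sum>i<Suc s. B ** P i)"
  have R: "R *v u j = 0" if "j < Suc s" for j
  proof -
    have "(\<Sum>i<Suc s. B ** P i) *v u j = (\<Sum>i<Suc s. if i = j then B *v u j else 0)"
      unfolding sum_matrix_vec using that
      by (intro sum.cong) (auto simp: P simp flip: matrix_vector_mul_assoc)
    also have "\<dots> = B *v u j" using that by simp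
    finally show ?thesis by (simp add: R_def matrix_vector_mult_diff_rdistrib)
  qed
  have "dirderiv f (mat_coords X) (mat_coords (B ** P i)) = 0" if "i < Suc s" for i
    by (rule key[OF that]) (auto simp: P simp flip: matrix_vector_mul_assoc)
  moreover have "dirderiv f (mat_coords X) (mat_coords R) = 0"
    by (rule key[of 0]) (use R in auto)
  moreover have "w = mat_coords R + (\<Sum>i<Suc s. mat_coords (B ** P i))"
  proof -
    have "mat_coords (sum g I) = (\<Sum>i\<in>I. mat_coords (g i))" for g :: "nat \<Rightarrow> 'a ^ 'n ^ 'n" and I
      by (induction I rule: infinite_finite_induct) (simp_all add: mat_coords_add)
    then have "mat_coords R + (\<Sum>i<Suc s. mat_coords (B ** P i)) = mat_coords (R + (\<Sum>i<Suc s. B ** P i))"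
      by (simp only: mat_coords_add)
    also have "R + (\<Sum>i<Suc s. B ** P i) = B" unfolding R_def by (rule diff_add_cancel)
    finally show ?thesis by (simp only: B_def mat_coords_inverse)
  qed
  ultimately show ?thesis by (simp only: dirderiv_add dirderiv_sum) simp
qed

lemma triangular_independent:
  fixes v :: "nat \<Rightarrow> 'a::field ^ 'n::finite"
  assumes "\<forall>i<k. v i \<notin> vec.span (v ` {..<i})"
  shows "vec.independent (v ` {..<k}) \<and> inj_on v {..<k}"
  using assms
proof (induction k)
  case 0
  then show ?case by (simp add: vec.independent_empty)
next
  case (Suc k)
  then have "vec.independent (insert (v k) (v ` {..<k}))" by (intro vec.independent_insertI) auto
  moreover have "v k \<notin> v ` {..<k}"
    using Suc.prems vec.span_superset[of "v ` {..<k}"] by auto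
  ultimately show ?case using Suc by (auto simp: lessThan_Suc)
qed

lemma polyfun_dirderiv: "polyfun (\<lambda>v. dirderiv f v w)"
proof -
  have "polyfun (mpoly_eval g)" for g by (auto simp: polyfun_def)
  then show ?thesis unfolding dirderiv_def by (intro polyfun_sum polyfun_mult polyfun_const)
qed

text \<open>Perturbing along a flag makes the eigenvalues on the invariant subspace distinct, so that it
  becomes the sum of eigenlines.\<close>

lemma dirderiv_kalman_Suc:
  fixes f :: "('n::finite \<times> 'n, 'a::alg_closed_field) mpoly"
  assumes L: "vec.subspace L" and f: "\<And>v. v \<in> kalman_cone s L \<Longrightarrow> mpoly_eval f v = 0"
    and v: "v \<in> kalman_cone (Suc s) L"
  shows "dirderiv f v w = 0"
proof -
  define A where "A = coords_mat v"
  have "invariant A (maxinv L A)" "invariant A {0}" using invariant_maxinv[OF L] by (auto simp: invariant_def)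
  moreover have "{0} \<subseteq> maxinv L A" using calculation(1) by (auto simp: invariant_def dest: vec.subspace_0)
  ultimately obtain U where U: "invariant A U" "U \<subseteq> maxinv L A" "vec.dim U = Suc s"
    using exists_invariant_between[of A "{0}" "maxinv L A" "Suc s"] v by (auto simp: kalman_cone_def A_def)
  have UL: "U \<subseteq> L" using U(2) maxinv_subset by blast
  obtain b a where b: "U = vec.span (b ` {..<Suc s})"
    and ba: "\<forall>i<Suc s. b i \<notin> vec.span (b ` {..<i}) \<and> A *v b i - a i *s b i \<in> vec.span (b ` {..<i})"
    using exists_triangular_basis[OF U(1,3)] by auto
  have ind: "vec.independent (b ` {..<Suc s})" "inj_on b {..<Suc s}"
    using triangular_independent[of "Suc s" b] ba by auto
  obtain d :: "nat \<Rightarrow> 'a" where d: "inj d"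
    using infinite_countable_subset[OF infinite_UNIV_alg_closed[where 'a='a]] by blast
  obtain D :: "'a ^ 'n ^ 'n" where D: "\<And>i. i \<in> {..<Suc s} \<Longrightarrow> D *v b i = d i *s b i"
    using exists_matrix_on_independent[OF ind, of "\<lambda>i. d i *s b i"] by metis
  \<comment> \<open>These are the parameters at which two perturbed eigenvalues can collide. The
    diagonal pairs contribute 0 through division by zero, so the value \<open>t = 0\<close> of
    interest is itself excluded and is recovered from \<open>q = 0\<close>.\<close>
  define E where "E = (\<lambda>(i, j). (a j - a i) / (d i - d j)) ` ({..<Suc s} \<times> {..<Suc s})"
  have zero: "dirderiv f (mat_coords (A + mat t ** D)) w = 0" if t: "t \<notin> E" for t
  proof -
    define X where "X = A + mat t ** D"
    have "inj_on (\<lambda>i. a i + t * d i) {..<Suc s}"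
    proof (rule inj_onI, rule ccontr)
      fix i j assume ij: "i \<in> {..<Suc s}" "j \<in> {..<Suc s}" "a i + t * d i = a j + t * d j" "i \<noteq> j"
      then have "d i - d j \<noteq> 0" using d by (auto simp: inj_def)
      moreover have "t * (d i - d j) = a j - a i" using ij(3) by (simp add: algebra_simps)
      ultimately have "t = (a j - a i) / (d i - d j)" by (simp add: nonzero_eq_divide_eq)
      then have "t \<in> E" using ij(1,2) by (auto simp: E_def)
      with t show False by simp
    qed
    moreover have "\<forall>i<Suc s. X *v b i - (a i + t * d i) *s b i \<in> vec.span (b ` {..<i})"
      using ba D by (simp add: X_def matrix_vector_mult_add_rdistrib mat_scale_vec vec.scale_left_distrib)
    ultimately obtain u where u: "vec.span (u ` {..<Suc s}) = U" "\<forall>i<Suc s. X *v u i = (a i + t * d i) *s u i"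
      using triangular_distinct_eigenbasis[of "Suc s" X b "\<lambda>i. a i + t * d i"] b by auto
    have "dirderiv f (mat_coords X) w = 0"
      by (rule dirderiv_eigenbasis[OF f, where u = u and l = "\<lambda>i. a i + t * d i"]) (use u UL U(3) in auto)
    then show ?thesis by (simp add: X_def)
  qed
  obtain q where q: "\<And>t. poly q t = dirderiv f (\<chi> i. poly [:v $ i, mat_coords D $ i:] t) w"
    using polyfun_on_curve[OF polyfun_dirderiv[of f w], of "\<lambda>i. [:v $ i, mat_coords D $ i:]"] by auto
  have curve: "(\<chi> i. poly [:v $ i, mat_coords D $ i:] t) = mat_coords (A + mat t ** D)" for t
    by (simp add: vec_eq_iff A_def mat_coords_add mat_coords_scale)
  have "q = 0"
  proof (rule poly_eq_0_if_cofinitely_zero)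
    show "finite E" by (simp add: E_def)
    show "poly q t = 0" if "t \<notin> E" for t unfolding q curve using that by (rule zero)
  qed
  then have "dirderiv f (mat_coords (A + mat 0 ** D)) w = 0" using q[of 0] unfolding curve by simp
  moreover have "A + mat 0 ** D = A" by (simp add: vec_eq_iff mat_scale_nth)
  ultimately show ?thesis by (simp add: A_def)
qed

lemma tangent_cone_space_iff:
  "w \<in> tangent_cone_space X p \<longleftrightarrow> (\<forall>f\<in>vanishing_forms X. \<forall>v\<in>p - {0}. dirderiv f v w = 0)"
  by (simp add: tangent_cone_space_def dirderiv_def)

text \<open>Only the vector 0 needs care: a form of degree 0 is constant and vanishes there because
  it vanishes at some nonzero vector of \<open>C\<close>.\<close>

lemma vanishing_forms_projectivization_iff:
  assumes "scale_closed C" "\<exists>v\<in>C. v \<noteq> 0"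
  shows "f \<in> vanishing_forms (projectivization C) \<longleftrightarrow> homogeneous f \<and> (\<forall>v\<in>C. mpoly_eval f v = 0)"
proof (cases "homogeneous f")
  case True
  then obtain k where k: "formfun k (mpoly_eval f)" by (rule homogeneousE)
  have "f \<in> vanishing_forms (projectivization C) \<longleftrightarrow> (\<forall>v\<in>C - {0}. mpoly_eval f v = 0)"
    using vanishes_on_cone[OF True projectivization_subset[of C]] True
    by (simp add: vanishing_forms_def cone_projectivization[OF assms(1)])
  moreover have "mpoly_eval f 0 = 0" if zero: "\<forall>v\<in>C - {0}. mpoly_eval f v = 0"
  proof -
    obtain v where "v \<in> C" "v \<noteq> 0" using assms(2) by blast
    then show ?thesis using formfun_scale[OF k, of 0 v] zero by simp
  qed
  ultimately show ?thesis using True by auto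
qed (simp add: vanishing_forms_def)

text \<open>All defining differentials vanish at \<open>v\<close> and its multiples, so the tangent
  space is the whole matrix space; one dimension is lost to projectivization.\<close>

lemma tangent_dim_kalman_Suc:
  fixes L :: "('a::alg_closed_field ^ 'n::finite) set"
  assumes L: "vec.subspace L" and v: "v \<in> kalman_cone (Suc s) L" "v \<noteq> 0"
  shows "tangent_dim (projectivization (kalman_cone s L)) (vec.span {v}) = CARD('n \<times> 'n) - 1"
proof -
  have "v \<in> kalman_cone s L" using v(1) by (simp add: kalman_cone_def)
  then have vf: "f \<in> vanishing_forms (projectivization (kalman_cone s L)) \<longleftrightarrow>
      homogeneous f \<and> (\<forall>v\<in>kalman_cone s L. mpoly_eval f v = 0)" for f
    using v(2) by (intro vanishing_forms_projectivization_iff scale_closed_kalman_cone L) blast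
  have mem: "v' \<in> kalman_cone (Suc s) L" if "v' \<in> vec.span {v}" for v'
    using scale_closed_kalman_cone[OF L, of "Suc s"] v(1) that
    by (auto simp: vec.span_singleton scale_closed_def)
  have "w \<in> tangent_cone_space (projectivization (kalman_cone s L)) (vec.span {v})" for w
    unfolding tangent_cone_space_iff
  proof (intro ballI)
    fix f v' assume "f \<in> vanishing_forms (projectivization (kalman_cone s L))" "v' \<in> vec.span {v} - {0}"
    then show "dirderiv f v' w = 0" using vf mem by (intro dirderiv_kalman_Suc[OF L]) auto
  qed
  then have "tangent_cone_space (projectivization (kalman_cone s L)) (vec.span {v}) = UNIV" by blast
  then show ?thesis by (simp add: tangent_dim_def card_cart_basis del: card_prod)
qed

section \<open>Tangent spaces at the smooth points\<close>

definition coeff_matrix :: "nat \<Rightarrow> 'a::comm_ring_1 poly ^ 'n::finite ^ 'n \<Rightarrow> 'a ^ 'n ^ 'n" where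
  "coeff_matrix k M = (\<chi> i j. coeff (M $ i $ j) k)"

lemma coeff_matrix_add: "coeff_matrix k (M + N) = coeff_matrix k M + coeff_matrix k N"
  by (simp add: coeff_matrix_def vec_eq_iff)

lemma coeff_matrix_sum: "coeff_matrix k (sum M I) = (\<Sum>i\<in>I. coeff_matrix k (M i))"
  by (induction I rule: infinite_finite_induct) (simp_all add: coeff_matrix_add, simp_all add: coeff_matrix_def vec_eq_iff)

lemma coeff_matrix_0_mult: "coeff_matrix 0 (M ** N) = coeff_matrix 0 M ** coeff_matrix 0 N"
  by (simp add: coeff_matrix_def vec_eq_iff matrix_matrix_mult_def coeff_sum coeff_mult)

lemma coeff_matrix_1_mult: "coeff_matrix 1 (M ** N) = coeff_matrix 0 M ** coeff_matrix 1 N + coeff_matrix 1 M ** coeff_matrix 0 N"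
  by (simp add: coeff_matrix_def vec_eq_iff matrix_matrix_mult_def coeff_sum coeff_mult sum.distrib)

lemma coeff_matrix_pencil: "coeff_matrix 0 (pencil A B) = A" "coeff_matrix 1 (pencil A B) = B"
  by (simp_all add: coeff_matrix_def pencil_def vec_eq_iff)

lemma coeff_matrix_0_eq_eval_matrix: "coeff_matrix 0 M = eval_matrix 0 M"
  by (simp add: coeff_matrix_def eval_matrix_def vec_eq_iff poly_0_coeff_0)

text \<open>Row \<open>k\<close> of \<open>N\<close> vanishes at 0, so it is divisible by the
  variable. After pulling this factor out, the remaining determinant is evaluated at 0.\<close>

lemma coeff_1_det:
  fixes N :: "'a::field poly ^ 'n::finite ^ 'n"
  assumes "coeff_matrix 0 N = diag_on (- {k})"
  shows "coeff (det N) 1 = coeff_matrix 1 N $ k $ k"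
proof -
  have c0: "coeff (N $ i $ j) 0 = (if i = j \<and> i \<noteq> k then 1 else 0)" for i j
    using arg_cong[OF assms, of "\<lambda>M. M $ i $ j"] by (simp add: coeff_matrix_def diag_on_def)
  have "\<exists>c. N $ k $ j = [:0, 1:] * c" for j
  proof -
    have "poly (N $ k $ j) 0 = 0" using c0[of k j] by (simp add: poly_0_coeff_0)
    then show ?thesis using poly_eq_0_iff_dvd[of "N $ k $ j" 0] by (auto simp: dvd_def)
  qed
  then obtain c where c: "\<And>j. N $ k $ j = [:0, 1:] * c j" by metis
  define M where "M = (\<chi> i. if i = k then (\<chi> j. c j) else N $ i)"
  have "N = (\<chi> i. if i = k then [:0, 1:] *s (\<chi> j. c j) else N $ i)"
    by (simp add: vec_eq_iff c)
  then have "det N = det (\<chi> i. if i = k then [:0, 1:] *s (\<chi> j. c j) else N $ i)" by simp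
  also have "\<dots> = [:0, 1:] * det M"
    unfolding M_def by (rule det_row_mul)
  finally have "coeff (det N) 1 = poly (det M) 0" by (simp add: poly_0_coeff_0)
  also have "\<dots> = det (eval_matrix 0 M)" by (rule poly_det)
  \<comment> \<open>At 0 this is the identity matrix with row \<open>k\<close> replaced, written as
    a combination of rows of the identity to fit Cramer's lemma.\<close>
  also have "eval_matrix 0 M = (\<chi> i. if i = k then (\<Sum>j\<in>UNIV. (\<chi> j. coeff (c j) 0) $ j *s row j (mat 1)) else row i (mat 1))"
  proof -
    have "(\<Sum>j\<in>UNIV. (\<chi> j. coeff (c j) 0) $ j *s row j (mat 1)) = (\<chi> j. coeff (c j) 0)"
      by (simp add: vec_eq_iff row_def mat_def if_distrib[of "\<lambda>x. _ * x"] cong: if_cong)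
    then show ?thesis
      by (simp add: vec_eq_iff eval_matrix_def M_def poly_0_coeff_0 c0 row_def mat_def)
  qed
  also have "det \<dots> = (\<chi> j. coeff (c j) 0) $ k * det (mat 1 :: 'a ^ 'n ^ 'n)"
    by (rule cramer_lemma_transpose)
  also have "\<dots> = coeff (N $ k $ k) 1" by (simp add: c)
  finally show ?thesis by (simp add: coeff_matrix_def)
qed

text \<open>\<open>dpow A B j\<close> is the coefficient of \<open>t\<close> in the \<open>j\<close>-th power of \<open>A + t B\<close>.\<close>

primrec dpow :: "'a::comm_ring_1 ^ 'n::finite ^ 'n \<Rightarrow> 'a ^ 'n ^ 'n \<Rightarrow> nat \<Rightarrow> 'a ^ 'n ^ 'n" where
  "dpow A B 0 = 0"
| "dpow A B (Suc j) = dpow A B j ** A + mpow A j ** B"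

text \<open>The coefficient of \<open>t\<close> in \<open>obs J Q (A + t B)\<close>.\<close>

definition dobs :: "nat \<Rightarrow> (nat \<Rightarrow> 'a::comm_ring_1 ^ 'n::finite ^ 'n) \<Rightarrow> 'a ^ 'n ^ 'n \<Rightarrow> 'a ^ 'n ^ 'n \<Rightarrow> 'a ^ 'n ^ 'n" where
  "dobs J Q A B = (\<Sum>j<J. Q j ** dpow A B j)"

lemma coeff_matrix_mpow: "coeff_matrix 0 (mpow (pencil A B) j) = mpow A j" "coeff_matrix 1 (mpow (pencil A B) j) = dpow A B j"
proof (induction j)
  case 0
  show "coeff_matrix 0 (mpow (pencil A B) 0) = mpow A 0" "coeff_matrix 1 (mpow (pencil A B) 0) = dpow A B 0"
    by (simp_all add: coeff_matrix_def mat_def vec_eq_iff)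
next
  case (Suc j)
  then show "coeff_matrix 0 (mpow (pencil A B) (Suc j)) = mpow A (Suc j)"
    by (simp add: coeff_matrix_0_mult coeff_matrix_pencil)
  from Suc show "coeff_matrix 1 (mpow (pencil A B) (Suc j)) = dpow A B (Suc j)"
    by (simp only: mpow.simps dpow.simps coeff_matrix_1_mult coeff_matrix_pencil add.commute)
qed

lemma eval_matrix_mpow: "eval_matrix t (mpow M j) = mpow (eval_matrix t M) j"
proof (induction j)
  case 0
  then show ?case by (simp add: eval_matrix_def mat_def vec_eq_iff)
qed (simp add: eval_matrix_mult)

lemma eval_matrix_sum: "eval_matrix t (sum M I) = (\<Sum>i\<in>I. eval_matrix t (M i))"
  by (induction I rule: infinite_finite_induct) (simp_all add: eval_matrix_add, simp_all add: eval_matrix_def vec_eq_iff)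

lemma eval_matrix_obs: "eval_matrix t (obs J (\<lambda>j. pencil (Q j) 0) (pencil A B)) = obs J Q (A + mat t ** B)"
  by (simp add: obs_def eval_matrix_sum eval_matrix_mult eval_matrix_mpow eval_matrix_pencil)

lemma coeff_matrix_1_obs: "coeff_matrix 1 (obs J (\<lambda>j. pencil (Q j) 0) (pencil A B)) = dobs J Q A B"
  by (simp only: obs_def dobs_def coeff_matrix_sum coeff_matrix_1_mult coeff_matrix_pencil coeff_matrix_mpow) simp

lemma obs_pad: "K \<le> J \<Longrightarrow> obs K Q X = obs J (\<lambda>j. if j < K then Q j else 0) X"
  for Q :: "nat \<Rightarrow> 'a::comm_ring_1 ^ 'n::finite ^ 'n"
  unfolding obs_def by (intro sum.mono_neutral_cong_left) auto

lemma dobs_pad: "K \<le> J \<Longrightarrow> dobs K Q A B = dobs J (\<lambda>j. if j < K then Q j else 0) A B"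
  unfolding dobs_def by (intro sum.mono_neutral_cong_left) auto

text \<open>One family \<open>P\<close> realises the combination for the values and for the
  first-order terms in every direction. Thus an equation can be altered to first order without
  changing its \<open>obs\<close> at \<open>A\<close>.\<close>

lemma obs_combine:
  fixes Q Q' :: "nat \<Rightarrow> 'a::field ^ 'n::finite ^ 'n"
  assumes "\<And>j. kills (Q j) L" "\<And>j. kills (Q' j) L"
  obtains K P where "\<And>j. kills (P j) L" "obs K P A = obs J Q A + Y ** obs J' Q' A"
    "\<And>B. dobs K P A B = dobs J Q A B + Y ** dobs J' Q' A B"
proof -
  define K where "K = max J J'"
  define P where "P j = (if j < J then Q j else 0) + Y ** (if j < J' then Q' j else 0)" for j
  have le: "J \<le> K" "J' \<le> K" by (auto simp: K_def)
  show ?thesis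
  proof (rule that[of P K])
    show "kills (P j) L" for j
      using assms by (auto simp: kills_def P_def matrix_vector_mult_add_rdistrib simp flip: matrix_vector_mul_assoc)
    show "obs K P A = obs J Q A + Y ** obs J' Q' A"
      unfolding obs_pad[OF le(1)] obs_pad[OF le(2)]
      by (simp add: obs_def P_def matrix_add_rdistrib matrix_mul_sum_right sum.distrib matrix_mul_assoc)
    show "dobs K P A B = dobs J Q A B + Y ** dobs J' Q' A B" for B
      unfolding dobs_pad[OF le(1)] dobs_pad[OF le(2)]
      by (simp add: dobs_def P_def matrix_add_rdistrib matrix_mul_sum_right sum.distrib matrix_mul_assoc)
  qed
qed

lemma diag_on_union: "S \<inter> T = {} \<Longrightarrow> diag_on S + diag_on T = (diag_on (S \<union> T) :: 'a::comm_ring_1 ^ 'n::finite ^ 'n)"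
  by (auto simp: vec_eq_iff diag_on_def)

lemma mult_axis: "(M *v axis k 1) $ i = M $ i $ k" for M :: "'a::comm_ring_1 ^ 'n::finite ^ 'n"
  by (simp add: matrix_vector_mult_def axis_def if_distrib[of "\<lambda>x. _ * x"] cong: if_cong)

lemma mult_diag_on: "(M ** diag_on S) $ i $ k = (if k \<in> S then M $ i $ k else 0)"
  for M :: "'a::comm_ring_1 ^ 'n::finite ^ 'n"
proof -
  have "(M ** diag_on S) $ i $ k = (\<Sum>j\<in>UNIV. M $ i $ j * diag_on S $ j $ k)"
    by (simp add: matrix_matrix_mult_def)
  also have "\<dots> = (\<Sum>j\<in>UNIV. if j = k then (if k \<in> S then M $ i $ k else 0) else 0)"
    by (intro sum.cong) (auto simp: diag_on_def)
  finally show ?thesis by simp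
qed

lemma conj_mult:
  fixes G H :: "'a::comm_ring_1 ^ 'n::finite ^ 'n"
  assumes "H ** G = mat 1"
  shows "H ** (G ** M ** H) ** G = M"
  using conj_inverse[OF assms, of M] .

text \<open>A matrix whose largest invariant subspace in \<open>L\<close> has dimension exactly
  \<open>s\<close>, a basis adapted to that subspace, and a tangent direction \<open>w\<close>.
  Tangency refers to all polynomial functions vanishing on the cone, not only to forms, because the
  determinantal equations are inhomogeneous.\<close>

locale smooth_point =
  fixes L :: "('a::alg_closed_field ^ 'n::finite) set" and s :: nat and v w :: "'a ^ ('n \<times> 'n)"
    and G H :: "'a ^ 'n ^ 'n" and S :: "'n set"
  assumes L: "vec.subspace L"
    and GH: "G ** H = mat 1" "H ** G = mat 1"
    and U: "(*v) G ` coord_subspace S = maxinv L (coords_mat v)" "card S = s"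
    and tangent: "\<And>F q. polyfun F \<Longrightarrow> (\<And>x. x \<in> kalman_cone s L \<Longrightarrow> F x = 0) \<Longrightarrow>
      (\<And>t. poly q t = F (v + t *s w)) \<Longrightarrow> coeff q 1 = 0"
begin

abbreviation "A \<equiv> coords_mat v"
abbreviation "B \<equiv> coords_mat w"
abbreviation "U \<equiv> maxinv L A"

text \<open>Tangency is applied to the determinant of \<open>obs\<close> plus a projection of rank
  \<open>s - 1\<close> that omits the basis vector \<open>k\<close>. In the adapted basis the matrix
  at \<open>v\<close> is \<open>diag_on (- {k})\<close>, so the coefficient of \<open>t\<close> is
  the diagonal entry at \<open>k\<close>.\<close>

lemma dobs_diagonal:
  assumes Q: "\<And>j. kills (Q j) L" "obs J Q A = G ** diag_on (- S) ** H" and k: "k \<in> S"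
  shows "(H ** dobs J Q A B ** G) $ k $ k = 0"
proof -
  define R where "R = G ** diag_on (S - {k}) ** H"
  define F where "F x = det (obs J Q (coords_mat x) + R)" for x
  define W where "W = obs J (\<lambda>j. pencil (Q j) 0) (pencil A B)"
  define N where "N = pencil H 0 ** (W + pencil R 0) ** pencil G 0"
  have detHG: "det H * det G = 1" by (metis GH(2) det_I det_mul)
  have eval_matrix_N: "eval_matrix t N = H ** (obs J Q (A + mat t ** B) + R) ** G" for t
    by (simp add: N_def W_def eval_matrix_mult eval_matrix_add eval_matrix_pencil eval_matrix_obs)
  have "coords_mat (v + t *s w) = A + mat t ** B" for t
    by (simp add: vec_eq_iff mat_scale_nth)
  then have "poly (det N) t = det H * det G * F (v + t *s w)" for t
    unfolding poly_det eval_matrix_N F_def by (simp add: det_mul mult_ac)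
  then have "coeff (det N) 1 = 0"
    using detHG
  proof (intro tangent[of F])
    show "polyfun F" unfolding F_def by (rule polyfun_det_obs)
    have "card (S - {k}) < s" using k U(2) by (metis card_Diff1_less finite)
    then show "F x = 0" if "x \<in> kalman_cone s L" for x
      using that unfolding F_def R_def by (intro det_obs_eq_0[OF L Q(1)]) (auto simp: kalman_cone_def)
  qed simp
  moreover have "coeff_matrix 0 N = diag_on (- {k})"
  proof -
    have "A + mat 0 ** B = A" by (simp add: vec_eq_iff mat_scale_nth)
    then have "coeff_matrix 0 N = H ** (G ** diag_on (- S) ** H + G ** diag_on (S - {k}) ** H) ** G"
      unfolding coeff_matrix_0_eq_eval_matrix eval_matrix_N by (simp add: Q(2) R_def)
    also have "G ** diag_on (- S) ** H + G ** diag_on (S - {k}) ** H = G ** (diag_on (- S) + diag_on (S - {k})) ** H"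
      by (simp add: matrix_add_ldistrib matrix_add_rdistrib)
    also have "diag_on (- S) + diag_on (S - {k}) = (diag_on (- {k}) :: 'a ^ 'n ^ 'n)"
      using k by (subst diag_on_union) (auto intro: arg_cong[where f = diag_on])
    finally show ?thesis by (simp only: conj_mult[OF GH(2)])
  qed
  ultimately have "coeff_matrix 1 N $ k $ k = 0" using coeff_1_det by metis
  moreover have "coeff_matrix 1 N = H ** dobs J Q A B ** G"
    by (simp only: N_def coeff_matrix_1_mult coeff_matrix_0_mult coeff_matrix_add coeff_matrix_pencil W_def coeff_matrix_1_obs) simp
  ultimately show ?thesis by simp
qed

lemma exists_obs_complement_projection:
  obtains J Q where "\<And>j. kills (Q j) L" "obs J Q A = G ** diag_on (- S) ** H"
  using exists_obs_projection[OF L GH U(1)] by metis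

text \<open>Adding a left multiple of the given family to the one producing the projection leaves
  \<open>obs\<close> at \<open>A\<close> unchanged. Comparing diagonal entries for both families
  shows that the multiple contributes nothing, for every choice of multiplier.\<close>

lemma dobs_kills:
  assumes Q: "\<And>j. kills (Q j) L" "obs J Q A = 0" and u: "u \<in> U"
  shows "dobs J Q A B *v u = 0"
proof -
  let ?D = "dobs J Q A B ** G"
  obtain J0 Q0 where Q0: "\<And>j. kills (Q0 j) L" "obs J0 Q0 A = G ** diag_on (- S) ** H"
    using exists_obs_complement_projection by metis
  have D0: "?D $ a $ k = 0" if k: "k \<in> S" for a k
  proof -
    \<comment> \<open>This matrix unit moves row \<open>a\<close> to row \<open>k\<close>, so that a
      diagonal entry reveals an arbitrary entry of column \<open>k\<close>.\<close>
    define Y where "Y = (\<chi> i j. if i = k \<and> j = a then (1 :: 'a) else 0)"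
    obtain K P where P: "\<And>j. kills (P j) L" "obs K P A = obs J0 Q0 A + (G ** Y) ** obs J Q A"
      "\<And>B. dobs K P A B = dobs J0 Q0 A B + (G ** Y) ** dobs J Q A B"
      by (rule obs_combine[where A = A and J = J0 and Y = "G ** Y" and J' = J and Q = Q0 and Q' = Q, OF Q0(1) Q(1)])
        (rule that, auto)
    have "(H ** dobs K P A B ** G) $ k $ k = 0"
      by (rule dobs_diagonal[OF P(1) _ k]) (simp add: P(2) Q0(2) Q(2))
    moreover have "(H ** dobs J0 Q0 A B ** G) $ k $ k = 0" by (rule dobs_diagonal[OF Q0 k])
    moreover have "H ** dobs K P A B ** G = H ** dobs J0 Q0 A B ** G + (H ** G) ** Y ** ?D"
      by (simp only: P(3) matrix_add_ldistrib matrix_add_rdistrib matrix_mul_assoc)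
    ultimately have "(Y ** ?D) $ k $ k = 0" by (simp add: GH(2))
    moreover have "(Y ** ?D) $ k $ k = ?D $ a $ k"
    proof -
      have "(Y ** ?D) $ k $ k = (\<Sum>j\<in>UNIV. Y $ k $ j * ?D $ j $ k)"
        unfolding matrix_matrix_mult_def[of Y] by simp
      also have "\<dots> = (\<Sum>j\<in>UNIV. if j = a then ?D $ a $ k else 0)"
        by (intro sum.cong) (auto simp: Y_def)
      finally show ?thesis by simp
    qed
    ultimately show ?thesis by simp
  qed
  obtain x where x: "x \<in> coord_subspace S" "u = G *v x" using u U(1) by blast
  have "?D $ a $ k * x $ k = 0" for a k
    using D0 x(1) by (cases "k \<in> S") (auto simp: coord_subspace_def)
  then have "?D *v x = 0"
    unfolding matrix_vector_mult_def[of ?D] by (simp only: sum.neutral_const) (simp add: vec_eq_iff)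
  then show ?thesis by (simp add: x(2) matrix_vector_mul_assoc)
qed

lemma mem_if_killed:
  assumes "\<And>Q. kills Q L \<Longrightarrow> Q *v x = 0"
  shows "x \<in> L"
proof (rule ccontr)
  assume "x \<notin> L"
  then obtain c where c: "\<And>v. v \<in> L \<Longrightarrow> (\<Sum>i\<in>UNIV. c $ i * v $ i) = 0" "(\<Sum>i\<in>UNIV. c $ i * x $ i) \<noteq> 0"
    using exists_functional[OF L] by metis
  define Q where "Q = ((\<chi> a b. c $ b) :: 'a ^ 'n ^ 'n)"
  have Q: "(Q *v y) $ a = (\<Sum>i\<in>UNIV. c $ i * y $ i)" for y a by (simp add: Q_def matrix_vector_mult_def)
  then have "kills Q L" using c(1) by (simp add: kills_def vec_eq_iff)
  \<comment> \<open>All rows of \<open>Q\<close> are equal, so any index will do.\<close>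
  then have "(Q *v x) $ undefined = 0" using assms by simp
  then show False using Q c(2) by simp
qed

text \<open>The value of \<open>dobs J Q A B\<close> on \<open>U\<close> depends only on \<open>obs J Q A\<close>, so it has the form
  \<open>obs J Q A ** C\<close>; comparing the terms for \<open>j\<close> and \<open>j + 1\<close> gives the commutation relation.\<close>

lemma first_order_deformation:
  obtains C where "\<And>u. u \<in> U \<Longrightarrow> C *v u \<in> L" "\<And>u i. i \<in> S \<Longrightarrow> (H *v (C *v u)) $ i = 0"
    "\<And>u. u \<in> U \<Longrightarrow> A *v (C *v u) - C *v (A *v u) - B *v u \<in> U"
proof -
  define E where "E = G ** diag_on (- S) ** H"
  obtain J0 Q0 where Q0: "\<And>j. kills (Q0 j) L" "obs J0 Q0 A = E"
    unfolding E_def using exists_obs_complement_projection by metis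
  \<comment> \<open>The left factor \<open>E\<close> removes the components along \<open>U\<close>,
    which normalises \<open>C\<close> to take values in the chosen complement.\<close>
  define C where "C = E ** dobs J0 Q0 A B"
  have key: "Q *v (dpow A B j *v u) = Q *v (mpow A j *v (C *v u))" if Q: "kills Q L" and u: "u \<in> U" for Q j u
  proof -
    define T where "T = Q ** mpow A j"
    define Q1 where "Q1 i = (if i = j then Q else 0)" for i
    have Q1: "kills (Q1 i) L" for i using Q by (simp add: Q1_def kills_def)
    have obs1: "obs (Suc j) Q1 A = T" "dobs (Suc j) Q1 A B = Q ** dpow A B j"
      by (simp_all add: obs_def dobs_def Q1_def T_def)
    \<comment> \<open>Since \<open>T\<close> annihilates \<open>U\<close>, it has zero columns at
      \<open>S\<close> in the adapted basis; hence \<open>T ** E = T\<close>.\<close>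
    have TG: "(T ** G) $ a $ k = 0" if "k \<in> S" for a k
    proof -
      have "G *v axis k 1 \<in> U" using that U(1) axis_mem_coord_subspace by blast
      then have "T *v (G *v axis k 1) = 0"
        using obs_maxinv[where Q = Q1, OF Q1, of _ A "Suc j"] unfolding obs1 by blast
      then have "((T ** G) *v axis k 1) $ a = 0" by (simp add: matrix_vector_mul_assoc)
      then show ?thesis by (simp add: mult_axis)
    qed
    have "T ** G ** diag_on (- S) = T ** G"
      using TG by (auto simp: vec_eq_iff mult_diag_on)
    then have "T ** E = T ** G ** H" by (simp add: E_def matrix_mul_assoc)
    then have TE: "T ** E = T" by (simp add: GH(1) flip: matrix_mul_assoc)
    obtain K P where P: "\<And>j. kills (P j) L" "obs K P A = obs (Suc j) Q1 A + (mat (-1) ** T) ** obs J0 Q0 A"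
      "\<And>B. dobs K P A B = dobs (Suc j) Q1 A B + (mat (-1) ** T) ** dobs J0 Q0 A B"
      by (rule obs_combine[where A = A and J = "Suc j" and Y = "mat (-1) ** T" and J' = J0 and Q = Q1 and Q' = Q0, OF Q1 Q0(1)])
        (rule that, auto)
    \<comment> \<open>The combination of families is chosen to cancel at \<open>A\<close>, so that
      \<open>dobs_kills\<close> compares their first-order terms on \<open>U\<close>.\<close>
    have "obs K P A = T + mat (-1) ** (T ** E)" by (simp add: P(2) obs1 Q0(2) matrix_mul_assoc)
    also have "\<dots> = 0" unfolding TE by (simp add: vec_eq_iff mat_scale_nth)
    finally have "dobs K P A B *v u = 0" by (rule dobs_kills[OF P(1) _ u])
    then have "(Q ** dpow A B j) *v u + (-1) *s ((T ** dobs J0 Q0 A B) *v u) = 0"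
      unfolding P(3) obs1 matrix_vector_mult_add_rdistrib matrix_mul_assoc[symmetric] mat_scale_vec .
    then have "(Q ** dpow A B j) *v u = (T ** dobs J0 Q0 A B) *v u" by (simp add: vec_eq_iff)
    also have "T ** dobs J0 Q0 A B = T ** E ** dobs J0 Q0 A B" unfolding TE ..
    also have "\<dots> = T ** C" by (simp add: C_def matrix_mul_assoc)
    finally show ?thesis by (simp add: T_def matrix_vector_mul_assoc matrix_mul_assoc)
  qed
  show ?thesis
  proof (rule that[of C])
    fix u assume u: "u \<in> U"
    show "C *v u \<in> L"
    proof (rule mem_if_killed)
      fix Q assume "kills Q L"
      from key[OF this u, of 0] show "Q *v (C *v u) = 0" by simp
    qed
    have Au: "A *v u \<in> U" using invariant_maxinv[OF L, of A] u by (simp add: invariant_def)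
    let ?e = "A *v (C *v u) - C *v (A *v u) - B *v u"
    have "mpow A j *v ?e \<in> L" for j
    proof (rule mem_if_killed)
      fix Q assume Q: "kills Q L"
      have "Q *v (dpow A B (Suc j) *v u) = Q *v (mpow A (Suc j) *v (C *v u))" by (rule key[OF Q u])
      then have "Q *v (dpow A B j *v (A *v u)) + Q *v (mpow A j *v (B *v u)) = Q *v (mpow A j *v (A *v (C *v u)))"
        unfolding mpow_Suc_vec by (simp add: matrix_vector_mult_add_rdistrib vec.add flip: matrix_vector_mul_assoc)
      then show "Q *v (mpow A j *v ?e) = 0"
        unfolding key[OF Q Au] by (simp add: vec.diff algebra_simps)
    qed
    then show "?e \<in> U" by (simp add: maxinv_def)
  next
    fix u i assume "i \<in> S"
    have "H *v (C *v u) = (H ** G) *v (diag_on (- S) *v (H *v (dobs J0 Q0 A B *v u)))"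
      by (simp only: C_def E_def matrix_vector_mul_assoc matrix_mul_assoc)
    then show "(H *v (C *v u)) $ i = 0" using \<open>i \<in> S\<close> by (simp add: GH(2) diag_on_vec)
  qed
qed

end

lemma card_complement: "card (- X) = CARD('b) - card X" for X :: "'b::finite set"
  by (simp add: Compl_eq_Diff_UNIV card_Diff_subset)

definition mask :: "('n \<times> 'n) set \<Rightarrow> 'a::zero ^ 'n::finite ^ 'n \<Rightarrow> 'a ^ 'n ^ 'n" where
  "mask P Z = (\<chi> a b. if (a, b) \<in> P then Z $ a $ b else 0)"

text \<open>The two masks have disjoint supports, so one matrix \<open>Z\<close> carries both the part preserving the
  invariant subspace and the deformation \<open>\<Psi>\<close> of that subspace inside \<open>L\<close>.\<close>

definition tangent_map :: "'n set \<Rightarrow> 'n set \<Rightarrow> 'a::field ^ 'n::finite ^ 'n \<Rightarrow> 'a ^ 'n ^ 'n \<Rightarrow> 'a ^ 'n ^ 'n \<Rightarrow>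
    'a ^ ('n \<times> 'n) \<Rightarrow> 'a ^ ('n \<times> 'n)" where
  "tangent_map S T G H A' z =
     (let Z = coords_mat z; \<Psi> = mask ((T - S) \<times> S) Z in
      mat_coords (G ** (mask (- ((- S) \<times> S)) Z + (A' ** \<Psi> - \<Psi> ** A')) ** H))"

lemma mask_add: "mask P (X + Y) = mask P X + mask P Y" for X :: "'a::comm_ring_1 ^ 'n::finite ^ 'n"
  by (simp add: mask_def vec_eq_iff)

lemma mask_scale: "mask P (mat c ** X) = mat c ** mask P X" for X :: "'a::comm_ring_1 ^ 'n::finite ^ 'n"
  by (simp add: mask_def vec_eq_iff mat_scale_nth)

lemma coords_mat_add: "coords_mat (x + y) = coords_mat x + coords_mat y"
  by (simp add: vec_eq_iff)

lemma matrix_diff_distribs: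
  fixes A B C :: "'a::comm_ring_1 ^ 'n::finite ^ 'n"
  shows "A ** (B - C) = A ** B - A ** C" "(A - B) ** C = A ** C - B ** C"
  by (simp_all add: matrix_matrix_mult_def vec_eq_iff left_diff_distrib right_diff_distrib sum_subtractf)

lemma linear_tangent_map: "Vector_Spaces.linear (*s) (*s) (tangent_map S T G H A')"
  unfolding Vector_Spaces.linear_iff
proof (intro conjI allI vec.vector_space_axioms)
  fix x y :: "'a ^ ('b \<times> 'b)"
  show "tangent_map S T G H A' (x + y) = tangent_map S T G H A' x + tangent_map S T G H A' y"
    by (simp add: tangent_map_def Let_def coords_mat_add mask_add matrix_add_ldistrib matrix_add_rdistrib
        matrix_diff_distribs mat_coords_add[symmetric] algebra_simps)
next
  fix c and x :: "'a ^ ('b \<times> 'b)"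
  have left: "X ** (mat c ** Y) = mat c ** (X ** Y)" for X Y :: "'a ^ 'b ^ 'b"
    by (simp add: matrix_mul_assoc mat_commute[of c X])
  show "tangent_map S T G H A' (c *s x) = c *s tangent_map S T G H A' x"
    by (simp only: tangent_map_def Let_def coords_mat_scale mask_scale mat_coords_scale[symmetric] left
        matrix_add_ldistrib matrix_add_rdistrib matrix_diff_distribs matrix_mul_assoc[symmetric])
qed

text \<open>In the adapted basis the deformation equation says that the commutator of
  \<open>A'\<close> and \<open>\<Psi>\<close> differs from \<open>B'\<close> by a matrix
  \<open>D\<close> preserving the coordinate space of \<open>S\<close>. So \<open>B'\<close> is
  recovered from \<open>\<Psi>\<close> and \<open>D\<close>.\<close>

lemma (in smooth_point) tangent_in_image:
  assumes T: "S \<subseteq> T" "(*v) G ` coord_subspace T = L"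
  shows "w \<in> tangent_map S T G H (H ** A ** G) ` coord_subspace (- ((- T) \<times> S))"
proof -
  obtain C where C: "\<And>u. u \<in> U \<Longrightarrow> C *v u \<in> L" "\<And>u i. i \<in> S \<Longrightarrow> (H *v (C *v u)) $ i = 0"
    "\<And>u. u \<in> U \<Longrightarrow> A *v (C *v u) - C *v (A *v u) - B *v u \<in> U"
    using first_order_deformation by metis
  define A' B' C' where "A' = H ** A ** G" and "B' = H ** B ** G" and "C' = H ** C ** G"
  define \<Psi> where "\<Psi> = mask ((T - S) \<times> S) C'"
  define D where "D = A' ** \<Psi> - \<Psi> ** A' - B'"
  have memU: "G *v x \<in> U \<longleftrightarrow> x \<in> coord_subspace S" for x
    unfolding U(1)[symmetric] mem_image_coord_subspace[OF GH]
    by (simp add: matrix_vector_mul_assoc GH(2) coord_subspace_def)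
  \<comment> \<open>On the columns in \<open>S\<close>, the normalisation of \<open>C\<close> kills
    the rows in \<open>S\<close>, and \<open>C\<close> mapping \<open>U\<close> into
    \<open>L\<close> kills the rows outside \<open>T\<close>.\<close>
  have "C' $ a $ b = \<Psi> $ a $ b" if b: "b \<in> S" for a b
  proof -
    have ax: "G *v axis b 1 \<in> U" using b by (simp add: memU axis_mem_coord_subspace)
    have C'ab: "C' $ a $ b = (H *v (C *v (G *v axis b 1))) $ a"
      by (simp only: C'_def mult_axis[symmetric] matrix_vector_mul_assoc matrix_mul_assoc)
    have "C' $ a $ b = 0" if "a \<in> S" unfolding C'ab using that by (rule C(2))
    moreover have "C' $ a $ b = 0" if "a \<notin> T"
      unfolding C'ab using C(1)[OF ax] that mem_image_coord_subspace[OF GH, of _ T] T(2) by blast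
    ultimately show ?thesis using b by (auto simp: \<Psi>_def mask_def)
  qed
  then have eq: "C' $ a $ b * x $ b = \<Psi> $ a $ b * x $ b" if "x \<in> coord_subspace S" for a b and x :: "'a ^ 'n"
    using that by (cases "b \<in> S") (auto simp: coord_subspace_def)
  have \<Psi>C': "\<Psi> *v x = C' *v x" if "x \<in> coord_subspace S" for x
    unfolding matrix_vector_mult_def eq[OF that] ..
  have "invariant A U" by (rule invariant_maxinv[OF L])
  then have A': "preserves S A'" using invariant_conj[OF GH, of A S] by (simp add: U(1) A'_def)
  have "preserves S D"
    unfolding preserves_iff
  proof
    fix x :: "'a ^ 'n" assume x: "x \<in> coord_subspace S"
    then have u: "G *v x \<in> U" by (simp add: memU)
    have A'x: "A' *v x \<in> coord_subspace S" using A' x by (simp add: preserves_iff)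
    have GC': "G *v (M *v x) = X *v (G *v x)" if "M = H ** X ** G" for M X and x :: "'a ^ 'n"
      using GH(1) by (simp add: that matrix_vector_mul_assoc matrix_mul_assoc)
    have "D *v x = A' *v (C' *v x) - C' *v (A' *v x) - B' *v x"
      using x A'x by (simp add: D_def matrix_vector_mult_diff_rdistrib \<Psi>C' flip: matrix_vector_mul_assoc)
    then have GD: "G *v (D *v x) = A *v (C *v (G *v x)) - C *v (A *v (G *v x)) - B *v (G *v x)"
      by (simp add: vec.diff GC'[OF A'_def] GC'[OF B'_def] GC'[OF C'_def])
    show "D *v x \<in> coord_subspace S"
      using C(3)[OF u] unfolding memU[symmetric] GD .
  qed
  then have D0: "D $ a $ b = 0" if "a \<notin> S" "b \<in> S" for a b using that by (simp add: preserves_def)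
  \<comment> \<open>\<open>\<Psi>\<close> lives in the block \<open>(T - S) \<times> S\<close>,
    where \<open>D\<close> is zero, so the masks separate them again; the block of rows outside
    \<open>T\<close> and columns in \<open>S\<close> stays empty.\<close>
  define z where "z = mat_coords (\<Psi> - D)"
  have "z \<in> coord_subspace (- ((- T) \<times> S))"
    using D0 T(1) by (auto simp: z_def coord_subspace_def \<Psi>_def mask_def)
  moreover have "tangent_map S T G H A' z = w"
  proof -
    have 1: "mask ((T - S) \<times> S) (\<Psi> - D) = \<Psi>"
      using D0 by (auto simp: vec_eq_iff mask_def \<Psi>_def)
    have 2: "mask (- ((- S) \<times> S)) (\<Psi> - D) = - D"
      using D0 by (auto simp: vec_eq_iff mask_def \<Psi>_def)
    have "- D + (A' ** \<Psi> - \<Psi> ** A') = B'" by (simp add: D_def)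
    then have "tangent_map S T G H A' z = mat_coords (G ** B' ** H)"
      by (simp add: tangent_map_def Let_def z_def 1 2)
    then show ?thesis by (simp add: B'_def conj_inverse[OF GH(1)])
  qed
  ultimately show ?thesis unfolding A'_def by blast
qed

text \<open>The tangent space lies in a linear image of matrices with an empty block of
  \<open>CARD('n) - vec.dim L\<close> rows and \<open>s\<close> columns. One further dimension is
  lost to projectivization.\<close>

lemma tangent_dim_smooth:
  fixes L :: "('a::alg_closed_field ^ 'n::finite) set"
  assumes L: "vec.subspace L" and v: "v \<in> kalman_cone s L" "v \<notin> kalman_cone (Suc s) L" "v \<noteq> 0"
  shows "tangent_dim (projectivization (kalman_cone s L)) (vec.span {v}) \<le>
    CARD('n \<times> 'n) - 1 - s * (CARD('n) - vec.dim L)"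
proof -
  let ?C = "kalman_cone s L"
  define A where "A = coords_mat v"
  have dimU: "vec.dim (maxinv L A) = s" using v(1,2) by (simp add: kalman_cone_def A_def)
  obtain S T and G H :: "'a ^ 'n ^ 'n" where ST: "S \<subseteq> T" "card S = vec.dim (maxinv L A)" "card T = vec.dim L"
    and basis: "G ** H = mat 1" "H ** G = mat 1" "(*v) G ` coord_subspace S = maxinv L A" "(*v) G ` coord_subspace T = L"
    using adapted_basis_maxinv[OF L, of A] by metis
  have vf: "f \<in> vanishing_forms (projectivization ?C) \<longleftrightarrow> homogeneous f \<and> (\<forall>v\<in>?C. mpoly_eval f v = 0)" for f
    using v by (intro vanishing_forms_projectivization_iff scale_closed_kalman_cone L) blast
  have "tangent_cone_space (projectivization ?C) (vec.span {v}) \<subseteq>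
      tangent_map S T G H (H ** A ** G) ` coord_subspace (- ((- T) \<times> S))"
  proof
    fix w assume w: "w \<in> tangent_cone_space (projectivization ?C) (vec.span {v})"
    interpret smooth_point L s v w G H S
    proof
      \<comment> \<open>The tangent space is defined by forms; an arbitrary polynomial function
        vanishing on the cone is reduced to its homogeneous components, which vanish there
        too.\<close>
      fix F and q :: "'a poly"
      assume F: "polyfun F" "\<And>x. x \<in> ?C \<Longrightarrow> F x = 0" and q: "\<And>t. poly q t = F (v + t *s w)"
      obtain f where f: "F = mpoly_eval f" using F(1) by (auto simp: polyfun_def)
      obtain g K where g: "f = (\<Sum>k\<le>(K::nat). g k)" "\<And>k. homogeneous (g k)"
        "\<And>k w. k \<le> K \<Longrightarrow> w \<in> ?C \<Longrightarrow> mpoly_eval (g k) w = 0"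
        using polyfun_vanishing_on_cone[OF scale_closed_kalman_cone[OF L], of s f] F(2) unfolding f by metis
      have "\<exists>r. \<forall>t. poly r t = mpoly_eval (g k) (v + t *s w)" for k
        using directional_derivative by blast
      then obtain r where r: "\<And>k t. poly (r k) t = mpoly_eval (g k) (v + t *s w)" by metis
      have "coeff (r k) 1 = 0" if "k \<le> K" for k
      proof -
        have "g k \<in> vanishing_forms (projectivization ?C)" using g(2,3) that vf by blast
        moreover have "v \<in> vec.span {v} - {0}" using v(3) by (simp add: vec.span_base)
        ultimately have "dirderiv (g k) v w = 0" using w unfolding tangent_cone_space_iff by blast
        then show ?thesis using dirderiv_eq_coeff[OF r] by simp
      qed
      moreover have "q = (\<Sum>k\<le>K. r k)"
        by (rule poly_eqI_cofinite[of "{}"]) (simp_all add: q f g(1) mpoly_eval_sum r poly_sum)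
      ultimately show "coeff q 1 = 0" by (simp add: coeff_sum)
    qed (use L basis ST dimU in \<open>simp_all add: A_def\<close>)
    show "w \<in> tangent_map S T G H (H ** A ** G) ` coord_subspace (- ((- T) \<times> S))"
      using tangent_in_image[OF ST(1) basis(4)] by (simp add: A_def)
  qed
  then have "vec.dim (tangent_cone_space (projectivization ?C) (vec.span {v})) \<le>
      vec.dim (tangent_map S T G H (H ** A ** G) ` coord_subspace (- ((- T) \<times> S)))"
    by (rule vec.dim_subset)
  also have "\<dots> \<le> vec.dim (coord_subspace (- ((- T) \<times> S)) :: ('a ^ ('n \<times> 'n)) set)"
    by (intro vec.dim_image_le linear_tangent_map)
  also have "\<dots> = CARD('n \<times> 'n) - (CARD('n) - card T) * card S"
    by (simp only: dim_coord_subspace card_complement card_cartesian_product)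
  finally show ?thesis
    unfolding tangent_dim_def by (simp add: ST dimU mult.commute)
qed

section \<open>A complete flag through the Kalman cones\<close>

lemma coord_subspace_mono: "S \<subseteq> T \<Longrightarrow> coord_subspace S \<subseteq> coord_subspace T"
  unfolding coord_subspace_def by blast

lemma diagonal_vec: "((\<chi> i j. if i = j then l i else 0) *v x) $ i = l i * x $ i"
  for x :: "'a::comm_ring_1 ^ 'n::finite"
  by (simp add: matrix_vector_mult_def if_distrib[of "\<lambda>c. c * _"] cong: if_cong)

text \<open>Applying \<open>A - l b\<close> for all \<open>b \<noteq> i\<close> to a vector of an invariant subspace isolates its component
  along the \<open>i\<close>-th eigenvector.\<close>

lemma maxinv_diagonalizable:
  fixes M M' :: "'a::field ^ 'n::finite ^ 'n"
  assumes L: "vec.subspace L" and M: "M ** M' = mat 1" "M' ** M = mat 1" and l: "inj l"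
  defines "A \<equiv> M ** (\<chi> i j. if i = j then l i else 0) ** M'"
  shows "maxinv L A = (*v) M ` coord_subspace {i. M *v axis i 1 \<in> L}"
proof
  let ?\<Lambda> = "(\<chi> i j. if i = j then l i else 0) :: 'a ^ 'n ^ 'n" and ?S = "{i. M *v axis i 1 \<in> L}"
  have "preserves ?S ?\<Lambda>" by (auto simp: preserves_def)
  moreover have "M' ** A ** M = ?\<Lambda>" unfolding A_def by (rule conj_inverse[OF M(2)])
  ultimately have "invariant A ((*v) M ` coord_subspace ?S)" using invariant_conj[OF M] by metis
  moreover have "(*v) M ` coord_subspace ?S \<subseteq> L"
    unfolding coord_subspace_eq_span vec.span_image[symmetric]
    by (rule vec.span_minimal) (use L in auto)
  ultimately show "(*v) M ` coord_subspace ?S \<subseteq> maxinv L A" by (rule invariant_subset_maxinv)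
  show "maxinv L A \<subseteq> (*v) M ` coord_subspace ?S"
  proof
    fix x assume x: "x \<in> maxinv L A"
    define y where "y = M' *v x"
    have My: "x = M *v y" by (simp add: y_def matrix_vector_mul_assoc M)
    have inv: "invariant A (maxinv L A)" by (rule invariant_maxinv[OF L])
    then have sub: "vec.subspace (maxinv L A)" by (simp add: invariant_def)
    have AM: "A *v (M *v z) = M *v (?\<Lambda> *v z)" for z
      unfolding A_def by (simp add: matrix_vector_mul_assoc M(2) flip: matrix_mul_assoc)
    have prod: "M *v (\<chi> a. y $ a * (\<Prod>b\<in>F. l a - l b)) \<in> maxinv L A" if "finite F" for F
      using that
    proof induction
      case empty
      have "(\<chi> a. y $ a * (\<Prod>b\<in>{}. l a - l b)) = y" by (simp add: vec_eq_iff)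
      then show ?case using x My by simp
    next
      case (insert b F)
      define z where "z = (\<chi> a. y $ a * (\<Prod>b\<in>F. l a - l b))"
      have "A *v (M *v z) - l b *s (M *v z) \<in> maxinv L A"
        using insert.IH inv sub by (auto simp: z_def invariant_def vec.subspace_diff vec.subspace_scale)
      moreover have "A *v (M *v z) - l b *s (M *v z) = M *v (?\<Lambda> *v z - l b *s z)"
        by (simp add: AM vec.diff vec.scale)
      moreover have "?\<Lambda> *v z - l b *s z = (\<chi> a. y $ a * (\<Prod>b\<in>insert b F. l a - l b))"
        using insert.hyps by (simp add: vec_eq_iff diagonal_vec z_def algebra_simps)
      ultimately show ?case by simp
    qed
    have "M *v axis i 1 \<in> L" if i: "y $ i \<noteq> 0" for i
    proof -
      define c where "c = y $ i * (\<Prod>b\<in>UNIV - {i}. l i - l b)"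
      have "c \<noteq> 0" using i l by (auto simp: c_def inj_def)
      have "(\<chi> a. y $ a * (\<Prod>b\<in>UNIV - {i}. l a - l b)) = c *s axis i 1"
      proof (rule vec_eq_iff[THEN iffD2], rule allI)
        fix a
        have "(\<Prod>b\<in>UNIV - {i}. l a - l b) = 0" if "a \<noteq> i"
          using that by (intro prod_zero) auto
        then show "(\<chi> a. y $ a * (\<Prod>b\<in>UNIV - {i}. l a - l b)) $ a = (c *s axis i 1) $ a"
          by (cases "a = i") (auto simp: c_def axis_def)
      qed
      then have "M *v (c *s axis i 1) \<in> maxinv L A" using prod[of "UNIV - {i}"] by simp
      then have "inverse c *s (M *v (c *s axis i 1)) \<in> maxinv L A" using sub by (intro vec.subspace_scale)
      moreover have "inverse c *s (M *v (c *s axis i 1)) = M *v axis i 1"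
        using \<open>c \<noteq> 0\<close> by (simp add: vec.scale)
      ultimately show ?thesis using maxinv_subset by auto
    qed
    then have "y \<in> coord_subspace ?S" by (auto simp: coord_subspace_def)
    then show "x \<in> (*v) M ` coord_subspace ?S" using My by blast
  qed
qed

text \<open>At the extreme dimension the cone is a linear space, which is where the linear part of
  the flag ends.\<close>

lemma kalman_cone_full:
  assumes "vec.subspace L"
  shows "kalman_cone (vec.dim L) L = {v. invariant (coords_mat v) L}"
proof -
  have "vec.dim L \<le> vec.dim (maxinv L A) \<longleftrightarrow> invariant A L" for A
  proof
    assume "vec.dim L \<le> vec.dim (maxinv L A)"
    then have "maxinv L A = L"
      using invariant_maxinv[OF assms, of A] assms maxinv_subset[of L A]
      by (intro vec.subspace_dim_equal) (auto simp: invariant_def)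
    then show "invariant A L" using invariant_maxinv[OF assms, of A] by simp
  next
    assume "invariant A L"
    then have "L \<subseteq> maxinv L A" by (simp add: invariant_subset_maxinv)
    then show "vec.dim L \<le> vec.dim (maxinv L A)" by (rule vec.dim_subset)
  qed
  then show ?thesis by (simp add: kalman_cone_def)
qed

lemma kalman_cone_mono: "L' \<subseteq> L \<Longrightarrow> kalman_cone s L' \<subseteq> kalman_cone s L"
  unfolding kalman_cone_def by (auto intro: le_trans vec.dim_subset[OF maxinv_mono])

lemma kalman_cone_antimono: "s' \<le> s \<Longrightarrow> kalman_cone s L \<subseteq> kalman_cone s' L"
  by (auto simp: kalman_cone_def)

lemma form_closed_Int: "form_closed C \<Longrightarrow> form_closed C' \<Longrightarrow> form_closed (C \<inter> C')"
  unfolding form_closed_def by (metis IntD1 IntD2 IntI)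

lemma scale_closed_Int: "scale_closed C \<Longrightarrow> scale_closed C' \<Longrightarrow> scale_closed (C \<inter> C')"
  unfolding scale_closed_def by blast

text \<open>Conjugation into the adapted basis identifies these matrices with those having a zero
  block of rows outside \<open>S\<close> and columns in \<open>S\<close>.\<close>

lemma subspace_dim_invariant_matrices:
  fixes G H :: "'a::field ^ 'n::finite ^ 'n" and S :: "'n set"
  assumes G: "G ** H = mat 1" "H ** G = mat 1"
  defines "P \<equiv> {v. invariant (coords_mat v) ((*v) G ` coord_subspace S)}"
  shows "vec.subspace P" "vec.dim P = CARD('n) * CARD('n) - (CARD('n) - card S) * card S"
proof -
  let ?f = "\<lambda>z. mat_coords (G ** coords_mat z ** H)"
  let ?Q = "- ((- S) \<times> S)"
  have lin: "Vector_Spaces.linear (*s) (*s) ?f"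
    unfolding Vector_Spaces.linear_iff
  proof (intro conjI allI vec.vector_space_axioms)
    show "?f (x + y) = ?f x + ?f y" for x y
      by (simp add: coords_mat_add matrix_add_ldistrib matrix_add_rdistrib mat_coords_add)
    show "?f (c *s x) = c *s ?f x" for c x
      by (simp only: coords_mat_scale mat_coords_scale[symmetric] matrix_mul_assoc mat_commute[of c G, symmetric])
  qed
  have "inj ?f"
    by (rule inj_on_inverseI[of _ "\<lambda>v. mat_coords (H ** coords_mat v ** G)"])
       (simp add: conj_inverse[OF G(2)])
  have "P = ?f ` coord_subspace ?Q"
  proof (intro equalityI subsetI)
    fix v assume "v \<in> P"
    then have "preserves S (H ** coords_mat v ** G)" by (simp add: P_def invariant_conj[OF G])
    then have "mat_coords (H ** coords_mat v ** G) \<in> coord_subspace ?Q"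
      by (auto simp: coord_subspace_def preserves_def)
    moreover have "v = ?f (mat_coords (H ** coords_mat v ** G))" by (simp add: conj_inverse[OF G(1)])
    ultimately show "v \<in> ?f ` coord_subspace ?Q" by (rule rev_image_eqI)
  next
    fix v assume "v \<in> ?f ` coord_subspace ?Q"
    then obtain z where z: "z \<in> coord_subspace ?Q" "v = ?f z" by blast
    have "preserves S (coords_mat z)" using z(1) by (auto simp: coord_subspace_def preserves_def)
    then show "v \<in> P" by (simp add: P_def z(2) invariant_conj[OF G] conj_inverse[OF G(2)])
  qed
  moreover have "vec.subspace (?f ` coord_subspace ?Q)"
    using lin by (intro vec.linear_subspace_image subspace_coord_subspace)
  moreover have "vec.dim (?f ` coord_subspace ?Q) = vec.dim (coord_subspace ?Q :: ('a ^ ('n \<times> 'n)) set)"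
    using lin \<open>inj ?f\<close> by (intro vec.dim_image_eq) (auto intro: inj_on_subset)
  ultimately show "vec.subspace P" "vec.dim P = CARD('n) * CARD('n) - (CARD('n) - card S) * card S"
    by (simp_all only: dim_coord_subspace card_complement card_cartesian_product card_prod)
qed

lemma subspace_chain:
  fixes P :: "('a::field ^ 'i::finite) set"
  assumes "vec.subspace P" "vec.dim P = Suc q"
  obtains W where "\<And>i. i \<le> q \<Longrightarrow> vec.subspace (W i)" "\<And>i. i \<le> q \<Longrightarrow> vec.dim (W i) = Suc i"
    "\<And>i. i < q \<Longrightarrow> W i \<subset> W (Suc i)" "W q = P"
proof -
  have "Suc q \<le> CARD('i)" using dim_subset_UNIV_cart_gen[of P] assms(2) by simp
  then obtain Q :: "'i set" where Q: "card Q = Suc q"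
    using obtain_subset_with_card_n[of "Suc q" "UNIV :: 'i set"] by metis
  obtain G H :: "'a ^ 'i ^ 'i" where G: "G ** H = mat 1" "H ** G = mat 1" "(*v) G ` coord_subspace Q = P"
    using adapted_basis1[OF assms(1)] Q assms(2) by metis
  obtain e where e: "bij_betw e {..<Suc q} Q"
    using finite_same_card_bij[of "{..<Suc q}" Q] Q by auto
  define W where "W i = (*v) G ` coord_subspace (e ` {..i})" for i
  have dimW: "vec.dim (W i) = Suc i" if "i \<le> q" for i
  proof -
    have "inj_on e {..i}" using e that by (auto simp: bij_betw_def intro: inj_on_subset)
    then show ?thesis unfolding W_def dim_image_invertible[OF G(2)] by (simp add: card_image)
  qed
  show ?thesis
  proof (rule that[of W])
    show "vec.subspace (W i)" for i
      unfolding W_def by (intro vec.subspace_image subspace_coord_subspace)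
    show "W i \<subset> W (Suc i)" if "i < q" for i
    proof -
      have "W i \<subseteq> W (Suc i)" unfolding W_def by (intro image_mono coord_subspace_mono) auto
      moreover have "W i \<noteq> W (Suc i)" using dimW[of i] dimW[of "Suc i"] that by auto
      ultimately show ?thesis by blast
    qed
    have "e ` {..q} = Q" using e by (simp add: bij_betw_def lessThan_Suc_atMost)
    then show "W q = P" by (simp add: W_def G(3))
  qed (rule dimW)
qed

text \<open>The columns of \<open>G\<close>, in the order given by \<open>e\<close>, span a complete
  flag of the vector space; \<open>s\<close> is the dimension demanded of the invariant
  subspace.\<close>

locale adapted_flag =
  fixes G H :: "'a::alg_closed_field ^ 'n::finite ^ 'n" and e :: "nat \<Rightarrow> 'n" and s :: nat
  assumes GH: "G ** H = mat 1" "H ** G = mat 1" and e: "bij_betw e {..<CARD('n)} UNIV"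
    and s: "1 \<le> s" "s \<le> CARD('n)"
begin

definition std_flag :: "nat \<Rightarrow> ('a ^ 'n) set" where
  "std_flag k = (*v) G ` coord_subspace (e ` {..<k})"

lemma subspace_std_flag: "vec.subspace (std_flag k)"
  unfolding std_flag_def by (intro vec.subspace_image subspace_coord_subspace)

lemma std_flag_mono: "k \<le> k' \<Longrightarrow> std_flag k \<subseteq> std_flag k'"
  unfolding std_flag_def by (intro image_mono coord_subspace_mono) auto

lemma dim_std_flag: "k \<le> CARD('n) \<Longrightarrow> vec.dim (std_flag k) = k"
proof -
  assume k: "k \<le> CARD('n)"
  have "inj_on e {..<k}" using e k by (auto simp: bij_betw_def intro: inj_on_subset)
  then show ?thesis unfolding std_flag_def dim_image_invertible[OF GH(2)] by (simp add: card_image)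
qed

lemma std_flag_UNIV: "CARD('n) \<le> k \<Longrightarrow> std_flag k = UNIV"
proof -
  assume "CARD('n) \<le> k"
  have "std_flag (CARD('n)) = UNIV"
    using dim_std_flag[of "CARD('n)"] subspace_std_flag
    by (intro vec.subspace_dim_equal) (auto simp: card_cart_basis)
  then show ?thesis using std_flag_mono[OF \<open>CARD('n) \<le> k\<close>] by auto
qed

lemma dim_std_flag_ge: "j \<le> k \<Longrightarrow> j \<le> CARD('n) \<Longrightarrow> j \<le> vec.dim (std_flag k)"
  using vec.dim_subset[OF std_flag_mono[of j k]] dim_std_flag[of j] by simp

text \<open>The witness is diagonalizable. Its eigenvectors are the basis vectors, except that the one with
  index \<open>k\<close> is added to those with index in \<open>{j..<k}\<close> in order to move them out of \<open>std_flag k\<close>.\<close>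

lemma exists_between:
  assumes k: "Suc k \<le> CARD('n)" and j: "j \<le> k"
  obtains A where "Suc k \<le> vec.dim (maxinv (std_flag (Suc k)) A)" "vec.dim (maxinv (std_flag k) A) = j"
proof -
  obtain d :: "nat \<Rightarrow> 'a" where d: "inj d"
    using infinite_countable_subset[OF infinite_UNIV_alg_closed[where 'a='a]] by blast
  define l where "l = (\<lambda>i. d (the_inv_into {..<CARD('n)} e i))"
  have "inj l"
  proof (rule injI)
    fix a b assume "l a = l b"
    then have "the_inv_into {..<CARD('n)} e a = the_inv_into {..<CARD('n)} e b"
      using d by (auto simp: l_def inj_def)
    then show "a = b" using e by (metis bij_betw_def f_the_inv_into_f UNIV_I)
  qed
  have e_eq: "e a = e b \<longleftrightarrow> a = b" if "a < CARD('n)" "b < CARD('n)" for a b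
    using e that by (auto simp: bij_betw_def inj_on_def)
  have e_mem: "e a \<in> e ` B \<longleftrightarrow> a \<in> B" if "a < CARD('n)" "B \<subseteq> {..<CARD('n)}" for a B
    using that e_eq by blast
  have sub: "{j..<k} \<subseteq> {..<CARD('n)}" "{..<k} \<subseteq> {..<CARD('n)}" using k by auto
  \<comment> \<open>This adds the basis vector \<open>k\<close> to those from \<open>j\<close> to
    \<open>k - 1\<close>. It squares to zero, so \<open>mat 1 - N\<close> inverts
    \<open>mat 1 + N\<close>.\<close>
  define N where "N = ((\<chi> a b. if a = e k \<and> b \<in> e ` {j..<k} then 1 else 0) :: 'a ^ 'n ^ 'n)"
  have zero: "N $ a $ b * N $ b $ c = 0" for a b c
    using k by (auto simp: N_def e_eq)
  have "N ** N = 0"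
    by (simp only: matrix_matrix_mult_def zero sum.neutral_const) (simp add: vec_eq_iff)
  then have NN: "(mat 1 + N) ** (mat 1 - N) = mat 1" "(mat 1 - N) ** (mat 1 + N) = mat 1"
    by (simp_all add: matrix_diff_distribs matrix_add_ldistrib matrix_add_rdistrib)
  define M where "M = G ** (mat 1 + N)"
  define M' where "M' = (mat 1 - N) ** H"
  have "M ** M' = G ** ((mat 1 + N) ** (mat 1 - N)) ** H" by (simp only: M_def M'_def matrix_mul_assoc)
  then have MM: "M ** M' = mat 1" by (simp add: NN GH)
  then have MM': "M' ** M = mat 1" by (simp add: matrix_left_right_inverse)
  define A where "A = M ** (\<chi> i j. if i = j then l i else 0) ** M'"
  have dimA: "vec.dim (maxinv (std_flag r) A) = card {i. M *v axis i 1 \<in> std_flag r}" for r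
    unfolding A_def maxinv_diagonalizable[OF subspace_std_flag MM MM' \<open>inj l\<close>] by (rule dim_image_invertible[OF MM'])
  have comp: "(H *v (M *v axis i 1)) $ a = (if a = i then 1 else 0) + N $ a $ i" for i a
  proof -
    have "H *v (M *v axis i 1) = ((H ** G) ** (mat 1 + N)) *v axis i 1"
      by (simp only: M_def matrix_vector_mul_assoc matrix_mul_assoc)
    then show ?thesis by (simp add: GH mult_axis) (simp add: mat_def)
  qed
  have mem: "M *v axis i 1 \<in> std_flag r \<longleftrightarrow> (\<forall>a. a \<notin> e ` {..<r} \<longrightarrow> (if a = i then 1 else 0) + N $ a $ i = 0)" for i r
    unfolding std_flag_def mem_image_coord_subspace[OF GH] comp ..
  have in1: "M *v axis (e i) 1 \<in> std_flag (Suc k)" if "i < Suc k" for i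
    unfolding mem N_def using that by auto
  have in2: "M *v axis (e i) 1 \<in> std_flag k \<longleftrightarrow> i < j" if i: "i < CARD('n)" for i
  proof
    assume "i < j"
    then have "e i \<notin> e ` {j..<k}" using e_mem[OF i sub(1)] \<open>i < j\<close> by simp
    then show "M *v axis (e i) 1 \<in> std_flag k"
      unfolding mem N_def using \<open>i < j\<close> j by auto
  next
    assume mem_k: "M *v axis (e i) 1 \<in> std_flag k"
    have ek: "e k \<notin> e ` {..<k}" using e_mem[OF _ sub(2), of k] k by simp
    show "i < j"
    proof (rule ccontr)
      assume "\<not> i < j"
      show False
      proof (cases "i < k")
        case True
        then have "e i \<in> e ` {j..<k}" "e k \<noteq> e i" using \<open>\<not> i < j\<close> k i e_eq by auto
        then have "(if e k = e i then 1 else 0) + N $ e k $ e i = 1" by (simp add: N_def)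
        then show False using mem_k ek unfolding mem by (metis one_neq_zero)
      next
        case False
        then have "e i \<notin> e ` {..<k}" "e i \<notin> e ` {j..<k}"
          using e_mem[OF i sub(2)] e_mem[OF i sub(1)] False by simp_all
        then have "(if e i = e i then 1 else 0) + N $ e i $ e i = 1" by (simp add: N_def)
        then show False using mem_k \<open>e i \<notin> e ` {..<k}\<close> unfolding mem by (metis one_neq_zero)
      qed
    qed
  qed
  have surj: "\<exists>i<CARD('n). a = e i" for a using e by (auto simp: bij_betw_def)
  show ?thesis
  proof (rule that[of A])
    have "inj_on e {..<Suc k}" using e k by (auto simp: bij_betw_def intro: inj_on_subset)
    then have "Suc k = card (e ` {..<Suc k})" by (simp add: card_image)
    also have "\<dots> \<le> card {i. M *v axis i 1 \<in> std_flag (Suc k)}" using in1 by (intro card_mono) auto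
    finally show "Suc k \<le> vec.dim (maxinv (std_flag (Suc k)) A)" by (simp only: dimA)
    have "{i. M *v axis i 1 \<in> std_flag k} = e ` {..<j}"
    proof (intro equalityI subsetI)
      fix a assume "a \<in> {i. M *v axis i 1 \<in> std_flag k}"
      then show "a \<in> e ` {..<j}" using surj[of a] in2 by auto
    next
      fix a assume "a \<in> e ` {..<j}"
      then show "a \<in> {i. M *v axis i 1 \<in> std_flag k}" using in2 j k by auto
    qed
    moreover have "inj_on e {..<j}" using e k j by (auto simp: bij_betw_def intro: inj_on_subset)
    ultimately show "vec.dim (maxinv (std_flag k) A) = j" by (simp add: dimA card_image)
  qed
qed

text \<open>As \<open>r\<close> grows, the condition on the smaller subspace is relaxed one dimension at a time; when it
  has become void, the pair of consecutive members of the flag moves up by one.\<close>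

definition level :: "nat \<Rightarrow> ('a ^ ('n \<times> 'n)) set" where
  "level r = kalman_cone s (std_flag (Suc (s + r div s))) \<inter> kalman_cone (s - r mod s) (std_flag (s + r div s))"

lemma level_mult: "level (s * q) = kalman_cone s (std_flag (s + q))"
  using s kalman_cone_mono[OF std_flag_mono[of "s + q" "Suc (s + q)"]] by (auto simp: level_def)

text \<open>If \<open>r mod s\<close> is \<open>s - 1\<close>, the second condition asks for
  dimension 0 and is void, in agreement with the move to the next pair of flag members; otherwise
  only the remainder changes. The common formula makes consecutive levels directly
  comparable.\<close>

lemma level_Suc: "level (Suc r) = kalman_cone s (std_flag (Suc (s + r div s))) \<inter> kalman_cone (s - r mod s - 1) (std_flag (s + r div s))"
proof (cases "Suc (r mod s) = s")
  case True
  have "Suc r = s * (r div s) + Suc (r mod s)" by simp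
  then have "Suc r = s * Suc (r div s)" unfolding True by simp
  then have "level (Suc r) = kalman_cone s (std_flag (s + Suc (r div s)))" using level_mult by metis
  moreover have "s - r mod s - 1 = 0" using True by simp
  ultimately show ?thesis by (simp add: kalman_cone_def)
next
  case False
  then have "Suc r mod s = Suc (r mod s)" "Suc r div s = r div s"
    by (simp_all add: mod_Suc div_Suc)
  then show ?thesis by (simp add: level_def)
qed

text \<open>Consecutive levels differ only in the dimension demanded on the smaller flag member, and
  \<open>exists_between\<close> supplies a matrix attaining exactly the weaker value.\<close>

lemma level_strict:
  assumes "r < s * (CARD('n) - s)"
  shows "level r \<subset> level (Suc r)"
proof -
  let ?k = "s + r div s" and ?j = "s - r mod s"
  have j: "1 \<le> ?j" using mod_less_divisor[of s r] s by linarith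
  have "r div s < CARD('n) - s" using assms by (simp add: less_mult_imp_div_less mult.commute)
  then have k: "Suc ?k \<le> CARD('n)" by simp
  have sub: "level r \<subseteq> level (Suc r)"
    unfolding level_Suc unfolding level_def using kalman_cone_antimono[OF diff_le_self[of ?j 1]] by blast
  obtain A where A: "Suc ?k \<le> vec.dim (maxinv (std_flag (Suc ?k)) A)" "vec.dim (maxinv (std_flag ?k) A) = ?j - 1"
    by (rule exists_between[OF k, of "?j - 1"]) linarith
  have "mat_coords A \<in> level (Suc r)" unfolding level_Suc using A by (simp add: kalman_cone_def)
  moreover have "\<not> ?j \<le> vec.dim (maxinv (std_flag ?k) A)" unfolding A(2) using j by linarith
  then have "mat_coords A \<notin> level r" by (simp add: level_def kalman_cone_def)
  ultimately show ?thesis using sub by blast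
qed

lemma level_form_cone:
  assumes "r \<le> s * (CARD('n) - s)"
  shows "form_irreducible (level r - {0})" "form_closed (level r)" "scale_closed (level r)"
proof -
  have "s * (r div s) \<le> s * (CARD('n) - s)" using assms by (meson le_trans times_div_less_eq_dividend)
  then have "r div s \<le> CARD('n) - s" using s by simp
  then have k: "s + r div s \<le> CARD('n)" using s by simp
  show "form_irreducible (level r - {0})"
    unfolding level_def using k s
    by (intro form_irreducible_kalman_cone_flag subspace_std_flag std_flag_mono dim_std_flag_ge) auto
  show "form_closed (level r)" "scale_closed (level r)"
    unfolding level_def by (intro form_closed_Int scale_closed_Int form_closed_kalman_cone scale_closed_kalman_cone subspace_std_flag)+
qed

text \<open>Linear subspaces lead up to the matrices preserving \<open>std_flag s\<close>, which
  form \<open>level 0\<close>; then \<open>s * (CARD('n) - s)\<close> strict steps of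
  \<open>level\<close> reach the whole space. The Kalman cone of \<open>std_flag k\<close> is
  \<open>level (s * (k - s))\<close>, which determines its position.\<close>

lemma exists_cone_flag:
  "\<exists>D. cone_flag D (CARD('n) * CARD('n) - 1) \<and> D (CARD('n) * CARD('n) - 1) = UNIV \<and>
    (\<forall>k. s \<le> k \<longrightarrow> k \<le> CARD('n) \<longrightarrow>
      D (CARD('n) * CARD('n) - 1 - s * (CARD('n) - k)) = kalman_cone s (std_flag k))"
proof -
  let ?n = "CARD('n)"
  define P where "P = level 0"
  have P: "P = {v. invariant (coords_mat v) (std_flag s)}"
    using level_mult[of 0] kalman_cone_full[OF subspace_std_flag[of s]] dim_std_flag[OF s(2)] by (simp add: P_def)
  have card_s: "card (e ` {..<s}) = s"
    using e s(2) by (subst card_image) (auto simp: bij_betw_def intro: inj_on_subset)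
  have subP: "vec.subspace P" and dimP: "vec.dim P = ?n * ?n - (?n - s) * s"
    using subspace_dim_invariant_matrices[OF GH, of "e ` {..<s}"] by (simp_all only: P std_flag_def card_s)
  have ss: "s * (?n - s) < ?n * ?n"
  proof -
    have "s * (?n - s) \<le> ?n * (?n - s)" using s by (intro mult_le_mono1)
    also have "\<dots> < ?n * ?n" using s by simp
    finally show ?thesis .
  qed
  \<comment> \<open>The projective dimension of \<open>P\<close>, one less than its linear
    dimension.\<close>
  define q where "q = ?n * ?n - 1 - s * (?n - s)"
  have dimq: "vec.dim P = Suc q" using ss by (simp add: q_def dimP mult.commute)
  have Nq: "?n * ?n - 1 = q + s * (?n - s)" using ss by (simp add: q_def)
  obtain W where W: "\<And>i. i \<le> q \<Longrightarrow> vec.subspace (W i)" "\<And>i. i \<le> q \<Longrightarrow> vec.dim (W i) = Suc i"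
    "\<And>i. i < q \<Longrightarrow> W i \<subset> W (Suc i)" "W q = P"
    using subspace_chain[OF subP dimq] by metis
  define D where "D i = (if i \<le> q then W i else level (i - q))" for i
  have D_ge: "D (q + r) = level r" for r by (cases "r = 0") (auto simp: D_def W(4) P_def)
  show ?thesis
  proof (intro exI[of _ D] conjI)
    show "cone_flag D (?n * ?n - 1)"
    proof
      show "CARD('n \<times> 'n) = Suc (?n * ?n - 1)" by simp
      fix i
      have Wne: "\<exists>v\<in>W i. v \<noteq> 0" if "i \<le> q"
      proof (rule ccontr)
        assume "\<not> (\<exists>v\<in>W i. v \<noteq> 0)"
        then have "W i \<subseteq> {0}" by auto
        then have "vec.dim (W i) \<le> 0" using vec.dim_subset[of "W i" "{0}"] by simp
        then show False using W(2)[OF that] by simp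
      qed
      show "form_irreducible (D i - {0})" "form_closed (D i)" "scale_closed (D i)" if "i \<le> ?n * ?n - 1"
        using that subspace_form_cone[OF W(1)[of i]] Wne level_form_cone[of "i - q"] Nq by (auto simp: D_def)
      show "D i \<subset> D (Suc i)" if i: "i < ?n * ?n - 1"
      proof (cases "i < q")
        case True
        then show ?thesis using W(3)[of i] by (simp add: D_def)
      next
        case False
        then obtain r where r: "i = q + r" using le_Suc_ex[of q i] by auto
        have "r < s * (?n - s)" using i unfolding Nq r by simp
        then show ?thesis using level_strict[of r] D_ge[of r] D_ge[of "Suc r"] by (simp add: r)
      qed
    qed
    have level: "D (?n * ?n - 1 - s * (?n - k)) = kalman_cone s (std_flag k)" if k: "s \<le> k" "k \<le> ?n" for k
    proof -
      have "s * (?n - s) = s * (k - s) + s * (?n - k)"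
        using k by (simp flip: distrib_left)
      then have "?n * ?n - 1 - s * (?n - k) = q + s * (k - s)" unfolding Nq by simp
      then show ?thesis using D_ge[of "s * (k - s)"] level_mult[of "k - s"] k by simp
    qed
    then show "\<forall>k. s \<le> k \<longrightarrow> k \<le> ?n \<longrightarrow> D (?n * ?n - 1 - s * (?n - k)) = kalman_cone s (std_flag k)"
      by simp
    have "invariant A UNIV" for A :: "'a ^ 'n ^ 'n" by (simp add: invariant_def)
    then have "maxinv UNIV A = UNIV" for A :: "'a ^ 'n ^ 'n"
      using invariant_subset_maxinv[of A UNIV UNIV] by blast
    then have "kalman_cone s (UNIV :: ('a ^ 'n) set) = UNIV"
      using s(2) by (simp add: kalman_cone_def card_cart_basis)
    then show "D (?n * ?n - 1) = UNIV"
      using level[of ?n] s(2) std_flag_UNIV[of ?n] by simp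
  qed
qed

end

section \<open>Dimensions, singular loci and the theorem\<close>

text \<open>A basis whose first \<open>vec.dim L\<close> vectors span \<open>L\<close> makes
  \<open>L\<close> a member of the standard flag.\<close>

lemma kalman_flag:
  fixes L :: "('a::alg_closed_field ^ 'n::finite) set"
  assumes L: "vec.subspace L" and s: "1 \<le> s" "s \<le> vec.dim L"
  obtains D where "cone_flag D (CARD('n) * CARD('n) - 1)" "D (CARD('n) * CARD('n) - 1) = UNIV"
    "D (CARD('n) * CARD('n) - 1 - s * (CARD('n) - vec.dim L)) = kalman_cone s L"
proof -
  let ?d = "vec.dim L"
  have d: "?d \<le> CARD('n)" by (rule dim_subset_UNIV_cart_gen)
  obtain e :: "nat \<Rightarrow> 'n" where e: "bij_betw e {..<CARD('n)} UNIV"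
    using finite_same_card_bij[of "{..<CARD('n)}" "UNIV :: 'n set"] by auto
  have "card (e ` {..<?d}) = ?d"
    using e d by (subst card_image) (auto simp: bij_betw_def intro: inj_on_subset)
  then obtain G H :: "'a ^ 'n ^ 'n" where G: "G ** H = mat 1" "H ** G = mat 1"
    "(*v) G ` coord_subspace (e ` {..<?d}) = L"
    using adapted_basis1[OF L] by metis
  interpret adapted_flag G H e s
    by unfold_locales (use G e s d in auto)
  have "std_flag ?d = L" using G(3) by (simp add: std_flag_def)
  then show ?thesis using exists_cone_flag that assms(3) d by metis
qed

lemma projective_space_eq: "projective_space = projectivization UNIV"
  by (auto simp: projective_space_def projectivization_def)

lemma zdim_projective_space_kalman:
  fixes L :: "('a::alg_closed_field ^ 'n::finite) set"
  assumes L: "vec.subspace L" "1 \<le> vec.dim L"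
  shows "zdim (projective_space :: ('a ^ ('n \<times> 'n)) set set) = enat (CARD('n) * CARD('n) - 1)"
    and "s \<le> vec.dim L \<Longrightarrow> zdim (kalman s L) = enat (CARD('n) * CARD('n) - 1 - s * (CARD('n) - vec.dim L))"
proof -
  show proj: "zdim (projective_space :: ('a ^ ('n \<times> 'n)) set set) = enat (CARD('n) * CARD('n) - 1)"
  proof -
    obtain D :: "nat \<Rightarrow> ('a ^ ('n \<times> 'n)) set" where D: "cone_flag D (CARD('n) * CARD('n) - 1)"
      "D (CARD('n) * CARD('n) - 1) = UNIV"
      using kalman_flag[OF L(1) order_refl L(2)] by metis
    show ?thesis using cone_flag.zdim_eq[OF D(1) order_refl] unfolding D(2) projective_space_eq .
  qed
  assume s: "s \<le> vec.dim L"
  show "zdim (kalman s L) = enat (CARD('n) * CARD('n) - 1 - s * (CARD('n) - vec.dim L))"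
  \<comment> \<open>The flag construction asks for \<open>1 \<le> s\<close>; for
    \<open>s = 0\<close> the condition is void and the variety is all of projective space.\<close>
  proof (cases "s = 0")
    case True
    then have "kalman s L = projective_space"
      by (simp add: kalman_eq_projectivization[OF L(1)] kalman_cone_def projective_space_eq)
    then show ?thesis using proj True by simp
  next
    case False
    then have "1 \<le> s" by simp
    then obtain D where D: "cone_flag D (CARD('n) * CARD('n) - 1)"
      "D (CARD('n) * CARD('n) - 1 - s * (CARD('n) - vec.dim L)) = kalman_cone s L"
      using kalman_flag[OF L(1) _ s] by metis
    show ?thesis
      using cone_flag.zdim_eq[OF D(1) diff_le_self] unfolding D(2)[symmetric] kalman_eq_projectivization[OF L(1)] .
  qed
qed

text \<open>The local dimension is \<open>?N - ?c\<close> everywhere. The tangent dimension is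
  \<open>?N\<close> on the next Kalman cone and at most \<open>?N - ?c\<close> off it. The case
  \<open>s = vec.dim L\<close>, where the right-hand side is empty, is included.\<close>

lemma singular_locus_kalman:
  fixes L :: "('a::alg_closed_field ^ 'n::finite) set"
  assumes L: "vec.subspace L" "vec.dim L < CARD('n)" and s: "1 \<le> s" "s \<le> vec.dim L"
  shows "singular_locus (kalman s L) = kalman (s + 1) L"
proof -
  let ?N = "CARD('n) * CARD('n) - 1" and ?c = "s * (CARD('n) - vec.dim L)"
  let ?K = "projectivization (kalman_cone s L)"
  obtain D where D: "cone_flag D ?N" "D (?N - ?c) = kalman_cone s L"
    using kalman_flag[OF L(1) s] by metis
  have local: "local_dim ?K p = enat (?N - ?c)" if "p \<in> ?K" for p
    using cone_flag.local_dim_eq[OF D(1) diff_le_self, of p ?c] that unfolding D(2) by simp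
  \<comment> \<open>Both positivity facts make the truncated difference \<open>?N - ?c\<close>
    strictly smaller than \<open>?N\<close>.\<close>
  have c: "0 < ?c" using s L(2) by simp
  have N: "0 < ?N"
  proof -
    have "2 \<le> CARD('n)" using s L(2) by linarith
    then have "2 * 2 \<le> CARD('n) * CARD('n)" by (intro mult_le_mono)
    then show ?thesis by linarith
  qed
  show ?thesis
    unfolding kalman_eq_projectivization[OF L(1)]
  proof (intro equalityI subsetI)
    fix p assume p: "p \<in> singular_locus ?K"
    then have "p \<in> ?K" by (simp add: singular_locus_def)
    then obtain v where v: "v \<in> kalman_cone s L" "v \<noteq> 0" "p = vec.span {v}" by (auto simp: projectivization_def)
    have "local_dim ?K p < enat (tangent_dim ?K p)" using p by (simp only: singular_locus_def mem_Collect_eq)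
    then have "?N - ?c < tangent_dim ?K p" unfolding local[OF \<open>p \<in> ?K\<close>] by (simp only: enat_ord_simps)
    then have "v \<in> kalman_cone (Suc s) L"
      using tangent_dim_smooth[OF L(1) v(1) _ v(2)] v(3) by (force simp: not_le)
    then show "p \<in> projectivization (kalman_cone (s + 1) L)" using v by (auto simp: projectivization_def)
  next
    fix p assume "p \<in> projectivization (kalman_cone (s + 1) L)"
    then obtain v where v: "v \<in> kalman_cone (Suc s) L" "v \<noteq> 0" "p = vec.span {v}"
      by (auto simp: projectivization_def)
    then have "v \<in> kalman_cone s L" using kalman_cone_antimono[of s "Suc s" L] by auto
    then have pK: "p \<in> ?K" using v by (auto simp: projectivization_def)
    have tangent: "tangent_dim ?K p = ?N" using tangent_dim_kalman_Suc[OF L(1) v(1,2)] v(3) by simp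
    have "?N - ?c < ?N" using c N by (rule diff_less)
    then show "p \<in> singular_locus ?K"
      using pK unfolding singular_locus_def mem_Collect_eq local[OF pK] tangent by (simp only: enat_ord_simps)
  qed
qed

text \<open>An eigenvector spans an invariant line; conversely, a nonzero invariant subspace
  contains an eigenvector modulo the zero space.\<close>

lemma kalman_variety_eq:
  fixes L :: "('a::alg_closed_field ^ 'n::finite) set"
  assumes L: "vec.subspace L"
  shows "kalman_variety L = kalman 1 L"
proof -
  have "(\<exists>v\<in>L. v \<noteq> 0 \<and> (\<exists>c. A *v v = c *s v)) \<longleftrightarrow>
      (\<exists>U. vec.subspace U \<and> (\<forall>u\<in>U. A *v u \<in> U) \<and> 1 \<le> vec.dim U \<and> U \<subseteq> L)" for A :: "'a ^ 'n ^ 'n"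
  proof
    assume "\<exists>v\<in>L. v \<noteq> 0 \<and> (\<exists>c. A *v v = c *s v)"
    then obtain v c where v: "v \<in> L" "v \<noteq> 0" "A *v v = c *s v" by blast
    have "\<forall>u\<in>vec.span {v}. A *v u \<in> vec.span {v}"
      by (auto simp: vec.span_singleton vec.scale v(3))
    moreover have "vec.span {v} \<subseteq> L" using L v(1) by (intro vec.span_minimal) auto
    moreover have "1 \<le> vec.dim (vec.span {v})" using v(2) by simp
    ultimately show "\<exists>U. vec.subspace U \<and> (\<forall>u\<in>U. A *v u \<in> U) \<and> 1 \<le> vec.dim U \<and> U \<subseteq> L"
      by (intro exI[of _ "vec.span {v}"]) simp
  next
    assume "\<exists>U. vec.subspace U \<and> (\<forall>u\<in>U. A *v u \<in> U) \<and> 1 \<le> vec.dim U \<and> U \<subseteq> L"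
    then obtain U where U: "invariant A U" "1 \<le> vec.dim U" "U \<subseteq> L" by (auto simp: invariant_def)
    have zero: "invariant A {0}" by (simp add: invariant_def)
    have "{0} \<subseteq> U" using U(1) by (auto simp: invariant_def dest: vec.subspace_0)
    moreover have "U \<noteq> {0}" using U(2) by auto
    ultimately obtain v c where "v \<in> U" "v \<notin> {0}" "A *v v - c *s v \<in> {0}"
      using exists_eigenvector_modulo[OF zero U(1)] by (metis psubsetI)
    then show "\<exists>v\<in>L. v \<noteq> 0 \<and> (\<exists>c. A *v v = c *s v)" using U(3) by auto
  qed
  then show ?thesis by (simp add: kalman_variety_def kalman_def)
qed

theorem theorem4p4:
  fixes L :: "('a::alg_closed_field ^ 'n::finite) set" and d s :: nat
  assumes "d \<le> CARD('n) - 1"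
    and "vec.subspace L" and "vec.dim L = d"
    and "1 \<le> s" and "s \<le> d - 1"
  shows "kalman (s + 1) L = singular_locus (kalman s L)
    \<and> zcodim (kalman s L) projective_space = enat (s * (CARD('n) - d))
    \<and> zcodim (kalman s L) (kalman (s - 1) L) = enat (CARD('n) - d)
    \<and> kalman_variety L = kalman 1 L
    \<and> zcodim (singular_locus (kalman_variety L)) (kalman_variety L) = enat (CARD('n) - d)"
proof -
  let ?n = "CARD('n)" and ?N = "CARD('n) * CARD('n) - 1"
  have d: "2 \<le> d" "d < ?n" using assms by linarith+
  note zdim = zdim_projective_space_kalman[OF assms(2), unfolded assms(3)]
  \<comment> \<open>This keeps the truncated subtractions in the dimension formula exact, so that
    differences of dimensions are the expected codimensions.\<close>
  have small: "r * (?n - d) \<le> ?N" if "r \<le> d" for r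
  proof -
    have "r * (?n - d) \<le> d * (?n - d)" using that by (intro mult_le_mono1)
    also have "\<dots> < d * ?n" using d by simp
    also have "\<dots> \<le> ?n * ?n" using d by (intro mult_le_mono1) simp
    finally show ?thesis by linarith
  qed
  have step: "zcodim (kalman (Suc r) L) (kalman r L) = enat (?n - d)" if "Suc r \<le> d" for r
    using that d small[of "Suc r"] by (simp add: zcodim_def zdim)
  have sing: "singular_locus (kalman r L) = kalman (r + 1) L" if "1 \<le> r" "r \<le> d" for r
    using singular_locus_kalman[OF assms(2)] d assms(3) that by simp
  have "s \<le> d" using assms by linarith
  then have "zcodim (kalman s L) projective_space = enat (s * (?n - d))"
    using d by (simp only: zcodim_def zdim idiff_enat_enat diff_diff_cancel small)
  moreover have "zcodim (kalman s L) (kalman (s - 1) L) = enat (?n - d)"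
    using step[of "s - 1"] assms by simp
  \<comment> \<open>The singular locus is the second Kalman variety, and \<open>2 \<le> d\<close>
    allows the codimension step from the first to the second.\<close>
  moreover have "zcodim (singular_locus (kalman_variety L)) (kalman_variety L) = enat (?n - d)"
    unfolding kalman_variety_eq[OF assms(2)] using sing[of 1] step[of 1] d by simp
  ultimately show ?thesis
    using sing[of s] kalman_variety_eq[OF assms(2)] assms by simp
qed

end
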